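(* Consider $K\ge 2$-armed bandits with horizon $T\ge K$, and run Algorithm 1 (described in the context) with the log-barrier regularizer $\phi^t(p)=-C_{\log}\sum_{i\in[K]}\log p_i-\sum_{i\in[K]}\gamma^t_i\log p_i$ and parameters $C_{\log}=162$, $\alpha=0$, $\theta=\sqrt{1/\log T}$. Then against every environment, $\mathrm{Reg}^T=\mathcal{O}\big(\sqrt{KT\log T}\big)$. Simultaneously, whenever the environment satisfies the self-bounding condition with gap vector $\Delta$ and constant $C$ (see context), and $D$ is any real number with $\mathbb{E}\big[\sum_{t=1}^T\max_{i\in U}\mathbb{E}^t[\ell^t_i-\ell^t_{i^\star}]\big]\le D$, we have $$\mathrm{Reg}^T=\mathcal{O}\Big(\mathbb{G}\log T+\sqrt{C\,\mathbb{G}\log T}+\frac{K^2}{\sqrt{\log T}}+K\log T+D\Big).$$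
   Context: Multi-armed bandit protocol: arms $[K]=\{1,\dots,K\}$, rounds $t=1,\dots,T$. In each round the learner picks $i^t\in[K]$ while the environment (possibly adaptively, with knowledge of the learner's algorithm) picks $\ell^t\in[0,1]^K$; the learner suffers and observes only $\ell^t_{i^t}$. The pseudo-regret is $\mathrm{Reg}^T=\mathbb{E}\big[\sum_{t=1}^T\ell^t_{i^t}-\sum_{t=1}^T\ell^t_{i^\star}\big]$ where $i^\star\in\arg\min_{i\in[K]}\mathbb{E}[\sum_{t=1}^T\ell^t_i]$ and the expectation is over the randomness of learner and environment; $\mathbb{E}^t[\cdot]$ denotes expectation conditional on the history before round $t$. $\Omega_K$ is the probability simplex in $\mathbb{R}^K$. Algorithm 1 (FTRL) with parameters $\theta>0$, $\alpha\in[0,1]$, $C_{\log}>0$: for $t=1,\dots,T$, set learning rates $\gamma^t_i=\theta\sqrt{1+\sum_{\tau=1}^{t-1}(\max\{p^\tau_i,1/T\})^{1-2\alpha}}$, compute $p^t=\arg\min_{p\in\Omega_K}\{\langle p,\sum_{\tau<t}\hat\ell^\tau\rangle+\phi^t(p)\}$, draw $i^t\sim p^t$, observe $\ell^t_{i^t}$, and set $\hat\ell^t_i=\mathbb{1}\{i^t=i\}\ell^t_i/p^t_i$ for all $i$. Self-bounding (stochastic) condition: there exist $\Delta\in[0,1]^K$ and $C\ge0$ such that $\mathrm{Reg}^T\ge\mathbb{E}\big[\sum_{t=1}^T\sum_{i\in[K]}\Pr[i^t=i]\Delta_i\big]-C$. Then $U=\{i:\Delta_i=0\}$, $V=[K]\setminus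 U$, $\Delta_{\min}=\min_{i\in V}\Delta_i$, and $\mathbb{G}=\frac{|U|}{\Delta_{\min}}+\sum_{i\in V}\frac{1}{\Delta_i}$. $\mathcal{O}(\cdot)$ hides absolute constants. *)

theory Defs
  imports "HOL-Probability.Probability"
begin

text \<open>Arms are 0,...,K-1 and rounds are 0,...,T-1 (0-indexed).
  Probability vectors are functions nat => real, supported on arms < K.
  An observation history is the list of pairs (chosen arm, observed loss of the chosen arm).\<close>

definition open_simplex :: "nat \<Rightarrow> (nat \<Rightarrow> real) set" where
  "open_simplex K = {p. (\<forall>i<K. 0 < p i) \<and> (\<forall>i. K \<le> i \<longrightarrow> p i = 0) \<and> (\<Sum>i<K. p i) = 1}"

definition loss_est :: "nat \<times> real \<Rightarrow> (nat \<Rightarrow> real) \<Rightarrow> nat \<Rightarrow> real" where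
  "loss_est ob p i = (if fst ob = i then snd ob / p i else 0)"

definition lrate :: "nat \<Rightarrow> real \<Rightarrow> real \<Rightarrow> (nat \<Rightarrow> real) list \<Rightarrow> nat \<Rightarrow> real" where
  "lrate T \<theta> \<alpha> ps i =
     \<theta> * sqrt (1 + (\<Sum>\<tau><length ps. (max ((ps ! \<tau>) i) (1 / real T)) powr (1 - 2 * \<alpha>)))"

definition logbarrier_reg :: "nat \<Rightarrow> real \<Rightarrow> (nat \<Rightarrow> real) \<Rightarrow> (nat \<Rightarrow> real) \<Rightarrow> real" where
  "logbarrier_reg K Clog \<gamma> p = - Clog * (\<Sum>i<K. ln (p i)) - (\<Sum>i<K. \<gamma> i * ln (p i))"

text \<open>One FTRL step: given the observations of rounds 1..t-1 (obs, at least t-1 long) and the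
  probability vectors ps = [p^1,...,p^(t-1)], compute p^t as the minimiser over the simplex of
  <p, cumulative estimated loss> + phi^t(p).  Since the log barrier tends to +infinity at the
  boundary, the minimiser lies in the relative interior, over which we minimise.\<close>
definition ftrl_step :: "nat \<Rightarrow> nat \<Rightarrow> real \<Rightarrow> real \<Rightarrow> real \<Rightarrow> (nat \<times> real) list
    \<Rightarrow> (nat \<Rightarrow> real) list \<Rightarrow> (nat \<Rightarrow> real)" where
  "ftrl_step K T \<theta> \<alpha> Clog obs ps =
    (let Lhat = (\<lambda>i. \<Sum>\<tau><length ps. loss_est (obs ! \<tau>) (ps ! \<tau>) i);
         obj = (\<lambda>p. (\<Sum>i<K. p i * Lhat i) + logbarrier_reg K Clog (lrate T \<theta> \<alpha> ps) p)
     in THE p. p \<in> open_simplex K \<and> (\<forall>q\<in>open_simplex K. obj p \<le> obj q))"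

primrec ftrl_plist :: "nat \<Rightarrow> nat \<Rightarrow> real \<Rightarrow> real \<Rightarrow> real \<Rightarrow> (nat \<times> real) list
    \<Rightarrow> nat \<Rightarrow> (nat \<Rightarrow> real) list" where
  "ftrl_plist K T \<theta> \<alpha> Clog obs 0 = []"
| "ftrl_plist K T \<theta> \<alpha> Clog obs (Suc n) =
     (let ps = ftrl_plist K T \<theta> \<alpha> Clog obs n in ps @ [ftrl_step K T \<theta> \<alpha> Clog obs ps])"

definition ftrl_prob :: "nat \<Rightarrow> nat \<Rightarrow> real \<Rightarrow> real \<Rightarrow> real \<Rightarrow> (nat \<times> real) list \<Rightarrow> (nat \<Rightarrow> real)" where
  "ftrl_prob K T \<theta> \<alpha> Clog obs = last (ftrl_plist K T \<theta> \<alpha> Clog obs (Suc (length obs)))"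

text \<open>A trajectory is a pair (arms, losses): fst w t = arm chosen in round t,
  snd w t = loss vector chosen by the environment in round t.\<close>
type_synonym traj = "(nat \<Rightarrow> nat) \<times> (nat \<Rightarrow> nat \<Rightarrow> real)"

definition traj_space :: "traj measure" where
  "traj_space = PiM UNIV (\<lambda>_. count_space UNIV) \<Otimes>\<^sub>M PiM UNIV (\<lambda>_. PiM UNIV (\<lambda>_. (borel :: real measure)))"

definition hist_alg :: "nat set \<Rightarrow> nat set \<Rightarrow> traj measure" where
  "hist_alg A B = vimage_algebra (space traj_space)
     (\<lambda>w. (restrict (fst w) A, restrict (snd w) B))
     (PiM A (\<lambda>_. count_space UNIV) \<Otimes>\<^sub>M PiM B (\<lambda>_. PiM UNIV (\<lambda>_. (borel :: real measure))))"

definition hist_before :: "nat \<Rightarrow> traj measure" where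
  "hist_before t = hist_alg {..<t} {..<t}"

text \<open>History before round t together with the loss vector of round t (what the environment
  has fixed when the learner draws its arm in round t).\<close>
definition hist_env :: "nat \<Rightarrow> traj measure" where
  "hist_env t = hist_alg {..<t} {..<Suc t}"

definition observations :: "nat \<Rightarrow> traj \<Rightarrow> (nat \<times> real) list" where
  "observations t w = map (\<lambda>\<tau>. (fst w \<tau>, snd w \<tau> (fst w \<tau>))) [0..<t]"

text \<open>M is the law of a run of Algorithm 1 (parameters theta, alpha, C_log) for T rounds with K
  arms against some (possibly randomized, adaptive) environment with losses in [0,1]:
  in each round t the environment's loss vector may depend arbitrarily on the past and on
  fresh randomness, and conditionally on the past and on the current loss vector the learner's
  arm is drawn from p^t.\<close>
definition ftrl_run :: "nat \<Rightarrow> nat \<Rightarrow> real \<Rightarrow> real \<Rightarrow> real \<Rightarrow> traj measure \<Rightarrow> bool" where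
  "ftrl_run K T \<theta> \<alpha> Clog M \<longleftrightarrow>
     prob_space M \<and> sets M = sets traj_space \<and>
     (AE w in M. \<forall>t<T. \<forall>i<K. 0 \<le> snd w t i \<and> snd w t i \<le> 1) \<and>
     (\<forall>t<T. \<forall>i<K. \<forall>E\<in>sets (hist_env t).
        measure M (E \<inter> {w\<in>space M. fst w t = i}) =
        (\<integral>w\<in>E. ftrl_prob K T \<theta> \<alpha> Clog (observations t w) i \<partial>M))"

definition cum_loss_arm :: "nat \<Rightarrow> nat \<Rightarrow> traj \<Rightarrow> real" where
  "cum_loss_arm T i w = (\<Sum>t<T. snd w t i)"

definition pseudo_regret :: "nat \<Rightarrow> nat \<Rightarrow> traj measure \<Rightarrow> real" where
  "pseudo_regret K T M =
     (\<integral>w. (\<Sum>t<T. snd w t (fst w t)) \<partial>M) - Min ((\<lambda>i. \<integral>w. cum_loss_arm T i w \<partial>M) ` {..<K})"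

definition is_best_arm :: "nat \<Rightarrow> nat \<Rightarrow> traj measure \<Rightarrow> nat \<Rightarrow> bool" where
  "is_best_arm K T M istar \<longleftrightarrow> istar < K \<and>
     (\<forall>i<K. (\<integral>w. cum_loss_arm T istar w \<partial>M) \<le> (\<integral>w. cum_loss_arm T i w \<partial>M))"

definition self_bounding :: "nat \<Rightarrow> nat \<Rightarrow> traj measure \<Rightarrow> (nat \<Rightarrow> real) \<Rightarrow> real \<Rightarrow> bool" where
  "self_bounding K T M \<Delta> C \<longleftrightarrow> (\<forall>i<K. 0 \<le> \<Delta> i \<and> \<Delta> i \<le> 1) \<and> 0 \<le> C \<and>
     pseudo_regret K T M \<ge>
       (\<Sum>t<T. \<Sum>i<K. measure M {w\<in>space M. fst w t = i} * \<Delta> i) - C"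

definition opt_arms :: "nat \<Rightarrow> (nat \<Rightarrow> real) \<Rightarrow> nat set" where
  "opt_arms K \<Delta> = {i. i < K \<and> \<Delta> i = 0}"

definition subopt_arms :: "nat \<Rightarrow> (nat \<Rightarrow> real) \<Rightarrow> nat set" where
  "subopt_arms K \<Delta> = {i. i < K \<and> \<Delta> i \<noteq> 0}"

definition gap_complexity :: "nat \<Rightarrow> (nat \<Rightarrow> real) \<Rightarrow> real" where
  "gap_complexity K \<Delta> =
     real (card (opt_arms K \<Delta>)) / Min (\<Delta> ` subopt_arms K \<Delta>)
     + (\<Sum>i\<in>subopt_arms K \<Delta>. 1 / \<Delta> i)"

definition opt_deviation :: "nat \<Rightarrow> nat \<Rightarrow> traj measure \<Rightarrow> (nat \<Rightarrow> real) \<Rightarrow> nat \<Rightarrow> traj \<Rightarrow> real" where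
  "opt_deviation K T M \<Delta> istar w =
     (\<Sum>t<T. if opt_arms K \<Delta> = {} then 0 else
        Max ((\<lambda>i. real_cond_exp M (hist_before t) (\<lambda>v. snd v t i - snd v t istar) w) ` opt_arms K \<Delta>))"

end

theory Submission
  imports Defs
begin

text \<open>The FTRL iterate \<open>p\<close> is compared with the virtual iterate \<open>q\<close> that minimises the same objective
  over the simplex of a set \<open>U\<close> of arms (the optimal arms, or a single best arm). Both have the form
  \<open>\<Gamma> i / (L i + \<lambda>)\<close>, so \<open>p \<le> q\<close> on \<open>U\<close>. With the gap between the two optimal values as potential,
  increasing the learning rates costs nothing, and to leading order the terminal potential only
  involves the learning rates outside \<open>U\<close>. In the stability terms the contributions of \<open>p\<close> and \<open>q\<close> on \<open>U\<close> cancel up to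
  terms controlled by the mass that \<open>p\<close> puts outside \<open>U\<close>. So the regret against \<open>q\<close> is at most
  \<open>sqrt (ln T)\<close> times square roots of the numbers of pulls outside \<open>U\<close>, plus lower-order terms, and
  the self-bounding condition absorbs these. Since \<open>q\<close> is predictable and supported on \<open>U\<close>, its own
  regret is bounded by the deviation among the optimal arms.\<close>

subsection \<open>The log-barrier minimiser\<close>

text \<open>The self-bounding condition controls the pulls outside \<open>U\<close> only, so no
  leading term in the pulls of an optimal arm may survive. The usual FTRL bound against a fixed
  point has such terms, both in the stability and in the penalty; an iterate that moves along on
  \<open>U\<close> removes them. The cancellation rests on conservation of mass: raising one loss
  moves the multiplier, and the drop of that coordinate is proportional to a harmonic sum
  \<open>x * y / (x + y)\<close> of weights, monotone in both arguments. Since \<open>p\<close>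
  \<le> \<open>q\<close> on \<open>U\<close>, the sum for all arms can exceed the one for
  \<open>U\<close> only through the weights outside \<open>U\<close>, and this excess is what is
  paid. In the stability part the arms of \<open>U\<close> split the payment in proportions that sum
  to one, so \<open>card U\<close> enters there only by Cauchy-Schwarz: the origin of the summand
  |U| / \<Delta>_min in the gap complexity. Rates of at least 2, guaranteed by the constant
  \<open>C\<close>, keep every probability within the needed factor 2 during one importance-weighted
  update. Stability carries 1 / \<theta>, the terminal penalty \<theta> ln T; \<theta> = 1 / sqrt
  (ln T) gives both the order sqrt (ln T).\<close>

definition lb_obj :: "'a set \<Rightarrow> ('a \<Rightarrow> real) \<Rightarrow> ('a \<Rightarrow> real) \<Rightarrow> ('a \<Rightarrow> real) \<Rightarrow> real" where
  "lb_obj A \<Gamma> L p = (\<Sum>i\<in>A. p i * L i - \<Gamma> i * ln (p i))"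

text \<open>The Lagrange multiplier of the constraint that the masses sum to one. Positive
  denominators single out the branch on which the root is unique.\<close>

definition lb_mult :: "'a set \<Rightarrow> ('a \<Rightarrow> real) \<Rightarrow> ('a \<Rightarrow> real) \<Rightarrow> real" where
  "lb_mult A \<Gamma> L = (THE x. (\<forall>i\<in>A. 0 < L i + x) \<and> (\<Sum>i\<in>A. \<Gamma> i / (L i + x)) = 1)"

text \<open>The value 0 outside \<open>A\<close> lets a minimiser over a subset act as a
  distribution on all arms.\<close>

definition lb_argmin :: "'a set \<Rightarrow> ('a \<Rightarrow> real) \<Rightarrow> ('a \<Rightarrow> real) \<Rightarrow> 'a \<Rightarrow> real" where
  "lb_argmin A \<Gamma> L i = (if i \<in> A then \<Gamma> i / (L i + lb_mult A \<Gamma> L) else 0)"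

definition lb_min :: "'a set \<Rightarrow> ('a \<Rightarrow> real) \<Rightarrow> ('a \<Rightarrow> real) \<Rightarrow> real" where
  "lb_min A \<Gamma> L = lb_obj A \<Gamma> L (lb_argmin A \<Gamma> L)"

lemma scaled_inverse_diff:
  fixes x y c :: real
  assumes "0 < x" "0 < y" "0 < c"
  shows "c / y - c / x = (c / x) * (c / y) / c * (x - y)"
  using assms by (simp add: field_simps)

locale log_barrier =
  fixes A :: "'a set" and \<Gamma> :: "'a \<Rightarrow> real"
  assumes finite_A: "finite A" and nonempty_A: "A \<noteq> {}" and pos_\<Gamma>: "\<And>i. i \<in> A \<Longrightarrow> 0 < \<Gamma> i"
begin

lemma sum_strict_antimono:
  assumes "\<forall>i\<in>A. 0 < L i + x" "x < y"
  shows "(\<Sum>i\<in>A. \<Gamma> i / (L i + y)) < (\<Sum>i\<in>A. \<Gamma> i / (L i + x))"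
proof (rule sum_strict_mono[OF finite_A nonempty_A])
  fix i assume "i \<in> A"
  then show "\<Gamma> i / (L i + y) < \<Gamma> i / (L i + x)"
    using assms pos_\<Gamma>[of i] by (intro divide_strict_left_mono mult_pos_pos) force+
qed

text \<open>The sum decreases strictly in \<open>x\<close> while all denominators are positive. At
  \<open>x0\<close> the arm of least loss alone contributes 1; at \<open>x1\<close> every
  denominator is at least \<open>sum \<Gamma> A\<close>, so the sum is at most 1.\<close>

lemma lb_mult_ex1: "\<exists>!x. (\<forall>i\<in>A. 0 < L i + x) \<and> (\<Sum>i\<in>A. \<Gamma> i / (L i + x)) = 1"
proof -
  define m where "m = Min (L ` A)"
  have m: "m \<le> L i" if "i \<in> A" for i
    using that finite_A by (simp add: m_def)
  have "m \<in> L ` A"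
    using finite_A nonempty_A by (auto simp: m_def)
  then obtain j where j: "j \<in> A" "m = L j"
    by blast
  define x0 where "x0 = \<Gamma> j - m"
  define x1 where "x1 = sum \<Gamma> A - m"
  have \<Gamma>j: "0 < \<Gamma> j" "\<Gamma> j \<le> sum \<Gamma> A"
    using j pos_\<Gamma> finite_A by (auto intro!: member_le_sum simp: less_imp_le)
  have pos: "0 < L i + x" if "i \<in> A" "x0 \<le> x" for i x
    using m[OF that(1)] that(2) \<Gamma>j by (simp add: x0_def)
  have "\<exists>x. x0 \<le> x \<and> x \<le> x1 \<and> (\<Sum>i\<in>A. \<Gamma> i / (L i + x)) = 1"
  proof (rule IVT2')
    have "\<Gamma> j / (L j + x0) \<le> (\<Sum>i\<in>A. \<Gamma> i / (L i + x0))"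
      by (rule member_le_sum)
         (use j finite_A pos[of _ x0] pos_\<Gamma> in \<open>auto intro!: divide_nonneg_pos less_imp_le\<close>)
    then show "1 \<le> (\<Sum>i\<in>A. \<Gamma> i / (L i + x0))"
      using j \<Gamma>j by (simp add: x0_def)
    have "(\<Sum>i\<in>A. \<Gamma> i / (L i + x1)) \<le> (\<Sum>i\<in>A. \<Gamma> i / sum \<Gamma> A)"
    proof (rule sum_mono)
      fix i assume i: "i \<in> A"
      have "sum \<Gamma> A \<le> L i + x1"
        using m[OF i] by (simp add: x1_def)
      then show "\<Gamma> i / (L i + x1) \<le> \<Gamma> i / sum \<Gamma> A"
        using \<Gamma>j pos_\<Gamma>[OF i] by (intro divide_left_mono) auto
    qed
    also have "\<dots> = 1"
      using \<Gamma>j by (simp flip: sum_divide_distrib)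
    finally show "(\<Sum>i\<in>A. \<Gamma> i / (L i + x1)) \<le> 1" .
    show "x0 \<le> x1" using \<Gamma>j by (simp add: x0_def x1_def)
    show "continuous_on {x0..x1} (\<lambda>x. \<Sum>i\<in>A. \<Gamma> i / (L i + x))"
      by (intro continuous_intros) (use pos in force)
  qed
  then obtain x where x: "\<forall>i\<in>A. 0 < L i + x" "(\<Sum>i\<in>A. \<Gamma> i / (L i + x)) = 1"
    using pos by blast
  show ?thesis
  proof (rule ex1I[of _ x])
    fix y assume y: "(\<forall>i\<in>A. 0 < L i + y) \<and> (\<Sum>i\<in>A. \<Gamma> i / (L i + y)) = 1"
    show "y = x"
      using sum_strict_antimono[of L x y] sum_strict_antimono[of L y x] x y
      by (cases x y rule: linorder_cases) auto
  qed (use x in auto)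
qed

lemma lb_mult_pos: "i \<in> A \<Longrightarrow> 0 < L i + lb_mult A \<Gamma> L"
  and lb_mult_sum: "(\<Sum>i\<in>A. \<Gamma> i / (L i + lb_mult A \<Gamma> L)) = 1"
  using theI'[OF lb_mult_ex1[of L]] by (auto simp: lb_mult_def)

text \<open>Turns a statement about an implicit root into explicit inequalities. The comparisons of
  multipliers and the measurability of the multiplier rest on it.\<close>

lemma lb_mult_le_iff:
  "lb_mult A \<Gamma> L \<le> x \<longleftrightarrow> (\<forall>i\<in>A. 0 < L i + x) \<and> (\<Sum>i\<in>A. \<Gamma> i / (L i + x)) \<le> 1"
proof
  assume le: "lb_mult A \<Gamma> L \<le> x"
  have "(\<Sum>i\<in>A. \<Gamma> i / (L i + x)) \<le> 1"
    using sum_strict_antimono[of L "lb_mult A \<Gamma> L" x] lb_mult_pos[of _ L] lb_mult_sum[of L] le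
    by (cases "x = lb_mult A \<Gamma> L") auto
  then show "(\<forall>i\<in>A. 0 < L i + x) \<and> (\<Sum>i\<in>A. \<Gamma> i / (L i + x)) \<le> 1"
    using lb_mult_pos[of _ L] le by fastforce
next
  assume "(\<forall>i\<in>A. 0 < L i + x) \<and> (\<Sum>i\<in>A. \<Gamma> i / (L i + x)) \<le> 1"
  then show "lb_mult A \<Gamma> L \<le> x"
    using sum_strict_antimono[of L x "lb_mult A \<Gamma> L"] lb_mult_sum[of L] by force
qed

lemma lb_argmin_pos: "i \<in> A \<Longrightarrow> 0 < lb_argmin A \<Gamma> L i"
  using lb_mult_pos[of i L] pos_\<Gamma>[of i] by (simp add: lb_argmin_def)

lemma lb_argmin_nonneg: "0 \<le> lb_argmin A \<Gamma> L i"
  using lb_argmin_pos[of i L] by (cases "i \<in> A") (auto simp: lb_argmin_def)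

lemma lb_argmin_sum: "(\<Sum>i\<in>A. lb_argmin A \<Gamma> L i) = 1"
  using lb_mult_sum[of L] by (simp add: lb_argmin_def)

lemma lb_argmin_le_1: "lb_argmin A \<Gamma> L i \<le> 1"
proof (cases "i \<in> A")
  case True
  then have "lb_argmin A \<Gamma> L i \<le> (\<Sum>i\<in>A. lb_argmin A \<Gamma> L i)"
    using finite_A lb_argmin_nonneg by (intro member_le_sum) auto
  then show ?thesis by (simp add: lb_argmin_sum)
qed (simp add: lb_argmin_def)

lemma inverse_lb_argmin: "i \<in> A \<Longrightarrow> 1 / lb_argmin A \<Gamma> L i = (L i + lb_mult A \<Gamma> L) / \<Gamma> i"
  by (simp add: lb_argmin_def)

text \<open>The tangent inequality \<open>ln x \<le> x - 1\<close> at \<open>x = q i / p i\<close>, weighted by \<open>\<Gamma> i\<close>, sums up to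
  optimality because \<open>\<Gamma> i / p i - L i\<close> does not depend on \<open>i\<close>.\<close>

lemma lb_obj_diff_eq:
  assumes q: "\<And>i. i \<in> A \<Longrightarrow> 0 < q i" "(\<Sum>i\<in>A. q i) = 1"
  shows "lb_obj A \<Gamma> L q - lb_min A \<Gamma> L =
    (\<Sum>i\<in>A. \<Gamma> i * (q i / lb_argmin A \<Gamma> L i - 1 - ln (q i / lb_argmin A \<Gamma> L i)))"
proof -
  let ?p = "lb_argmin A \<Gamma> L" and ?m = "lb_mult A \<Gamma> L"
  have "\<Gamma> i * (q i / ?p i - 1 - ln (q i / ?p i)) =
      (q i * L i - \<Gamma> i * ln (q i)) - (?p i * L i - \<Gamma> i * ln (?p i)) + ?m * (q i - ?p i)"
    if i: "i \<in> A" for i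
  proof -
    have 1: "\<Gamma> i * (q i / ?p i) = q i * L i + ?m * q i"
      using pos_\<Gamma>[OF i] lb_mult_pos[OF i, of L] i by (simp add: lb_argmin_def field_simps)
    have "?p i * (L i + ?m) = \<Gamma> i"
      using lb_mult_pos[OF i, of L] i by (simp add: lb_argmin_def)
    then have 2: "\<Gamma> i = ?p i * L i + ?m * ?p i"
      by (simp add: algebra_simps)
    have 3: "ln (q i / ?p i) = ln (q i) - ln (?p i)"
      using q(1)[OF i] lb_argmin_pos[OF i, of L] by (simp add: ln_div)
    have "\<Gamma> i * (q i / ?p i - 1 - ln (q i / ?p i)) =
        \<Gamma> i * (q i / ?p i) - \<Gamma> i - \<Gamma> i * ln (q i) + \<Gamma> i * ln (?p i)"
      unfolding 3 by (simp add: algebra_simps)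
    also have "\<dots> = q i * L i + ?m * q i - (?p i * L i + ?m * ?p i) - \<Gamma> i * ln (q i) + \<Gamma> i * ln (?p i)"
      using 1 2 by linarith
    finally show ?thesis by (simp add: algebra_simps)
  qed
  then have "(\<Sum>i\<in>A. \<Gamma> i * (q i / ?p i - 1 - ln (q i / ?p i))) =
      (\<Sum>i\<in>A. (q i * L i - \<Gamma> i * ln (q i)) - (?p i * L i - \<Gamma> i * ln (?p i)) + ?m * (q i - ?p i))"
    by simp
  also have "\<dots> = lb_obj A \<Gamma> L q - lb_min A \<Gamma> L + ?m * ((\<Sum>i\<in>A. q i) - (\<Sum>i\<in>A. ?p i))"
    by (simp only: lb_obj_def lb_min_def sum.distrib sum_subtractf flip: sum_distrib_left)
  finally show ?thesis by (simp add: q lb_argmin_sum)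
qed

lemma lb_min_le:
  assumes q: "\<And>i. i \<in> A \<Longrightarrow> 0 < q i" "(\<Sum>i\<in>A. q i) = 1"
  shows "lb_min A \<Gamma> L \<le> lb_obj A \<Gamma> L q"
proof -
  have "0 \<le> (\<Sum>i\<in>A. \<Gamma> i * (q i / lb_argmin A \<Gamma> L i - 1 - ln (q i / lb_argmin A \<Gamma> L i)))"
    using q lb_argmin_pos pos_\<Gamma>
    by (intro sum_nonneg mult_nonneg_nonneg) (auto simp: less_imp_le ln_le_minus_one)
  then show ?thesis using lb_obj_diff_eq[of q L] q by simp
qed

text \<open>Every summand of the excess is nonnegative and vanishes only at ratio 1. Uniqueness
  matters because the algorithm picks its vector by a definite description.\<close>

lemma lb_argmin_unique:
  assumes q: "\<And>i. i \<in> A \<Longrightarrow> 0 < q i" "(\<Sum>i\<in>A. q i) = 1" and opt: "lb_obj A \<Gamma> L q \<le> lb_min A \<Gamma> L"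
    and i: "i \<in> A"
  shows "q i = lb_argmin A \<Gamma> L i"
proof -
  let ?r = "\<lambda>i. q i / lb_argmin A \<Gamma> L i"
  have nn: "0 \<le> \<Gamma> i * (?r i - 1 - ln (?r i))" if "i \<in> A" for i
    using that q lb_argmin_pos pos_\<Gamma>
    by (intro mult_nonneg_nonneg) (auto simp: less_imp_le ln_le_minus_one)
  have "(\<Sum>i\<in>A. \<Gamma> i * (?r i - 1 - ln (?r i))) = 0"
    using lb_obj_diff_eq[of q L] lb_min_le[of q L] q opt by simp
  then have "\<Gamma> i * (?r i - 1 - ln (?r i)) = 0"
    using nn i finite_A by (simp add: sum_nonneg_eq_0_iff)
  then have "ln (?r i) = ?r i - 1"
    using pos_\<Gamma>[OF i] by simp
  then have "?r i = 1"
    using q(1)[OF i] lb_argmin_pos[OF i, of L] by (intro ln_eq_minus_one) auto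
  then show ?thesis using lb_argmin_pos[OF i, of L] by simp
qed

text \<open>Both bounds test a candidate in \<open>lb_mult_le_iff\<close>: at the old multiplier the
  denominators have only grown, and at the new multiplier plus \<open>a\<close> the old denominators
  are at least the new ones.\<close>

lemma lb_mult_shift:
  assumes i: "i \<in> A" and a: "0 \<le> a"
  shows "lb_mult A \<Gamma> (L(i := L i + a)) \<le> lb_mult A \<Gamma> L"
    and "lb_mult A \<Gamma> L \<le> lb_mult A \<Gamma> (L(i := L i + a)) + a"
proof -
  let ?L = "L(i := L i + a)"
  have "0 < ?L j + lb_mult A \<Gamma> L" if "j \<in> A" for j
    using lb_mult_pos[OF that, of L] a by auto
  moreover have "(\<Sum>j\<in>A. \<Gamma> j / (?L j + lb_mult A \<Gamma> L)) \<le> (\<Sum>j\<in>A. \<Gamma> j / (L j + lb_mult A \<Gamma> L))"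
  proof (rule sum_mono)
    fix j assume "j \<in> A"
    then show "\<Gamma> j / (?L j + lb_mult A \<Gamma> L) \<le> \<Gamma> j / (L j + lb_mult A \<Gamma> L)"
      using a lb_mult_pos[of j L] pos_\<Gamma>[of j] by (intro frac_le) auto
  qed
  ultimately show "lb_mult A \<Gamma> ?L \<le> lb_mult A \<Gamma> L"
    by (subst lb_mult_le_iff) (auto simp: lb_mult_sum)
  have le: "?L j + lb_mult A \<Gamma> ?L \<le> L j + (lb_mult A \<Gamma> ?L + a)" for j
    using a by auto
  have "(\<Sum>j\<in>A. \<Gamma> j / (L j + (lb_mult A \<Gamma> ?L + a))) \<le> (\<Sum>j\<in>A. \<Gamma> j / (?L j + lb_mult A \<Gamma> ?L))"
  proof (rule sum_mono)
    fix j assume "j \<in> A"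
    then show "\<Gamma> j / (L j + (lb_mult A \<Gamma> ?L + a)) \<le> \<Gamma> j / (?L j + lb_mult A \<Gamma> ?L)"
      using le[of j] lb_mult_pos[of j ?L] pos_\<Gamma>[of j] by (intro frac_le) auto
  qed
  moreover have "0 < L j + (lb_mult A \<Gamma> ?L + a)" if "j \<in> A" for j
    using lb_mult_pos[OF that, of ?L] le[of j] by linarith
  ultimately show "lb_mult A \<Gamma> L \<le> lb_mult A \<Gamma> ?L + a"
    by (subst lb_mult_le_iff) (auto simp only: lb_mult_sum)
qed

section \<open>Raising the loss of a single arm\<close>

context
  fixes L L' :: "'a \<Rightarrow> real" and i :: 'a and a :: real and p p' :: "'a \<Rightarrow> real"
  assumes i: "i \<in> A" and a: "0 \<le> a"
  defines "L' \<equiv> L(i := L i + a)" and "p \<equiv> lb_argmin A \<Gamma> L" and "p' \<equiv> lb_argmin A \<Gamma> L'"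
begin

lemma shift_le: "p' i \<le> p i"
  unfolding p_def p'_def lb_argmin_def
  using i lb_mult_shift[OF i a, of L] pos_\<Gamma>[OF i] lb_mult_pos[OF i, of L]
  by (auto simp: L'_def intro!: frac_le)

lemma shift_ge: "j \<noteq> i \<Longrightarrow> p j \<le> p' j"
  unfolding p_def p'_def lb_argmin_def
  using lb_mult_shift[OF i a, of L] pos_\<Gamma>[of j] lb_mult_pos[of j L']
  by (auto simp: L'_def intro!: frac_le)

lemma shift_diff_self:
  "p i - p' i = p i * p' i / \<Gamma> i * (a - (lb_mult A \<Gamma> L - lb_mult A \<Gamma> L'))"
proof -
  have "p i - p' i = p' i * p i / \<Gamma> i * ((L' i + lb_mult A \<Gamma> L') - (L i + lb_mult A \<Gamma> L))"
    unfolding p_def p'_def lb_argmin_def if_P[OF i]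
    using i lb_mult_pos pos_\<Gamma> by (intro scaled_inverse_diff) blast+
  also have "(L' i + lb_mult A \<Gamma> L') - (L i + lb_mult A \<Gamma> L) = a - (lb_mult A \<Gamma> L - lb_mult A \<Gamma> L')"
    by (simp add: L'_def)
  finally show ?thesis by (simp only: mult.commute)
qed

lemma shift_diff_other:
  assumes "j \<in> A" "j \<noteq> i"
  shows "p' j - p j = p j * p' j / \<Gamma> j * (lb_mult A \<Gamma> L - lb_mult A \<Gamma> L')"
proof -
  have "p' j - p j = p j * p' j / \<Gamma> j * ((L j + lb_mult A \<Gamma> L) - (L' j + lb_mult A \<Gamma> L'))"
    unfolding p_def p'_def lb_argmin_def if_P[OF assms(1)]
    using assms lb_mult_pos pos_\<Gamma> by (intro scaled_inverse_diff) blast+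
  also have "(L j + lb_mult A \<Gamma> L) - (L' j + lb_mult A \<Gamma> L') = lb_mult A \<Gamma> L - lb_mult A \<Gamma> L'"
    using assms by (simp add: L'_def)
  finally show ?thesis .
qed

text \<open>Both minimisers have total mass one, which determines the change of the multiplier; the
  change of the \<open>i\<close>-th coordinate becomes a harmonic sum of the weights.\<close>

lemma shift_diff_harmonic:
  "p i - p' i = a * (p i * p' i / \<Gamma> i * (\<Sum>j\<in>A-{i}. p j * p' j / \<Gamma> j)
     / (p i * p' i / \<Gamma> i + (\<Sum>j\<in>A-{i}. p j * p' j / \<Gamma> j)))"
proof -
  define d where "d = lb_mult A \<Gamma> L - lb_mult A \<Gamma> L'"
  define x where "x = p i * p' i / \<Gamma> i"
  define y where "y = (\<Sum>j\<in>A-{i}. p j * p' j / \<Gamma> j)"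
  have x: "0 < x"
    using i lb_argmin_pos pos_\<Gamma> by (simp add: x_def p_def p'_def)
  have y: "0 \<le> y"
    unfolding y_def p_def p'_def using lb_argmin_pos pos_\<Gamma> by (intro sum_nonneg) (auto simp: less_imp_le)
  have "(\<Sum>j\<in>A-{i}. p' j - p j) = y * d"
    unfolding y_def sum_distrib_right by (intro sum.cong) (use shift_diff_other d_def in auto)
  moreover have "(\<Sum>j\<in>A. p j) = 1" "(\<Sum>j\<in>A. p' j) = 1"
    by (simp_all add: p_def p'_def lb_argmin_sum)
  ultimately have "p i - p' i = y * d"
    using i finite_A by (simp add: sum.remove[of A i] sum_subtractf)
  moreover have xd: "p i - p' i = x * (a - d)"
    using shift_diff_self by (simp add: x_def d_def)
  ultimately have "d * (x + y) = a * x"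
    by (simp add: algebra_simps)
  then have "d = a * x / (x + y)"
    using x y by (simp add: field_simps)
  moreover have "p i - p' i = y * d" by fact
  ultimately have "p i - p' i = a * (x * y / (x + y))"
    by (simp add: mult.commute)
  then show ?thesis by (simp add: x_def y_def)
qed

text \<open>The multiplier does not increase, so dropping its change leaves the usual local-norm
  stability bound of the log barrier.\<close>

lemma shift_diff_le: "p i - p' i \<le> a * (p i)\<^sup>2 / \<Gamma> i"
proof -
  have "p i - p' i \<le> p i * p' i / \<Gamma> i * a"
    unfolding shift_diff_self using lb_mult_shift[OF i a, of L] i lb_argmin_pos pos_\<Gamma>
    by (intro mult_left_mono) (auto simp: L'_def p_def p'_def less_imp_le)
  also have "\<dots> \<le> p i * p i / \<Gamma> i * a"
    using shift_le i lb_argmin_pos pos_\<Gamma> a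
    by (intro mult_right_mono divide_right_mono mult_left_mono) (auto simp: p_def less_imp_le)
  finally show ?thesis by (simp add: power2_eq_square mult_ac)
qed

text \<open>Reciprocal probabilities are affine in loss plus multiplier. \<open>1 / p i\<close> is
  the largest importance-weighted estimate of a loss in [0,1], so the reciprocal grows by at most
  its own size.\<close>

lemma shift_self_factor:
  assumes "2 \<le> \<Gamma> i" "a \<le> 1 / p i"
  shows "p i \<le> 2 * p' i"
proof -
  have pp: "0 < p i" "0 < p' i" using i lb_argmin_pos by (auto simp: p_def p'_def)
  have "1 / p' i = (L i + a + lb_mult A \<Gamma> L') / \<Gamma> i"
    using inverse_lb_argmin[OF i, of L'] by (simp add: p'_def L'_def)
  also have "\<dots> \<le> (L i + a + lb_mult A \<Gamma> L) / \<Gamma> i"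
    using lb_mult_shift[OF i a, of L] assms by (intro divide_right_mono) (auto simp: L'_def)
  also have "\<dots> = 1 / p i + a / \<Gamma> i"
    using inverse_lb_argmin[OF i, of L] by (simp add: p_def add_divide_distrib)
  also have "a / \<Gamma> i \<le> (1 / p i) / 1"
    using assms a pp by (intro frac_le) auto
  finally have "1 / p' i \<le> 2 / p i" by simp
  then show ?thesis using pp by (simp add: field_simps)
qed

text \<open>If \<open>j\<close> is no likelier than \<open>i\<close>, the multiplier drops by at
  most \<open>a\<close> \<le> \<open>1 / p j\<close>, and a rate of at least 2 keeps half of the
  reciprocal. If \<open>j\<close> is likelier, it gains no more than the mass lost by
  \<open>i\<close>, which is below \<open>p j\<close>.\<close>

lemma shift_other_factor:
  assumes j: "j \<in> A" "j \<noteq> i" and "2 \<le> \<Gamma> j" "a \<le> 1 / p i"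
  shows "p' j \<le> 2 * p j"
proof (cases "p j \<le> p i")
  case True
  have pp: "0 < p i" "0 < p j" "0 < p' j" using i j lb_argmin_pos by (auto simp: p_def p'_def)
  have "1 / p' j = (L j + lb_mult A \<Gamma> L') / \<Gamma> j"
    using inverse_lb_argmin[OF j(1), of L'] j by (simp add: p'_def L'_def)
  also have "\<dots> \<ge> (L j + lb_mult A \<Gamma> L - a) / \<Gamma> j"
    using lb_mult_shift[OF i a, of L] assms by (intro divide_right_mono) (auto simp: L'_def)
  also have "(L j + lb_mult A \<Gamma> L - a) / \<Gamma> j = 1 / p j - a / \<Gamma> j"
    using inverse_lb_argmin[OF j(1), of L] by (simp add: p_def diff_divide_distrib)
  finally have 1: "1 / p j - a / \<Gamma> j \<le> 1 / p' j" .
  have "1 / p i \<le> 1 / p j" using True pp by (intro divide_left_mono) auto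
  then have "a / \<Gamma> j \<le> (1 / p j) / 2"
    using assms a pp by (intro frac_le) auto
  with 1 have "1 / (2 * p j) \<le> 1 / p' j" by simp
  then show ?thesis using pp by (simp add: field_simps)
next
  case False
  have "p' j - p j \<le> (\<Sum>j\<in>A-{i}. p' j - p j)"
    using shift_ge finite_A j by (intro member_le_sum) auto
  also have "\<dots> = p i - p' i"
    using i finite_A lb_argmin_sum[of L] lb_argmin_sum[of L']
    by (simp add: sum.remove[of A i] sum_subtractf p_def p'_def)
  also have "\<dots> \<le> p i" using i lb_argmin_pos[of i L'] by (simp add: p'_def)
  finally show ?thesis using False by simp
qed

end

end

subsection \<open>Comparison with the virtual minimiser\<close>

text \<open>Both functions are compared with the Riemann sums of their supergradients over a uniform
  partition; the error telescopes. In this form no differentiability is needed.\<close>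

lemma concave_increment_le:
  fixes F G x y :: "real \<Rightarrow> real"
  assumes F: "\<And>s s'. s \<in> {0..1} \<Longrightarrow> s' \<in> {0..1} \<Longrightarrow> F s' \<le> F s + (s' - s) * x s"
    and G: "\<And>s s'. s \<in> {0..1} \<Longrightarrow> s' \<in> {0..1} \<Longrightarrow> G s' \<le> G s + (s' - s) * y s"
    and le: "\<And>s. s \<in> {0..1} \<Longrightarrow> y s \<le> x s + c"
  shows "G 1 - G 0 \<le> F 1 - F 0 + c"
proof (rule field_le_epsilon)
  fix e :: real assume e: "0 < e"
  obtain n :: nat where n: "\<bar>x 1 - x 0\<bar> / e < real n" using reals_Archimedean2 by blast
  have "0 \<le> \<bar>x 1 - x 0\<bar> / e" using e by simp
  with n have n0: "0 < n" by linarith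
  have step: "(G (real (Suc k) / n) - F (real (Suc k) / n)) - (G (real k / n) - F (real k / n))
      \<le> (x (real k / n) - x (real (Suc k) / n)) / n + c / n" if "k < n" for k
  proof -
    have in01: "real k / n \<in> {0..1}" "real (Suc k) / n \<in> {0..1}"
      using that n0 by auto
    have d: "real (Suc k) / n - real k / n = 1 / n" "real k / n - real (Suc k) / n = - (1 / n)"
      using n0 by (simp_all add: field_simps)
    \<comment> \<open>The supergradient of \<open>G\<close> is taken at the left end of the interval
      and that of \<open>F\<close> at the right end; the mismatch is a difference of consecutive
      values of \<open>x\<close>.\<close>
    have "G (real (Suc k) / n) \<le> G (real k / n) + 1 / n * y (real k / n)"
      using G[OF in01] by (simp only: d)
    moreover have "F (real k / n) \<le> F (real (Suc k) / n) - 1 / n * x (real (Suc k) / n)"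
      using F[OF in01(2,1), unfolded d(2)] by simp
    moreover have "1 / n * y (real k / n) \<le> 1 / n * (x (real k / n) + c)"
      using le[OF in01(1)] by (intro mult_left_mono) auto
    ultimately show ?thesis by (simp add: diff_divide_distrib add_divide_distrib)
  qed
  have "(\<Sum>k<n. (G (real (Suc k) / n) - F (real (Suc k) / n)) - (G (real k / n) - F (real k / n)))
      \<le> (\<Sum>k<n. (x (real k / n) - x (real (Suc k) / n)) / n + c / n)"
    using step by (intro sum_mono) auto
  also have "\<dots> = (\<Sum>k<n. x (real k / n) - x (real (Suc k) / n)) / n + c"
    using n0 by (simp add: sum.distrib flip: sum_divide_distrib)
  also have "(\<Sum>k<n. x (real k / n) - x (real (Suc k) / n)) = x 0 - x 1"
    using n0 sum_lessThan_telescope'[of "\<lambda>k. x (real k / n)" n] by simp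
  also have "(\<Sum>k<n. (G (real (Suc k) / n) - F (real (Suc k) / n)) - (G (real k / n) - F (real k / n)))
      = (G 1 - F 1) - (G 0 - F 0)"
    using n0 sum_lessThan_telescope[of "\<lambda>k. G (real k / n) - F (real k / n)" n] by simp
  also have "(x 0 - x 1) / n \<le> e"
  proof -
    have "\<bar>x 1 - x 0\<bar> \<le> e * n" using n e by (simp add: field_simps)
    then show ?thesis using n0 by (simp add: field_simps)
  qed
  finally show "G 1 - G 0 \<le> F 1 - F 0 + c + e" by simp
qed

text \<open>The harmonic sum is monotone in both arguments, so its value at \<open>(x, A)\<close> is
  at most the one at \<open>(v, C)\<close>. What remains is the exact increment caused by adding
  \<open>B\<close> to the second argument.\<close>

lemma harmonic_increment_le:
  fixes x v A B C :: real
  assumes "0 < x" "x \<le> v" "0 \<le> A" "A \<le> C" "0 \<le> B"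
  shows "x * (A + B) / (x + (A + B)) - v * C / (v + C) \<le> x * (x / (x + A)) * (B / (x + A + B))"
proof -
  have 1: "x * A / (x + A) \<le> v * C / (v + C)"
  proof (cases "A = 0")
    case False
    then have A: "0 < A" "0 < C" "0 < v" using assms by auto
    have "A * (x * v) \<le> C * (x * v)" "x * (A * C) \<le> v * (A * C)"
      using assms A by (intro mult_right_mono; simp)+
    then have "x * A * (v + C) \<le> v * C * (x + A)" by (simp add: algebra_simps)
    then show ?thesis using assms A by (simp add: divide_simps)
  qed (use assms in auto)
  have "x * (A + B) / (x + (A + B)) - x * A / (x + A) = x * (x / (x + A)) * (B / (x + A + B))"
  proof -
    have "x + A > 0" "x + A + B > 0" using assms by auto
    then show ?thesis by (simp add: divide_simps) (simp add: algebra_simps)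
  qed
  with 1 show ?thesis by linarith
qed

locale log_barrier_pair =
  fixes A U :: "'a set" and \<Gamma> :: "'a \<Rightarrow> real"
  assumes finite_A: "finite A" and U_sub: "U \<subseteq> A" and nonempty_U: "U \<noteq> {}"
    and \<Gamma>_ge: "\<And>i. i \<in> A \<Longrightarrow> 2 \<le> \<Gamma> i"
begin

sublocale A: log_barrier A \<Gamma>
  using finite_A U_sub nonempty_U \<Gamma>_ge by unfold_locales fastforce+

sublocale U: log_barrier U \<Gamma>
  using A.finite_A U_sub nonempty_U A.pos_\<Gamma> by unfold_locales (auto intro: finite_subset)

abbreviation "P \<equiv> lb_argmin A \<Gamma>"
abbreviation "Q \<equiv> lb_argmin U \<Gamma>"

text \<open>At the multiplier of \<open>A\<close> the arms of \<open>U\<close> carry only part of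
  the unit mass.\<close>

lemma lb_mult_le: "lb_mult U \<Gamma> L \<le> lb_mult A \<Gamma> L"
proof -
  have "(\<Sum>i\<in>U. \<Gamma> i / (L i + lb_mult A \<Gamma> L)) \<le> (\<Sum>i\<in>A. \<Gamma> i / (L i + lb_mult A \<Gamma> L))"
    using A.finite_A U_sub A.lb_mult_pos A.pos_\<Gamma>
    by (intro sum_mono2) (auto intro!: divide_nonneg_pos less_imp_le)
  then show ?thesis
    using U_sub A.lb_mult_pos A.lb_mult_sum by (subst U.lb_mult_le_iff) auto
qed

lemma P_le_Q: "i \<in> U \<Longrightarrow> P L i \<le> Q L i"
  using U_sub lb_mult_le[of L] U.lb_mult_pos[of i L] A.pos_\<Gamma>[of i]
  by (auto simp: lb_argmin_def intro!: frac_le)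

definition "weight L i = (P L i)\<^sup>2 / \<Gamma> i"
definition "off_mass L = (\<Sum>j\<in>A-U. P L j)"
definition "off_rate L = (\<Sum>j\<in>A-U. P L j / \<Gamma> j)"

text \<open>This bounds \<open>P L i\<close> times the stability cost of a round in which \<open>i \<in> U\<close> is drawn.\<close>
definition "U_cost L i = weight L i / (\<Sum>j\<in>U. weight L j) *
   ((if P L i \<le> off_mass L then P L i / \<Gamma> i else 0) + 4 * off_rate L)"

lemma weight_pos: "i \<in> A \<Longrightarrow> 0 < weight L i"
  using A.lb_argmin_pos[of i L] A.pos_\<Gamma>[of i] by (simp add: weight_def)

lemma off_mass_nonneg: "0 \<le> off_mass L"
  by (simp add: off_mass_def sum_nonneg A.lb_argmin_nonneg)

lemma off_rate_nonneg: "0 \<le> off_rate L"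
  using A.pos_\<Gamma> by (auto simp: off_rate_def less_imp_le intro!: sum_nonneg divide_nonneg_pos A.lb_argmin_nonneg)

lemma sum_off_weight_le: "(\<Sum>j\<in>A-U. weight L j) \<le> off_mass L * off_rate L"
  unfolding off_rate_def sum_distrib_left
proof (rule sum_mono)
  fix j assume j: "j \<in> A - U"
  then have "P L j \<le> off_mass L"
    unfolding off_mass_def using finite_A A.lb_argmin_nonneg by (intro member_le_sum) auto
  then have "P L j * (P L j / \<Gamma> j) \<le> off_mass L * (P L j / \<Gamma> j)"
    using j A.lb_argmin_nonneg A.pos_\<Gamma>[of j] by (intro mult_right_mono) auto
  then show "weight L j \<le> off_mass L * (P L j / \<Gamma> j)"
    by (simp add: weight_def power2_eq_square)
qed

text \<open>Both drops are harmonic sums, with weights \<open>u\<close> for \<open>P\<close> and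
  \<open>v\<close> for \<open>Q\<close>; as \<open>u\<close> \<le> \<open>v\<close> on
  \<open>U\<close>, only the weight \<open>B\<close> outside \<open>U\<close> is charged. The
  weights \<open>u\<close> involve the shifted iterate. The factor-two lemmas trade them for
  \<open>w\<close>, which depends on \<open>L\<close> alone, so one coefficient of \<open>a\<close>
  serves along the whole segment of shifts.\<close>

lemma shift_drift_le:
  assumes i: "i \<in> U" and a: "0 \<le> a" "a \<le> 1 / P L i"
  shows "(P L i - P (L(i := L i + a)) i) - (Q L i - Q (L(i := L i + a)) i) \<le> a * (P L i * U_cost L i)"
proof -
  define p p' q q' where "p = P L" "p' = P (L(i := L i + a))" "q = Q L" "q' = Q (L(i := L i + a))"
  note pdefs = this
  have iA: "i \<in> A" using i U_sub by auto
  have pos: "0 < p j" "0 < p' j" "0 < \<Gamma> j" if "j \<in> A" for j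
    using that A.lb_argmin_pos A.pos_\<Gamma> by (auto simp: pdefs)
  have pq: "p j \<le> q j" "p' j \<le> q' j" if "j \<in> U" for j
    using that P_le_Q by (auto simp: pdefs)
  define u where "u j = p j * p' j / \<Gamma> j" for j
  define v where "v j = q j * q' j / \<Gamma> j" for j
  have u_pos: "0 < u j" if "j \<in> A" for j using pos[OF that] by (simp add: u_def)
  have uv: "u j \<le> v j" if "j \<in> U" for j
    unfolding u_def v_def using that pos[of j] pq[of j] U_sub
    by (intro divide_right_mono mult_mono) auto
  define S where "S = (\<Sum>j\<in>U-{i}. u j)"
  define B where "B = (\<Sum>j\<in>A-U. u j)"
  have A_split: "(\<Sum>j\<in>A-{i}. u j) = S + B"
  proof -
    have "A - {i} = (U - {i}) \<union> (A - U)" using U_sub i by auto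
    then show ?thesis
      unfolding S_def B_def using finite_A U.finite_A by (simp add: sum.union_disjoint Int_Diff_disjoint[symmetric] inf_commute Diff_Int_distrib)
  qed
  have S0: "0 \<le> S" unfolding S_def using u_pos U_sub by (intro sum_nonneg) (auto intro!: less_imp_le)
  have B0: "0 \<le> B" unfolding B_def using u_pos by (intro sum_nonneg) (auto intro!: less_imp_le)
  define w where "w = weight L"
  have wdef: "w j = p j * p j / \<Gamma> j" for j by (simp add: w_def weight_def power2_eq_square pdefs)
  have w_pos: "0 < w j" if "j \<in> A" for j using weight_pos that by (simp add: w_def)
  define W where "W = (\<Sum>j\<in>U. w j)"
  have W: "W = w i + (\<Sum>j\<in>U-{i}. w j)"
    unfolding W_def using i by (rule sum.remove[OF U.finite_A])
  have R0: "0 \<le> (\<Sum>j\<in>U-{i}. w j)" using w_pos U_sub by (intro sum_nonneg) (auto intro!: less_imp_le)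
  have ui_le: "u i \<le> w i"
    unfolding u_def wdef using A.shift_le[OF iA a(1), of L] pos[OF iA]
    by (intro divide_right_mono mult_left_mono) (auto simp: pdefs)
  have S_ge: "(\<Sum>j\<in>U-{i}. w j) \<le> S"
    unfolding S_def u_def wdef using A.shift_ge[OF iA a(1), of _ L] pos U_sub
    by (intro sum_mono divide_right_mono mult_left_mono) (auto simp: pdefs less_imp_le subset_iff)
  have wi_le: "w i \<le> 2 * u i"
  proof -
    have "p i * p i / \<Gamma> i \<le> p i * (2 * p' i) / \<Gamma> i"
      using A.shift_self_factor[OF iA a(1) \<Gamma>_ge[OF iA] a(2)] pos[OF iA]
      by (intro divide_right_mono mult_left_mono) (auto simp: pdefs)
    then show ?thesis by (simp add: u_def wdef mult_ac)
  qed
  have B_le: "B \<le> 2 * (\<Sum>j\<in>A-U. w j)"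
    unfolding B_def sum_distrib_left
  proof (rule sum_mono)
    fix j assume j: "j \<in> A - U"
    then have "p j * p' j / \<Gamma> j \<le> p j * (2 * p j) / \<Gamma> j"
      using A.shift_other_factor[OF iA a(1) _ _ \<Gamma>_ge a(2), of j] pos[of j] i
      by (intro divide_right_mono mult_left_mono) (auto simp: pdefs)
    then show "u j \<le> 2 * w j" by (simp add: u_def wdef mult_ac)
  qed
  \<comment> \<open>The shift lowers the weight of \<open>i\<close> and raises the others in
    \<open>U\<close>, so the share of \<open>i\<close> is largest before the shift. The unshifted
    shares sum to one over \<open>U\<close>.\<close>
  have frac: "u i / (u i + S) \<le> w i / W"
  proof -
    have "u i * (\<Sum>j\<in>U-{i}. w j) \<le> w i * S"
      using ui_le S_ge u_pos[OF iA] R0 by (intro mult_mono) auto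
    then have "u i * W \<le> w i * (u i + S)" by (simp add: W algebra_simps)
    moreover have "0 < W" "0 < u i + S" using W w_pos[OF iA] R0 u_pos[OF iA] S0 by auto
    ultimately show ?thesis by (simp add: divide_simps)
  qed
  \<comment> \<open>An arm lighter than \<open>off_mass\<close> pays its full weight. A heavier one
    pays \<open>B\<close>, which is at most \<open>off_mass\<close> times \<open>off_rate\<close> up
    to constants, and \<open>off_mass\<close> is then below \<open>p i\<close>. The 4 combines the
    factor 2 from \<open>u i\<close> to \<open>w i\<close> with the factor 2 on the arms outside
    \<open>U\<close>.\<close>
  have cost: "w i * (B / (u i + S + B)) \<le> p i * ((if p i \<le> off_mass L then p i / \<Gamma> i else 0) + 4 * off_rate L)"
  proof (cases "p i \<le> off_mass L")
    case True
    have "B / (u i + S + B) \<le> 1" using u_pos[OF iA] S0 B0 by simp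
    then have "w i * (B / (u i + S + B)) \<le> w i * 1"
      using w_pos[OF iA] by (intro mult_left_mono) auto
    also have "\<dots> \<le> p i * (p i / \<Gamma> i + 4 * off_rate L)"
      using pos[OF iA] off_rate_nonneg[of L] by (simp add: wdef distrib_left)
    finally show ?thesis using True by simp
  next
    case False
    have "B / (u i + S + B) \<le> B / u i"
      using u_pos[OF iA] S0 B0 by (intro divide_left_mono) auto
    then have "w i * (B / (u i + S + B)) \<le> 2 * u i * (B / u i)"
      using wi_le w_pos[OF iA] u_pos[OF iA] S0 B0 by (intro mult_mono) auto
    also have "\<dots> = 2 * B" using u_pos[OF iA] by simp
    also have "\<dots> \<le> 4 * (off_mass L * off_rate L)"
      using B_le sum_off_weight_le[of L] by (simp add: w_def)
    also have "\<dots> \<le> 4 * (p i * off_rate L)"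
      using False off_rate_nonneg[of L] by (intro mult_left_mono mult_right_mono) auto
    finally show ?thesis using False by simp
  qed
  have "(p i - p' i) - (q i - q' i)
     = a * (u i * (S + B) / (u i + (S + B)) - v i * (\<Sum>j\<in>U-{i}. v j) / (v i + (\<Sum>j\<in>U-{i}. v j)))"
    using A.shift_diff_harmonic[OF iA a(1), of L] U.shift_diff_harmonic[OF i a(1), of L]
    unfolding A_split[symmetric] by (simp add: pdefs u_def v_def right_diff_distrib)
  also have "\<dots> \<le> a * (u i * (u i / (u i + S)) * (B / (u i + S + B)))"
  proof (intro mult_left_mono a(1) harmonic_increment_le)
    show "S \<le> (\<Sum>j\<in>U-{i}. v j)" unfolding S_def using uv by (intro sum_mono) auto
  qed (use u_pos[OF iA] uv[OF i] S0 B0 in auto)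
  also have "u i * (u i / (u i + S)) * (B / (u i + S + B)) \<le> w i * (w i / W) * (B / (u i + S + B))"
    using ui_le frac u_pos[OF iA] w_pos[OF iA] S0 B0 by (intro mult_right_mono mult_mono) auto
  also have "\<dots> = w i / W * (w i * (B / (u i + S + B)))" by simp
  also have "\<dots> \<le> w i / W * (p i * ((if p i \<le> off_mass L then p i / \<Gamma> i else 0) + 4 * off_rate L))"
    using cost W R0 w_pos[OF iA] by (intro mult_left_mono) auto
  also have "\<dots> = p i * U_cost L i"
    by (simp add: U_cost_def W_def w_def pdefs)
  finally show ?thesis using a(1) by (simp add: pdefs mult_left_mono)
qed

definition "gap L = lb_min A \<Gamma> L - lb_min U \<Gamma> L"

end

section \<open>Optimal values as potentials, one round of play\<close>

context log_barrier
begin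

text \<open>Envelope argument: the minimiser for \<open>s\<close> is feasible for \<open>s'\<close>.
  So the probability of \<open>i\<close> is a supergradient of the optimal value in the loss of
  \<open>i\<close>.\<close>

lemma lb_min_shift:
  assumes i: "i \<in> A"
  shows "lb_min A \<Gamma> (L(i := L i + s')) \<le> lb_min A \<Gamma> (L(i := L i + s)) + (s' - s) * lb_argmin A \<Gamma> (L(i := L i + s)) i"
proof -
  let ?p = "lb_argmin A \<Gamma> (L(i := L i + s))"
  have "lb_min A \<Gamma> (L(i := L i + s')) \<le> lb_obj A \<Gamma> (L(i := L i + s')) ?p"
    by (intro lb_min_le lb_argmin_pos lb_argmin_sum)
  also have "\<dots> = lb_min A \<Gamma> (L(i := L i + s)) + (s' - s) * ?p i"
    unfolding lb_obj_def lb_min_def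
    by (simp add: sum.remove[OF finite_A i] algebra_simps)
  finally show ?thesis .
qed

text \<open>The same argument in the rates, where the supergradient is minus the logarithm of the
  probability.\<close>

lemma lb_min_rate:
  assumes \<Gamma>': "\<And>i. i \<in> A \<Longrightarrow> 0 < \<Gamma>' i"
  shows "lb_min A \<Gamma>' L \<le> lb_min A \<Gamma> L - (\<Sum>i\<in>A. (\<Gamma>' i - \<Gamma> i) * ln (lb_argmin A \<Gamma> L i))"
proof -
  interpret \<Gamma>': log_barrier A \<Gamma>'
    using finite_A nonempty_A \<Gamma>' by unfold_locales
  have "lb_min A \<Gamma>' L \<le> lb_obj A \<Gamma>' L (lb_argmin A \<Gamma> L)"
    by (intro \<Gamma>'.lb_min_le lb_argmin_pos lb_argmin_sum)
  also have "\<dots> = lb_min A \<Gamma> L - (\<Sum>i\<in>A. (\<Gamma>' i - \<Gamma> i) * ln (lb_argmin A \<Gamma> L i))"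
    unfolding lb_obj_def lb_min_def sum_subtractf[symmetric] by (simp add: algebra_simps)
  finally show ?thesis .
qed

end

context log_barrier_pair
begin

text \<open>One round of FTRL against the virtual FTRL on \<open>U\<close>, when arm \<open>i\<close> is drawn and incurs loss
  \<open>x\<close>; \<open>x / P L i\<close> is the importance-weighted estimate.\<close>

lemma step_U:
  assumes i: "i \<in> U" and x: "0 \<le> x" "x \<le> 1"
  shows "x / P L i * (P L i - Q L i) \<le> gap (L(i := L i + x / P L i)) - gap L + U_cost L i / P L i"
proof -
  have iA: "i \<in> A" using i U_sub by auto
  have p: "0 < P L i" using iA A.lb_argmin_pos by auto
  define a where "a = x / P L i"
  have a: "0 \<le> a" "a \<le> 1 / P L i" using x p by (auto simp: a_def divide_right_mono)
  have cost: "0 \<le> U_cost L i"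
    unfolding U_cost_def using iA weight_pos U_sub off_rate_nonneg[of L] p A.pos_\<Gamma>[OF iA]
    by (intro mult_nonneg_nonneg divide_nonneg_nonneg sum_nonneg add_nonneg_nonneg)
       (auto simp: less_imp_le subset_iff)
  let ?L = "\<lambda>s. L(i := L i + s * a)"
  have "lb_min U \<Gamma> (?L 1) - lb_min U \<Gamma> (?L 0) \<le> lb_min A \<Gamma> (?L 1) - lb_min A \<Gamma> (?L 0)
      + (a * (Q L i - P L i) + a * (a * (P L i * U_cost L i)))"
  \<comment> \<open>The loss estimate is added gradually. The supergradients of the two optimal
    values differ by their initial difference plus the drift; the drift costs two factors
    \<open>a\<close>, each at most the inverse probability.\<close>
  proof (rule concave_increment_le[where x = "\<lambda>s. a * P (?L s) i" and y = "\<lambda>s. a * Q (?L s) i"])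
    fix s s' :: real
    show "lb_min A \<Gamma> (?L s') \<le> lb_min A \<Gamma> (?L s) + (s' - s) * (a * P (?L s) i)"
      using A.lb_min_shift[OF iA, of L "s' * a" "s * a"] by (simp add: algebra_simps)
    show "lb_min U \<Gamma> (?L s') \<le> lb_min U \<Gamma> (?L s) + (s' - s) * (a * Q (?L s) i)"
      using U.lb_min_shift[OF i, of L "s' * a" "s * a"] by (simp add: algebra_simps)
  next
    fix s :: real assume s: "s \<in> {0..1}"
    then have sa: "0 \<le> s * a" "s * a \<le> a" using a by (auto simp: mult_left_le_one_le)
    have "(P L i - P (?L s) i) - (Q L i - Q (?L s) i) \<le> (s * a) * (P L i * U_cost L i)"
      using sa a by (intro shift_drift_le[OF i]) auto
    also have "\<dots> \<le> a * (P L i * U_cost L i)"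
      using sa p cost by (intro mult_right_mono) auto
    finally have "a * Q (?L s) i \<le> a * (P (?L s) i + (Q L i - P L i) + a * (P L i * U_cost L i))"
      using a by (intro mult_left_mono) auto
    then show "a * Q (?L s) i \<le> a * P (?L s) i + (a * (Q L i - P L i) + a * (a * (P L i * U_cost L i)))"
      by (simp add: algebra_simps)
  qed
  moreover have "a * (a * (P L i * U_cost L i)) \<le> U_cost L i / P L i"
  proof -
    have "a * (a * (P L i * U_cost L i)) \<le> 1 / P L i * (1 / P L i * (P L i * U_cost L i))"
      using a p cost by (intro mult_mono) auto
    then show ?thesis using p by simp
  qed
  ultimately show ?thesis
    by (simp add: gap_def a_def[symmetric] algebra_simps)
qed

text \<open>Outside \<open>U\<close> the virtual iterate has no mass and its optimal value does not
  see the loss. Only the ordinary FTRL stability term remains, and \<open>a * P L i\<close> \<le> 1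
  bounds it.\<close>

lemma step_V:
  assumes i: "i \<in> A - U" and x: "0 \<le> x" "x \<le> 1"
  shows "x / P L i * (P L i - Q L i) \<le> gap (L(i := L i + x / P L i)) - gap L + 1 / \<Gamma> i"
proof -
  have iA: "i \<in> A" using i by auto
  have p: "0 < P L i" using iA A.lb_argmin_pos by auto
  define a where "a = x / P L i"
  have a: "0 \<le> a" "a * P L i \<le> 1" using x p by (auto simp: a_def)
  let ?L = "L(i := L i + a)"
  have Q0: "Q L i = 0" using i by (simp add: lb_argmin_def)
  have mult: "lb_mult U \<Gamma> ?L = lb_mult U \<Gamma> L"
  proof -
    have "?L j = L j" if "j \<in> U" for j using that i by auto
    then show ?thesis unfolding lb_mult_def by simp
  qed
  have U: "lb_min U \<Gamma> ?L = lb_min U \<Gamma> L"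
    using i unfolding lb_min_def lb_obj_def by (intro sum.cong) (auto simp: lb_argmin_def mult)
  have "lb_min A \<Gamma> L \<le> lb_min A \<Gamma> ?L - a * P ?L i"
    using A.lb_min_shift[OF iA, of L 0 a] by simp
  moreover have "a * (P L i - P ?L i) \<le> 1 / \<Gamma> i"
  proof -
    have "a * (P L i - P ?L i) \<le> a * (a * (P L i)\<^sup>2 / \<Gamma> i)"
      using A.shift_diff_le[OF iA a(1), of L] a by (intro mult_left_mono)
    also have "\<dots> = (a * P L i)\<^sup>2 / \<Gamma> i"
      by (simp add: power2_eq_square)
    also have "\<dots> \<le> 1 / \<Gamma> i"
      using a p A.pos_\<Gamma>[OF iA] by (intro divide_right_mono power_le_one) auto
    finally show ?thesis .
  qed
  ultimately have "a * P L i \<le> lb_min A \<Gamma> ?L - lb_min A \<Gamma> L + 1 / \<Gamma> i"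
    by (simp add: right_diff_distrib)
  then show ?thesis
    by (simp add: gap_def a_def[symmetric] U Q0)
qed

text \<open>The gap between the two optimal values is nondecreasing in every learning rate, since \<open>P\<close> lies
  below \<open>Q\<close> on \<open>U\<close> and below \<open>1\<close> outside: changing the learning rates costs nothing.\<close>

lemma gap_mono_rate:
  assumes \<Gamma>': "\<And>i. i \<in> A \<Longrightarrow> \<Gamma> i \<le> \<Gamma>' i"
  shows "gap L \<le> lb_min A \<Gamma>' L - lb_min U \<Gamma>' L"
proof -
  define G where "G s i = \<Gamma> i + s * (\<Gamma>' i - \<Gamma> i)" for s i
  have pair: "log_barrier_pair A U (G s)" if "s \<in> {0..1}" for s
  proof
    fix i assume "i \<in> A"
    then show "2 \<le> G s i"
      using that \<Gamma>_ge[of i] \<Gamma>'[of i] by (auto simp: G_def intro: add_increasing2)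
  qed (use finite_A U_sub nonempty_U in auto)
  let ?D = "\<lambda>i. \<Gamma>' i - \<Gamma> i"
  have diff: "G s' i - G s i = (s' - s) * ?D i" for s s' i
    by (simp add: G_def algebra_simps)
  have "lb_min U (G 1) L - lb_min U (G 0) L \<le> lb_min A (G 1) L - lb_min A (G 0) L + 0"
  proof (rule concave_increment_le[where x = "\<lambda>s. - (\<Sum>i\<in>A. ?D i * ln (lb_argmin A (G s) L i))"
      and y = "\<lambda>s. - (\<Sum>i\<in>U. ?D i * ln (lb_argmin U (G s) L i))"])
    fix s s' :: real assume s: "s \<in> {0..1}" "s' \<in> {0..1}"
    interpret s: log_barrier_pair A U "G s" using s by (intro pair)
    interpret s': log_barrier_pair A U "G s'" using s by (intro pair)
    show "lb_min A (G s') L \<le> lb_min A (G s) L + (s' - s) * - (\<Sum>i\<in>A. ?D i * ln (lb_argmin A (G s) L i))"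
      using s.A.lb_min_rate[where \<Gamma>' = "G s'" and L = L, OF s'.A.pos_\<Gamma>] by (simp add: diff sum_distrib_left mult.assoc)
    show "lb_min U (G s') L \<le> lb_min U (G s) L + (s' - s) * - (\<Sum>i\<in>U. ?D i * ln (lb_argmin U (G s) L i))"
      using s.U.lb_min_rate[where \<Gamma>' = "G s'" and L = L, OF s'.U.pos_\<Gamma>] by (simp add: diff sum_distrib_left mult.assoc)
  next
    fix s :: real assume s: "s \<in> {0..1}"
    interpret s: log_barrier_pair A U "G s" using s by (intro pair)
    have "(\<Sum>i\<in>A. ?D i * ln (s.P L i)) = (\<Sum>i\<in>A-U. ?D i * ln (s.P L i)) + (\<Sum>i\<in>U. ?D i * ln (s.P L i))"
      by (rule sum.subset_diff[OF U_sub finite_A])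
    also have "\<dots> \<le> 0 + (\<Sum>i\<in>U. ?D i * ln (s.Q L i))"
    proof (rule add_mono)
      show "(\<Sum>i\<in>A-U. ?D i * ln (s.P L i)) \<le> 0"
        using \<Gamma>' s.A.lb_argmin_pos s.A.lb_argmin_le_1
        by (intro sum_nonpos mult_nonneg_nonpos) (auto simp: ln_le_zero_iff)
      show "(\<Sum>i\<in>U. ?D i * ln (s.P L i)) \<le> (\<Sum>i\<in>U. ?D i * ln (s.Q L i))"
      proof (intro sum_mono mult_left_mono)
        fix i assume i: "i \<in> U"
        then have "0 < s.P L i" using U_sub s.A.lb_argmin_pos by auto
        then show "ln (s.P L i) \<le> ln (s.Q L i)" using s.P_le_Q[OF i, of L] by (simp add: ln_mono)
        show "0 \<le> ?D i" using \<Gamma>'[of i] i U_sub by auto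
      qed
    qed
    finally show "- (\<Sum>i\<in>U. ?D i * ln (s.Q L i)) \<le> - (\<Sum>i\<in>A. ?D i * ln (s.P L i)) + 0"
      by simp
  qed
  moreover have "G 1 = \<Gamma>'" "G 0 = \<Gamma>" by (auto simp: G_def)
  ultimately show ?thesis by (simp add: gap_def)
qed

text \<open>\<open>P\<close> restricted to \<open>U\<close> and renormalised is feasible over
  \<open>U\<close>. Renormalising only raises the logarithms, and the barrier terms dropped outside
  \<open>U\<close> are nonnegative because \<open>P\<close> \<le> 1. This starts the
  telescoping.\<close>

lemma gap_zero_nonneg: "0 \<le> gap (\<lambda>_. 0)"
proof -
  let ?L = "\<lambda>_::'a. 0 :: real"
  define s where "s = (\<Sum>i\<in>U. P ?L i)"
  have pos: "0 < P ?L i" if "i \<in> A" for i using that by (rule A.lb_argmin_pos)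
  have s: "0 < s" unfolding s_def using pos U_sub U.finite_A nonempty_U by (intro sum_pos) auto
  have s1: "s \<le> 1"
    unfolding s_def using sum_mono2[OF finite_A U_sub, of "P ?L"] A.lb_argmin_nonneg A.lb_argmin_sum[of ?L]
    by simp
  have "lb_min U \<Gamma> ?L \<le> lb_obj U \<Gamma> ?L (\<lambda>i. P ?L i / s)"
    using pos U_sub s by (intro U.lb_min_le) (auto simp: s_def[symmetric] simp flip: sum_divide_distrib)
  also have "\<dots> \<le> (\<Sum>i\<in>U. - \<Gamma> i * ln (P ?L i))"
    unfolding lb_obj_def
  proof (intro sum_mono)
    fix i assume "i \<in> U"
    then have i: "i \<in> A" using U_sub by auto
    have "P ?L i * 1 \<le> P ?L i / s" using pos[OF i] s s1 by (simp add: field_simps)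
    then have "ln (P ?L i) \<le> ln (P ?L i / s)" using pos[OF i] by (simp add: ln_mono)
    then show "P ?L i / s * 0 - \<Gamma> i * ln (P ?L i / s) \<le> - \<Gamma> i * ln (P ?L i)"
      using A.pos_\<Gamma>[OF i] by simp
  qed
  also have "\<dots> \<le> (\<Sum>i\<in>A. - \<Gamma> i * ln (P ?L i))"
    using finite_A U_sub pos A.lb_argmin_le_1 A.pos_\<Gamma>
    by (intro sum_mono2) (auto simp: mult_le_0_iff ln_le_zero_iff less_imp_le)
  also have "\<dots> = lb_min A \<Gamma> ?L" by (simp add: lb_min_def lb_obj_def)
  finally show ?thesis by (simp add: gap_def)
qed

text \<open>The competitor moves mass \<open>1 / (2T)\<close> from the minimiser over \<open>U\<close> to every other arm.\<close>

lemma gap_le: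
  assumes L: "\<And>i. i \<in> A \<Longrightarrow> 0 \<le> L i" and T: "real (card A) \<le> T"
  shows "gap L \<le> (\<Sum>j\<in>A-U. \<Gamma> j) * ln (2 * T) + (\<Sum>j\<in>A-U. L j) / (2 * T)
    + (\<Sum>i\<in>U. \<Gamma> i) * (real (card (A - U)) / T)"
proof -
  define n where "n = real (card (A - U))"
  \<comment> \<open>The mass moved off \<open>U\<close>. It is at most 1/2, so - ln (1 - e) \<le> 2
    e = n / T; hence the rates on \<open>U\<close> enter only with the factor
    \<open>card (A - U) / T\<close>.\<close>
  define e where "e = n / (2 * T)"
  have "card (A - U) \<le> card A" using finite_A by (intro card_mono) auto
  then have n: "0 \<le> n" "n \<le> T" using T by (auto simp: n_def)
  have "0 < card A" using finite_A nonempty_U U_sub by (auto simp: card_gt_0_iff)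
  then have T0: "0 < T" using T by linarith
  have e: "0 \<le> e" "e \<le> 1/2" using n T0 by (auto simp: e_def field_simps)
  let ?c = "\<lambda>i. if i \<in> U then (1 - e) * Q L i else 1 / (2 * T)"
  have split: "(\<Sum>i\<in>A. f i) = (\<Sum>i\<in>A-U. f i) + (\<Sum>i\<in>U. f i)" for f :: "'a \<Rightarrow> real"
    by (rule sum.subset_diff[OF U_sub finite_A])
  have "lb_min A \<Gamma> L \<le> lb_obj A \<Gamma> L ?c"
  proof (rule A.lb_min_le)
    show "0 < ?c i" for i using e T0 U.lb_argmin_pos[of i L] by simp
    show "(\<Sum>i\<in>A. ?c i) = 1"
      by (simp add: split U.lb_argmin_sum n_def[symmetric] e_def flip: sum_distrib_left)
  qed
  also have "\<dots> = (\<Sum>j\<in>A-U. 1 / (2 * T) * L j - \<Gamma> j * ln (1 / (2 * T)))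
      + (\<Sum>i\<in>U. (1 - e) * Q L i * L i - \<Gamma> i * ln ((1 - e) * Q L i))"
    unfolding lb_obj_def split by simp
  also have "(\<Sum>j\<in>A-U. 1 / (2 * T) * L j - \<Gamma> j * ln (1 / (2 * T)))
      = (\<Sum>j\<in>A-U. L j) / (2 * T) + (\<Sum>j\<in>A-U. \<Gamma> j) * ln (2 * T)"
    using T0 by (simp add: ln_div sum.distrib sum_divide_distrib sum_distrib_right)
  also have "(\<Sum>i\<in>U. (1 - e) * Q L i * L i - \<Gamma> i * ln ((1 - e) * Q L i))
      \<le> (\<Sum>i\<in>U. (Q L i * L i - \<Gamma> i * ln (Q L i)) + \<Gamma> i * (n / T))"
  proof (rule sum_mono)
    fix i assume i: "i \<in> U"
    have q: "0 < Q L i" using i by (rule U.lb_argmin_pos)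
    have "(1 - e) * (Q L i * L i) \<le> Q L i * L i"
      using e q L[of i] i U_sub by (intro mult_left_le_one_le) auto
    moreover have "- ln (1 - e) \<le> 2 * e"
    proof -
      have "- ln (1 - e) = ln (1 / (1 - e))" using e by (simp add: ln_div)
      also have "\<dots> \<le> 1 / (1 - e) - 1" using e by (intro ln_le_minus_one) auto
      also have "\<dots> = e / (1 - e)" using e by (simp add: field_simps)
      also have "\<dots> \<le> e / (1/2)" using e by (intro divide_left_mono) auto
      finally show ?thesis by simp
    qed
    then have "\<Gamma> i * (- ln (1 - e)) \<le> \<Gamma> i * (n / T)"
      using U.pos_\<Gamma>[OF i] by (intro mult_left_mono) (auto simp: e_def)
    moreover have "ln ((1 - e) * Q L i) = ln (1 - e) + ln (Q L i)"
      using e q by (simp add: ln_mult)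
    ultimately show "(1 - e) * Q L i * L i - \<Gamma> i * ln ((1 - e) * Q L i)
        \<le> (Q L i * L i - \<Gamma> i * ln (Q L i)) + \<Gamma> i * (n / T)"
      by (simp add: algebra_simps)
  qed
  also have "\<dots> = lb_min U \<Gamma> L + (\<Sum>i\<in>U. \<Gamma> i) * (n / T)"
    by (simp only: sum.distrib lb_min_def lb_obj_def sum_distrib_right)
  finally show ?thesis by (simp add: gap_def n_def)
qed

end

section \<open>Expected stability cost of a round\<close>

context log_barrier_pair
begin

definition "cost L i = (if i \<in> U then U_cost L i / P L i else 1 / \<Gamma> i)"

text \<open>The part of the cost on \<open>U\<close> not already proportional to
  \<open>off_rate\<close>. The cut at \<open>off_mass\<close> makes these shares sum to at most the
  mass outside \<open>U\<close>, however often the arms of \<open>U\<close> are drawn.\<close>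

definition "U_share L i =
  (if P L i \<le> off_mass L then weight L i / (\<Sum>j\<in>U. weight L j) * P L i else 0)"

lemma sum_weight_pos: "0 < (\<Sum>j\<in>U. weight L j)"
  using U.finite_A nonempty_U U_sub weight_pos by (intro sum_pos) auto

lemma weight_ratio: "i \<in> U \<Longrightarrow> 0 \<le> weight L i / (\<Sum>j\<in>U. weight L j)"
    "i \<in> U \<Longrightarrow> weight L i / (\<Sum>j\<in>U. weight L j) \<le> 1"
proof -
  assume i: "i \<in> U"
  show "0 \<le> weight L i / (\<Sum>j\<in>U. weight L j)"
    using i U_sub weight_pos[of i L] sum_weight_pos[of L] by (auto simp: less_imp_le)
  have "weight L i \<le> (\<Sum>j\<in>U. weight L j)"
    using i U.finite_A U_sub weight_pos by (intro member_le_sum) (auto simp: less_imp_le subset_iff)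
  then show "weight L i / (\<Sum>j\<in>U. weight L j) \<le> 1"
    using sum_weight_pos[of L] by simp
qed

lemma U_cost_nonneg:
  assumes i: "i \<in> U"
  shows "0 \<le> U_cost L i"
  unfolding U_cost_def using i weight_ratio(1)[OF i, of L] off_rate_nonneg[of L] A.lb_argmin_nonneg[of L i]
    A.pos_\<Gamma>[of i] U_sub
  by (intro mult_nonneg_nonneg add_nonneg_nonneg) auto

lemma cost_nonneg: "i \<in> A \<Longrightarrow> 0 \<le> cost L i"
  using U_cost_nonneg[of i L] A.lb_argmin_nonneg[of L i] A.pos_\<Gamma>[of i] by (simp add: cost_def)

text \<open>Averaging over the draw cancels the division by \<open>P L i\<close>. One copy of
  \<open>off_rate\<close> comes from the arms outside \<open>U\<close>, four from
  \<open>U_cost\<close>, whose weight ratios sum to one.\<close>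

lemma expected_cost:
  "(\<Sum>i\<in>A. P L i * cost L i) = 5 * off_rate L + (\<Sum>i\<in>U. U_share L i / \<Gamma> i)"
proof -
  have "(\<Sum>i\<in>A. P L i * cost L i) = (\<Sum>i\<in>A-U. P L i * cost L i) + (\<Sum>i\<in>U. P L i * cost L i)"
    by (rule sum.subset_diff[OF U_sub finite_A])
  also have "(\<Sum>i\<in>A-U. P L i * cost L i) = off_rate L"
    unfolding off_rate_def by (intro sum.cong) (auto simp: cost_def)
  also have "(\<Sum>i\<in>U. P L i * cost L i)
      = (\<Sum>i\<in>U. U_share L i / \<Gamma> i + weight L i / (\<Sum>j\<in>U. weight L j) * (4 * off_rate L))"
  proof (intro sum.cong refl)
    fix i assume i: "i \<in> U"
    then have "0 < P L i" using U_sub A.lb_argmin_pos by auto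
    then have "P L i * cost L i = U_cost L i" using i by (simp add: cost_def)
    then show "P L i * cost L i = U_share L i / \<Gamma> i + weight L i / (\<Sum>j\<in>U. weight L j) * (4 * off_rate L)"
      by (simp add: U_cost_def U_share_def distrib_left)
  qed
  also have "\<dots> = (\<Sum>i\<in>U. U_share L i / \<Gamma> i) + 4 * off_rate L"
    using sum_weight_pos[of L] by (simp add: sum.distrib flip: sum_distrib_right sum_divide_distrib)
  finally show ?thesis by simp
qed

lemma U_share_nonneg: "i \<in> U \<Longrightarrow> 0 \<le> U_share L i"
  using weight_ratio(1)[of i L] A.lb_argmin_nonneg[of L i] by (simp add: U_share_def del: times_divide_eq_left)

lemma U_share_le: "i \<in> U \<Longrightarrow> U_share L i \<le> P L i"
  using weight_ratio[of i L] A.lb_argmin_nonneg[of L i] mult_right_mono[of _ 1 "P L i"]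
  by (auto simp: U_share_def simp del: times_divide_eq_left)

lemma sum_U_share_le: "(\<Sum>i\<in>U. U_share L i) \<le> off_mass L"
proof -
  have "(\<Sum>i\<in>U. U_share L i) \<le> (\<Sum>i\<in>U. weight L i / (\<Sum>j\<in>U. weight L j) * off_mass L)"
    using weight_ratio[of _ L] off_mass_nonneg[of L]
    by (intro sum_mono) (auto simp: U_share_def simp del: times_divide_eq_left intro: mult_left_mono)
  also have "\<dots> = off_mass L"
    using sum_weight_pos[of L] by (simp flip: sum_distrib_right sum_divide_distrib)
  finally show ?thesis .
qed

end

subsection \<open>Regret along a trajectory\<close>

text \<open>With \<open>a\<close> and \<open>b\<close> the square roots of the partial sums with and
  without \<open>m n\<close>, the bound a^2 - b^2 \<le> 2 a (a - b) telescopes. The rate does not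
  yet contain the current \<open>m n\<close>; since \<open>m n\<close> \<le> 1, the summand 1 under
  the root makes up for it.\<close>

lemma sum_div_rate_le:
  fixes m g :: "nat \<Rightarrow> real"
  assumes \<theta>: "0 < \<theta>" and m: "\<And>t. t < n \<Longrightarrow> 0 \<le> m t" "\<And>t. t < n \<Longrightarrow> m t \<le> 1"
    and g: "\<And>t. t < n \<Longrightarrow> \<theta> * sqrt (1 + (\<Sum>\<tau><t. m \<tau>)) \<le> g t"
  shows "(\<Sum>t<n. m t / g t) \<le> 2 / \<theta> * sqrt (\<Sum>t<n. m t)"
  using m g
proof (induction n)
  case (Suc n)
  define S where "S = (\<Sum>t<n. m t)"
  have S: "0 \<le> S" unfolding S_def using Suc.prems(1) by (intro sum_nonneg) auto
  have mn: "0 \<le> m n" "m n \<le> 1" "\<theta> * sqrt (1 + S) \<le> g n"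
    unfolding S_def by (rule Suc.prems; simp)+
  have "m n / g n \<le> 2 / \<theta> * (sqrt (S + m n) - sqrt S)"
  proof (cases "m n = 0")
    case False
    define a b where "a = sqrt (S + m n)" "b = sqrt S"
    have ab: "0 < a" "0 \<le> b" "b \<le> a" using S mn False by (auto simp: a_b_def)
    have mab: "m n = a\<^sup>2 - b\<^sup>2" using S mn by (simp add: a_b_def)
    have "\<theta> * a \<le> \<theta> * sqrt (1 + S)"
      unfolding a_b_def using mn \<theta> by (intro mult_left_mono) auto
    then have "\<theta> * a \<le> g n" using mn by linarith
    moreover have "0 < \<theta> * a" using ab \<theta> by simp
    ultimately have "m n / g n \<le> m n / (\<theta> * a)"
      using mn by (intro frac_le) auto
    also have "\<dots> \<le> 2 / \<theta> * (a - b)"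
    proof -
      have "(a - b) * (a + b) \<le> (a - b) * (2 * a)" using ab by (intro mult_left_mono) auto
      then have "m n \<le> 2 * a * (a - b)" unfolding mab by (simp add: algebra_simps power2_eq_square)
      then show ?thesis using ab \<theta> by (simp add: divide_simps mult_ac)
    qed
    finally show ?thesis by (simp add: a_b_def)
  qed simp
  moreover have "(\<Sum>t<n. m t / g t) \<le> 2 / \<theta> * sqrt S"
    unfolding S_def by (rule Suc.IH) (use Suc.prems less_SucI in blast)+
  ultimately have "(\<Sum>t<n. m t / g t) + m n / g n \<le> 2 / \<theta> * sqrt (S + m n)"
    by (simp only: right_diff_distrib)
  then show ?case by (simp only: S_def sum.lessThan_Suc)
qed simp

text \<open>One fixed trajectory, without probability. The rates satisfy the recursion of the
  algorithm for \<alpha> = 0, with the constant part of the barrier absorbed into them.\<close>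

locale lb_trajectory =
  fixes A U :: "'a set" and C \<theta> :: real and T :: nat and \<Gamma> L :: "nat \<Rightarrow> 'a \<Rightarrow> real"
  assumes finite_A: "finite A" and U_sub: "U \<subseteq> A" and nonempty_U: "U \<noteq> {}"
    and C_ge: "2 \<le> C" and \<theta>_pos: "0 < \<theta>" and card_le: "card A \<le> T"
    and \<Gamma>_eq: "\<And>t i. \<Gamma> t i = C + \<theta> * sqrt (1 + (\<Sum>\<tau><t. max (lb_argmin A (\<Gamma> \<tau>) (L \<tau>) i) (1 / T)))"
begin

definition "p t = lb_argmin A (\<Gamma> t) (L t)"
definition "q t = lb_argmin U (\<Gamma> t) (L t)"

lemma \<Gamma>_p: "\<Gamma> t i = C + \<theta> * sqrt (1 + (\<Sum>\<tau><t. max (p \<tau> i) (1 / T)))"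
  using \<Gamma>_eq by (simp add: p_def)

lemma sum_max_nonneg: "0 \<le> (\<Sum>\<tau><t. max (p \<tau> i) (1 / T))"
  by (intro sum_nonneg) (simp add: le_max_iff_disj)

lemma C_le_\<Gamma>: "C \<le> \<Gamma> t i"
  using \<theta>_pos sum_max_nonneg[of i t] by (subst \<Gamma>_p) simp

sublocale pair: log_barrier_pair A U "\<Gamma> t" for t
  using finite_A U_sub nonempty_U order_trans[OF C_ge C_le_\<Gamma>] by unfold_locales

lemma \<Gamma>_mono: "\<Gamma> t i \<le> \<Gamma> (Suc t) i"
  unfolding \<Gamma>_p[of t i] \<Gamma>_p[of "Suc t" i]
  using \<theta>_pos by (intro add_left_mono mult_left_mono) (auto simp: le_max_iff_disj)

lemma p_nonneg: "0 \<le> p t i" and p_le_1: "p t i \<le> 1"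
  by (auto simp: p_def pair.A.lb_argmin_nonneg pair.A.lb_argmin_le_1)

lemma T_pos: "0 < T"
proof -
  have "0 < card A" using finite_A nonempty_U U_sub by (auto simp: card_gt_0_iff)
  then show ?thesis using card_le by linarith
qed

lemma \<Gamma>_le: "\<Gamma> T i \<le> C + \<theta> * sqrt (2 + (\<Sum>t<T. p t i))"
proof -
  have "(\<Sum>\<tau><T. max (p \<tau> i) (1 / T)) \<le> (\<Sum>\<tau><T. p \<tau> i + 1 / T)"
    using p_nonneg by (intro sum_mono) auto
  also have "\<dots> = (\<Sum>\<tau><T. p \<tau> i) + 1" using T_pos by (simp add: sum.distrib)
  finally show ?thesis
    unfolding \<Gamma>_p[of T i] using \<theta>_pos by (intro add_left_mono mult_left_mono) auto
qed

text \<open>The rates grow with the full probability, hence also dominate those built from any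
  smaller \<open>m\<close>. It serves twice: for \<open>p\<close> itself outside \<open>U\<close>,
  and for the shares on \<open>U\<close>, where only the shares end up under the root.\<close>

lemma sum_share_div_\<Gamma>_le:
  assumes m: "\<And>t. 0 \<le> m t" "\<And>t. m t \<le> p t i"
  shows "(\<Sum>t<T. m t / \<Gamma> t i) \<le> 2 / \<theta> * sqrt (\<Sum>t<T. m t)"
proof (rule sum_div_rate_le[OF \<theta>_pos])
  fix t
  have "m t \<le> 1" using m[of t] p_le_1[of t i] by linarith
  then show "m t \<le> 1" .
  have "(\<Sum>\<tau><t. m \<tau>) \<le> (\<Sum>\<tau><t. max (p \<tau> i) (1 / T))"
    using m by (intro sum_mono) (simp add: le_max_iff_disj)
  then have "\<theta> * sqrt (1 + (\<Sum>\<tau><t. m \<tau>)) \<le> \<theta> * sqrt (1 + (\<Sum>\<tau><t. max (p \<tau> i) (1 / T)))"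
    using \<theta>_pos by (intro mult_left_mono real_sqrt_le_mono add_left_mono) auto
  also have "\<dots> \<le> \<Gamma> t i" unfolding \<Gamma>_p[of t i] using C_ge by simp
  finally show "\<theta> * sqrt (1 + (\<Sum>\<tau><t. m \<tau>)) \<le> \<Gamma> t i" .
qed (use m in auto)

text \<open>The 10 is five copies of \<open>off_rate\<close> times the factor 2 of the telescoped
  root. On \<open>U\<close>, Cauchy-Schwarz reduces the roots of the shares to their total, which
  the mass outside \<open>U\<close> bounds.\<close>

lemma total_cost_le:
  "(\<Sum>t<T. \<Sum>i\<in>A. p t i * pair.cost t (L t) i) \<le> 10 / \<theta> * (\<Sum>j\<in>A-U. sqrt (\<Sum>t<T. p t j))
    + 2 / \<theta> * sqrt (card U * (\<Sum>j\<in>A-U. \<Sum>t<T. p t j))"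
proof -
  define m where "m t i = pair.U_share t (L t) i" for t i
  have m: "0 \<le> m t i" "m t i \<le> p t i" if "i \<in> U" for t i
    using that pair.U_share_nonneg pair.U_share_le by (auto simp: m_def p_def)
  have cs: "(\<Sum>i\<in>U. sqrt (\<Sum>t<T. m t i)) \<le> sqrt (card U * (\<Sum>j\<in>A-U. \<Sum>t<T. p t j))"
  proof (rule real_le_rsqrt)
    have M: "0 \<le> (\<Sum>t<T. m t i)" if "i \<in> U" for i using m that by (intro sum_nonneg) auto
    have "(\<Sum>i\<in>U. sqrt (\<Sum>t<T. m t i))\<^sup>2 \<le> (\<Sum>i\<in>U. 1\<^sup>2) * (\<Sum>i\<in>U. (sqrt (\<Sum>t<T. m t i))\<^sup>2)"
      using Cauchy_Schwarz_ineq_sum[of "\<lambda>_. 1" "\<lambda>i. sqrt (\<Sum>t<T. m t i)" U] by simp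
    also have "\<dots> = card U * (\<Sum>i\<in>U. \<Sum>t<T. m t i)"
      using M by simp
    also have "(\<Sum>i\<in>U. \<Sum>t<T. m t i) = (\<Sum>t<T. \<Sum>i\<in>U. m t i)" by (rule sum.swap)
    also have "\<dots> \<le> (\<Sum>t<T. \<Sum>j\<in>A-U. p t j)"
      using pair.sum_U_share_le by (intro sum_mono) (auto simp: m_def p_def pair.off_mass_def)
    also have "\<dots> = (\<Sum>j\<in>A-U. \<Sum>t<T. p t j)" by (rule sum.swap)
    finally show "(\<Sum>i\<in>U. sqrt (\<Sum>t<T. m t i))\<^sup>2 \<le> card U * (\<Sum>j\<in>A-U. \<Sum>t<T. p t j)"
      by (simp add: mult_left_mono)
  qed
  have "(\<Sum>t<T. \<Sum>i\<in>A. p t i * pair.cost t (L t) i)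
      = (\<Sum>t<T. 5 * (\<Sum>j\<in>A-U. p t j / \<Gamma> t j) + (\<Sum>i\<in>U. m t i / \<Gamma> t i))"
    by (simp add: p_def pair.expected_cost pair.off_rate_def m_def)
  also have "\<dots> = 5 * (\<Sum>j\<in>A-U. \<Sum>t<T. p t j / \<Gamma> t j) + (\<Sum>i\<in>U. \<Sum>t<T. m t i / \<Gamma> t i)"
    by (simp add: sum.distrib sum.swap[of _ _ "{..<T}"] flip: sum_distrib_left)
  also have "\<dots> \<le> 5 * (\<Sum>j\<in>A-U. 2 / \<theta> * sqrt (\<Sum>t<T. p t j)) + (\<Sum>i\<in>U. 2 / \<theta> * sqrt (\<Sum>t<T. m t i))"
    using m p_nonneg by (intro add_mono mult_left_mono sum_mono sum_share_div_\<Gamma>_le) auto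
  also have "\<dots> = 10 / \<theta> * (\<Sum>j\<in>A-U. sqrt (\<Sum>t<T. p t j)) + 2 / \<theta> * (\<Sum>i\<in>U. sqrt (\<Sum>t<T. m t i))"
    by (simp only: sum_distrib_left[symmetric])
  also have "\<dots> \<le> 10 / \<theta> * (\<Sum>j\<in>A-U. sqrt (\<Sum>t<T. p t j)) + 2 / \<theta> * sqrt (card U * (\<Sum>j\<in>A-U. \<Sum>t<T. p t j))"
    using cs \<theta>_pos by (intro add_left_mono mult_left_mono) auto
  finally show ?thesis .
qed

text \<open>The one-round inequalities telescope in the gap. The loss estimates left in the terminal
  gap are handed back to the rounds that produced them, as \<open>x t / (2 * T * p t (I t))\<close>,
  so that they too can be averaged over the draw.\<close>

lemma path_regret_le:
  fixes I :: "nat \<Rightarrow> 'a" and x :: "nat \<Rightarrow> real"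
  assumes I: "\<And>t. t < T \<Longrightarrow> I t \<in> A" and x: "\<And>t. t < T \<Longrightarrow> 0 \<le> x t" "\<And>t. t < T \<Longrightarrow> x t \<le> 1"
    and L: "\<And>t i. i \<in> A \<Longrightarrow> L t i = (\<Sum>\<tau><t. if I \<tau> = i then x \<tau> / p \<tau> i else 0)"
  shows "(\<Sum>t<T. x t) \<le> (\<Sum>t<T. q t (I t) * x t / p t (I t) + pair.cost t (L t) (I t)
      + (if I t \<in> U then 0 else x t / (2 * T * p t (I t))))
    + (\<Sum>j\<in>A-U. \<Gamma> T j) * ln (2 * T) + (\<Sum>i\<in>U. \<Gamma> T i) * (card (A - U) / T)"
proof -
  \<comment> \<open>The updated \<open>L n\<close> and \<open>L (Suc n)\<close> are known to agree
    on \<open>A\<close> only.\<close>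
  have lb_cong: "lb_argmin B G f = lb_argmin B G g" "lb_min B G f = lb_min B G g"
    if "\<And>i. i \<in> B \<Longrightarrow> f i = g i" for B :: "'a set" and G f g
  proof -
    have 1: "lb_mult B G f = lb_mult B G g" using that by (simp add: lb_mult_def)
    then show 2: "lb_argmin B G f = lb_argmin B G g" using that by (auto simp: lb_argmin_def)
    show "lb_min B G f = lb_min B G g" using that by (simp add: lb_min_def lb_obj_def 2)
  qed
  have gap_cong: "pair.gap t f = pair.gap t g" if "\<And>i. i \<in> A \<Longrightarrow> f i = g i" for t f g
    using that U_sub lb_cong(2)[of A f g "\<Gamma> t"] lb_cong(2)[of U f g "\<Gamma> t"]
    by (auto simp: pair.gap_def)
  have bound: "(\<Sum>t<n. x t - q t (I t) * x t / p t (I t) - pair.cost t (L t) (I t)) \<le> pair.gap n (L n)"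
    if "n \<le> T" for n
    using that
  proof (induction n)
    case 0
    have "pair.gap 0 (L 0) = pair.gap 0 (\<lambda>_. 0)" using L by (intro gap_cong) simp
    then show ?case using pair.gap_zero_nonneg[of 0] by simp
  next
    case (Suc n)
    then have n: "n < T" by simp
    have p: "0 < p n (I n)" using I[OF n] pair.A.lb_argmin_pos by (simp add: p_def)
    let ?L = "(L n)(I n := L n (I n) + x n / p n (I n))"
    have "x n / p n (I n) * (p n (I n) - q n (I n)) \<le> pair.gap n ?L - pair.gap n (L n) + pair.cost n (L n) (I n)"
      using pair.step_U[of "I n" "x n" n "L n"] pair.step_V[of "I n" "x n" n "L n"] x[OF n] I[OF n]
      by (auto simp: p_def q_def pair.cost_def)
    moreover have "pair.gap n ?L \<le> pair.gap (Suc n) ?L"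
      using pair.gap_mono_rate[where \<Gamma>' = "\<Gamma> (Suc n)" and t = n and L = ?L] \<Gamma>_mono by (simp add: pair.gap_def)
    moreover have "pair.gap (Suc n) ?L = pair.gap (Suc n) (L (Suc n))"
      using L I[OF n] by (intro gap_cong) auto
    moreover have "x n / p n (I n) * (p n (I n) - q n (I n)) = x n - q n (I n) * x n / p n (I n)"
      using p by (simp add: right_diff_distrib)
    ultimately show ?case using Suc by simp
  qed
  have L_nonneg: "0 \<le> L T i" if "i \<in> A" for i
    using that x p_nonneg by (subst L) (auto intro!: sum_nonneg)
  from bound[of T] have "(\<Sum>t<T. x t) \<le> (\<Sum>t<T. q t (I t) * x t / p t (I t) + pair.cost t (L t) (I t)) + pair.gap T (L T)"
    by (simp add: sum_subtractf sum.distrib)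
  also have "pair.gap T (L T) \<le> (\<Sum>j\<in>A-U. \<Gamma> T j) * ln (2 * T) + (\<Sum>j\<in>A-U. L T j) / (2 * T)
      + (\<Sum>i\<in>U. \<Gamma> T i) * (card (A - U) / T)"
    using pair.gap_le[of "L T" "real T" T, OF L_nonneg] card_le by simp
  also have "(\<Sum>j\<in>A-U. L T j) = (\<Sum>j\<in>A-U. \<Sum>t<T. if I t = j then x t / p t j else 0)"
    using L by (intro sum.cong) auto
  also have "\<dots> = (\<Sum>t<T. \<Sum>j\<in>A-U. if I t = j then x t / p t j else 0)"
    by (rule sum.swap)
  also have "\<dots> = (\<Sum>t<T. if I t \<in> U then 0 else x t / p t (I t))"
    using finite_A I by (intro sum.cong) (auto simp: sum.delta')
  also have "(\<Sum>t<T. if I t \<in> U then 0 else x t / p t (I t)) / (2 * T)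
      = (\<Sum>t<T. if I t \<in> U then 0 else x t / (2 * T * p t (I t)))"
    unfolding sum_divide_distrib by (intro sum.cong refl) simp
  finally show ?thesis
    by (simp only: sum.distrib) linarith
qed

end

subsection \<open>Measurability and sampling\<close>

text \<open>By \<open>lb_mult_le_iff\<close> the sublevel sets of the implicit multiplier are cut
  out by finitely many inequalities between measurable functions.\<close>

lemma borel_measurable_lb_mult:
  assumes A: "finite A" "A \<noteq> {}"
    and \<Gamma>[measurable]: "\<And>i. i \<in> A \<Longrightarrow> (\<lambda>w. \<Gamma> w i) \<in> borel_measurable N"
    and L[measurable]: "\<And>i. i \<in> A \<Longrightarrow> (\<lambda>w. L w i) \<in> borel_measurable N"
    and pos: "\<And>w i. i \<in> A \<Longrightarrow> 0 < \<Gamma> w i"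
  shows "(\<lambda>w. lb_mult A (\<Gamma> w) (L w)) \<in> borel_measurable N"
  unfolding borel_measurable_iff_le
proof
  fix x
  have lb: "log_barrier A (\<Gamma> w)" for w
    using A pos by unfold_locales
  have "{w \<in> space N. lb_mult A (\<Gamma> w) (L w) \<le> x}
      = {w \<in> space N. (\<forall>i\<in>A. 0 < L w i + x) \<and> (\<Sum>i\<in>A. \<Gamma> w i / (L w i + x)) \<le> 1}"
    using log_barrier.lb_mult_le_iff[OF lb] by simp
  also have "\<dots> \<in> sets N"
    using A(1) by measurable
  finally show "{w \<in> space N. lb_mult A (\<Gamma> w) (L w) \<le> x} \<in> sets N" .
qed

lemma borel_measurable_lb_argmin:
  assumes A: "finite A" "A \<noteq> {}"
    and \<Gamma>: "\<And>i. i \<in> A \<Longrightarrow> (\<lambda>w. \<Gamma> w i) \<in> borel_measurable N"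
    and L: "\<And>i. i \<in> A \<Longrightarrow> (\<lambda>w. L w i) \<in> borel_measurable N"
    and pos: "\<And>w i. i \<in> A \<Longrightarrow> 0 < \<Gamma> w i"
  shows "(\<lambda>w. lb_argmin A (\<Gamma> w) (L w) i) \<in> borel_measurable N"
proof (cases "i \<in> A")
  case True
  have [measurable]: "(\<lambda>w. lb_mult A (\<Gamma> w) (L w)) \<in> borel_measurable N"
    by (rule borel_measurable_lb_mult[OF A \<Gamma> L pos])
  have [measurable]: "(\<lambda>w. \<Gamma> w i) \<in> borel_measurable N" "(\<lambda>w. L w i) \<in> borel_measurable N"
    using True \<Gamma> L by auto
  show ?thesis using True by (simp add: lb_argmin_def)
qed (simp add: lb_argmin_def)

section \<open>Coordinates and histories of the trajectory space\<close>

lemma snd_component_measurable: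
  assumes "t \<in> R"
  shows "(\<lambda>x. snd x t i) \<in> borel_measurable (B \<Otimes>\<^sub>M PiM R (\<lambda>_. PiM UNIV (\<lambda>_. borel :: real measure)))"
proof -
  have "(\<lambda>x. snd x t) \<in> measurable (B \<Otimes>\<^sub>M PiM R (\<lambda>_. PiM UNIV (\<lambda>_. borel :: real measure)))
      (PiM UNIV (\<lambda>_. borel))"
    using assms by measurable
  from measurable_compose[OF this measurable_component_singleton[of i UNIV]] show ?thesis by simp
qed

lemma fst_measurable_traj_space [measurable]:
  "(\<lambda>w. fst w t) \<in> measurable traj_space (count_space UNIV)"
  unfolding traj_space_def by measurable

lemma snd_measurable_traj_space [measurable]: "(\<lambda>w. snd w t i) \<in> borel_measurable traj_space"
  unfolding traj_space_def by (rule snd_component_measurable) simp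

lemma space_traj_space [simp]: "space traj_space = UNIV"
  by (simp add: traj_space_def space_pair_measure space_PiM)

lemma space_hist_alg [simp]: "space (hist_alg S R) = UNIV"
  by (simp add: hist_alg_def)

lemma hist_map_measurable:
  "(\<lambda>w. (restrict (fst w) S, restrict (snd w) R))
     \<in> measurable (hist_alg S R) (PiM S (\<lambda>_. count_space UNIV) \<Otimes>\<^sub>M PiM R (\<lambda>_. PiM UNIV (\<lambda>_. borel)))"
  unfolding hist_alg_def
  by (rule measurable_vimage_algebra1) (auto simp: space_pair_measure space_PiM)

lemma fst_measurable_hist_alg:
  assumes "t \<in> S"
  shows "(\<lambda>w. fst w t) \<in> measurable (hist_alg S R) (count_space UNIV)"
proof -
  have "(\<lambda>x. fst x t) \<in> measurable (PiM S (\<lambda>_. count_space UNIV)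
      \<Otimes>\<^sub>M PiM R (\<lambda>_. PiM UNIV (\<lambda>_. borel :: real measure))) (count_space UNIV)"
    using assms by measurable
  from measurable_compose[OF hist_map_measurable this] assms show ?thesis by simp
qed

lemma snd_measurable_hist_alg:
  assumes "t \<in> R"
  shows "(\<lambda>w. snd w t i) \<in> borel_measurable (hist_alg S R)"
proof -
  from measurable_compose[OF hist_map_measurable snd_component_measurable[OF assms]] assms
  show ?thesis by simp
qed

lemma sets_hist_alg_subset: "sets (hist_alg S R) \<subseteq> sets traj_space"
  unfolding hist_alg_def
proof (rule sets_image_in_sets)
  show "(\<lambda>w. (restrict (fst w) S, restrict (snd w) R))
     \<in> measurable traj_space (PiM S (\<lambda>_. count_space UNIV) \<Otimes>\<^sub>M PiM R (\<lambda>_. PiM UNIV (\<lambda>_. borel)))"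
    by (intro measurable_Pair measurable_restrict) (auto simp: measurable_PiM_single')
qed simp

section \<open>The algorithm as a recursion of log-barrier minimisers\<close>

lemma ftrl_plist_length [simp]: "length (ftrl_plist K T \<theta> \<alpha> C obs n) = n"
  by (induction n) (auto simp: Let_def)

lemma ftrl_step_cong:
  assumes "\<And>\<tau>. \<tau> < length ps \<Longrightarrow> obs ! \<tau> = obs' ! \<tau>"
  shows "ftrl_step K T \<theta> \<alpha> C obs ps = ftrl_step K T \<theta> \<alpha> C obs' ps"
  unfolding ftrl_step_def using assms by simp

text \<open>The last of the \<open>n\<close> vectors is computed from \<open>n - 1\<close>
  observations, hence \<open>Suc \<tau> < n\<close>.\<close>

lemma ftrl_plist_cong:
  assumes "\<And>\<tau>. Suc \<tau> < n \<Longrightarrow> obs ! \<tau> = obs' ! \<tau>"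
  shows "ftrl_plist K T \<theta> \<alpha> C obs n = ftrl_plist K T \<theta> \<alpha> C obs' n"
  using assms
proof (induction n)
  case (Suc n)
  then have "ftrl_plist K T \<theta> \<alpha> C obs n = ftrl_plist K T \<theta> \<alpha> C obs' n" by simp
  then show ?case using Suc.prems ftrl_step_cong[of "ftrl_plist K T \<theta> \<alpha> C obs' n" obs obs'] by (simp add: Let_def)
qed simp

lemma observations_nth: "\<tau> < t \<Longrightarrow> observations t w ! \<tau> = (fst w \<tau>, snd w \<tau> (fst w \<tau>))"
  and observations_length [simp]: "length (observations t w) = t"
  by (simp_all add: observations_def)

text \<open>Recomputing earlier vectors from a longer record returns the ones that were actually
  played.\<close>

lemma ftrl_plist_observations:
  "n \<le> Suc t \<Longrightarrow> ftrl_plist K T \<theta> \<alpha> C (observations t w) n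
     = map (\<lambda>\<tau>. ftrl_prob K T \<theta> \<alpha> C (observations \<tau> w)) [0..<n]"
proof (induction n)
  case (Suc n)
  have "ftrl_plist K T \<theta> \<alpha> C (observations n w) n = ftrl_plist K T \<theta> \<alpha> C (observations t w) n"
    using Suc.prems by (intro ftrl_plist_cong) (simp add: observations_nth)
  moreover from this have "ftrl_step K T \<theta> \<alpha> C (observations n w) (ftrl_plist K T \<theta> \<alpha> C (observations n w) n)
      = ftrl_step K T \<theta> \<alpha> C (observations t w) (ftrl_plist K T \<theta> \<alpha> C (observations t w) n)"
    using Suc.prems by (simp, intro ftrl_step_cong) (simp add: observations_nth)
  ultimately show ?case using Suc by (simp add: ftrl_prob_def Let_def)
qed simp

locale ftrl_log_barrier =
  fixes K T :: nat and \<theta> C :: real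
  assumes K_pos: "0 < K" and K_le_T: "K \<le> T" and \<theta>_pos: "0 < \<theta>" and C_ge: "2 \<le> C"
begin

definition "play t w = ftrl_prob K T \<theta> 0 C (observations t w)"
text \<open>The fixed and the adaptive barrier merge into one coefficient, so that
  \<open>lb_obj\<close> covers the whole regularizer.\<close>

definition "rate t w i = C + \<theta> * sqrt (1 + (\<Sum>\<tau><t. max (play \<tau> w i) (1 / T)))"
definition "est t w i = (\<Sum>\<tau><t. if fst w \<tau> = i then snd w \<tau> i / play \<tau> w i else 0)"

lemma rate_pos: "0 < rate t w i"
proof -
  have "0 \<le> (\<Sum>\<tau><t. max (play \<tau> w i) (1 / T))" by (intro sum_nonneg) (simp add: le_max_iff_disj)
  then have "0 \<le> \<theta> * sqrt (1 + (\<Sum>\<tau><t. max (play \<tau> w i) (1 / T)))" using \<theta>_pos by simp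
  then show ?thesis unfolding rate_def using C_ge by linarith
qed

text \<open>Existence and uniqueness of the minimiser resolve the definite description. As
  \<open>rate\<close> and \<open>est\<close> refer to earlier rounds only, this is a recursion over
  rounds.\<close>

lemma play_eq_argmin: "play t w = lb_argmin {..<K} (rate t w) (est t w)"
proof -
  let ?obs = "observations t w" and ?ps = "map (\<lambda>\<tau>. play \<tau> w) [0..<t]"
  interpret lb: log_barrier "{..<K}" "rate t w"
    using K_pos rate_pos by unfold_locales auto
  have "play t w = ftrl_step K T \<theta> 0 C ?obs (ftrl_plist K T \<theta> 0 C ?obs t)"
    by (simp add: play_def ftrl_prob_def Let_def)
  also have "ftrl_plist K T \<theta> 0 C ?obs t = ?ps"
    by (simp add: ftrl_plist_observations play_def)
  also have "ftrl_step K T \<theta> 0 C ?obs ?ps = (THE p. p \<in> open_simplex K \<and>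
     (\<forall>q\<in>open_simplex K. lb_obj {..<K} (rate t w) (est t w) p \<le> lb_obj {..<K} (rate t w) (est t w) q))"
  proof -
    have "(\<Sum>\<tau><length ?ps. loss_est (?obs ! \<tau>) (?ps ! \<tau>) i) = est t w i" for i
      unfolding est_def by (intro sum.cong) (auto simp: loss_est_def observations_nth)
    moreover have "C + lrate T \<theta> 0 ?ps i = rate t w i" for i
    proof -
      have "(max ((?ps ! \<tau>) i) (1 / real T)) powr (1 - 2 * 0) = max (play \<tau> w i) (1 / T)" if "\<tau> < t" for \<tau>
        using that by (simp add: le_max_iff_disj)
      then show ?thesis by (simp add: lrate_def rate_def)
    qed
    moreover have "(\<Sum>i<K. p i * l i) + logbarrier_reg K C g p = lb_obj {..<K} (\<lambda>i. C + g i) l p"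
      for l g p :: "nat \<Rightarrow> real"
      by (simp add: logbarrier_reg_def lb_obj_def sum.distrib sum_subtractf sum_distrib_left sum_negf algebra_simps)
    ultimately show ?thesis
      unfolding ftrl_step_def Let_def by simp
  qed
  also have "\<dots> = lb_argmin {..<K} (rate t w) (est t w)"
  proof (rule the_equality, intro conjI ballI)
    show "lb_argmin {..<K} (rate t w) (est t w) \<in> open_simplex K"
      using lb.lb_argmin_pos lb.lb_argmin_sum by (auto simp: open_simplex_def lb_argmin_def)
    fix q assume "q \<in> open_simplex K"
    then show "lb_obj {..<K} (rate t w) (est t w) (lb_argmin {..<K} (rate t w) (est t w))
        \<le> lb_obj {..<K} (rate t w) (est t w) q"
      using lb.lb_min_le[of q] by (simp add: open_simplex_def lb_min_def)
  next
    fix p assume p: "p \<in> open_simplex K \<and>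
      (\<forall>q\<in>open_simplex K. lb_obj {..<K} (rate t w) (est t w) p \<le> lb_obj {..<K} (rate t w) (est t w) q)"
    have "lb_argmin {..<K} (rate t w) (est t w) \<in> open_simplex K"
      using lb.lb_argmin_pos lb.lb_argmin_sum by (auto simp: open_simplex_def lb_argmin_def)
    with p have "lb_obj {..<K} (rate t w) (est t w) p \<le> lb_min {..<K} (rate t w) (est t w)"
      by (simp add: lb_min_def)
    then have "p i = lb_argmin {..<K} (rate t w) (est t w) i" if "i < K" for i
      using that p by (intro lb.lb_argmin_unique) (auto simp: open_simplex_def)
    moreover have "p i = lb_argmin {..<K} (rate t w) (est t w) i" if "\<not> i < K" for i
      using that p by (auto simp: open_simplex_def lb_argmin_def)
    ultimately show "p = lb_argmin {..<K} (rate t w) (est t w)" by blast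
  qed
  finally show ?thesis .
qed

text \<open>The algebra \<open>N\<close> is arbitrary, so that one strong induction over rounds
  serves both kinds of history.\<close>

lemma
  assumes "\<And>\<tau>. \<tau> < t \<Longrightarrow> (\<lambda>w. fst w \<tau>) \<in> measurable N (count_space UNIV)"
    and "\<And>\<tau> i. \<tau> < t \<Longrightarrow> (\<lambda>w. snd w \<tau> i) \<in> borel_measurable N"
  shows play_measurable_N: "(\<lambda>w. play t w i) \<in> borel_measurable N"
    and rate_measurable_N: "(\<lambda>w. rate t w i) \<in> borel_measurable N"
    and est_measurable_N: "(\<lambda>w. est t w i) \<in> borel_measurable N"
proof -
  have rate: "(\<lambda>w. rate n w i) \<in> borel_measurable N" and est: "(\<lambda>w. est n w i) \<in> borel_measurable N"
    if "n \<le> t" and [measurable]: "\<And>\<tau> i. \<tau> < n \<Longrightarrow> (\<lambda>w. play \<tau> w i) \<in> borel_measurable N" for n i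
  proof -
    have [measurable]: "(\<lambda>w. fst w \<tau>) \<in> measurable N (count_space UNIV)"
        "(\<lambda>w. snd w \<tau> i) \<in> borel_measurable N" if "\<tau> < n" for \<tau> i
      using assms that \<open>n \<le> t\<close> by auto
    show "(\<lambda>w. rate n w i) \<in> borel_measurable N" unfolding rate_def by measurable
    show "(\<lambda>w. est n w i) \<in> borel_measurable N" unfolding est_def by measurable
  qed
  have play: "(\<lambda>w. play n w i) \<in> borel_measurable N" if "n \<le> t" for n i
    using that
  proof (induction n arbitrary: i rule: less_induct)
    case (less n)
    show ?case unfolding play_eq_argmin using K_pos rate_pos less
      by (intro borel_measurable_lb_argmin rate est) auto
  qed
  show "(\<lambda>w. play t w i) \<in> borel_measurable N" "(\<lambda>w. rate t w i) \<in> borel_measurable N"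
      "(\<lambda>w. est t w i) \<in> borel_measurable N"
    using play rate est by auto
qed

end

text \<open>Jensen for the square root, read off from the nonnegative variance of
  \<open>sqrt (X w)\<close>.\<close>

lemma (in prob_space) expectation_sqrt_le:
  assumes X[measurable]: "X \<in> borel_measurable M" and bounds: "AE w in M. 0 \<le> X w" "AE w in M. X w \<le> B"
  shows "expectation (\<lambda>w. sqrt (X w)) \<le> sqrt (expectation X)"
proof (rule real_le_rsqrt)
  have int: "integrable M (\<lambda>w. sqrt (X w))"
    using bounds by (intro integrable_const_bound[where B = "sqrt B"]) auto
  have sq: "AE w in M. (sqrt (X w))\<^sup>2 = X w" using bounds by auto
  have "integrable M X" using bounds by (intro integrable_const_bound[where B = B]) auto
  then have int2: "integrable M (\<lambda>w. (sqrt (X w))\<^sup>2)"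
    using sq by (subst integrable_cong_AE[where g = X]) auto
  have "0 \<le> variance (\<lambda>w. sqrt (X w))" by (rule variance_positive)
  also have "\<dots> = expectation (\<lambda>w. (sqrt (X w))\<^sup>2) - (expectation (\<lambda>w. sqrt (X w)))\<^sup>2"
    using int int2 by (rule variance_eq)
  also have "expectation (\<lambda>w. (sqrt (X w))\<^sup>2) = expectation X"
    using sq by (intro integral_cong_AE) auto
  finally show "(expectation (\<lambda>w. sqrt (X w)))\<^sup>2 \<le> expectation X" by simp
qed

section \<open>The law of a run and averaging over the draw\<close>

locale ftrl_log_barrier_run = ftrl_log_barrier +
  fixes M :: "traj measure"
  assumes run: "ftrl_run K T \<theta> 0 C M"
begin

sublocale prob_space M
  using run by (simp add: ftrl_run_def)

lemma sets_M [measurable_cong]: "sets M = sets traj_space"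
  using run by (simp add: ftrl_run_def)

lemma space_M [simp]: "space M = UNIV"
  using sets_eq_imp_space_eq[OF sets_M] by simp

lemma losses: "AE w in M. \<forall>t<T. \<forall>i<K. 0 \<le> snd w t i \<and> snd w t i \<le> 1"
  using run by (simp add: ftrl_run_def)

lemma subalgebra_hist_alg: "subalgebra M (hist_alg S R)"
  using sets_hist_alg_subset[of S R] by (simp add: subalgebra_def sets_M)

lemma
  fixes t i
  shows rate_measurable_hist_before: "(\<lambda>w. rate t w i) \<in> borel_measurable (hist_before t)"
    and est_measurable_hist_before: "(\<lambda>w. est t w i) \<in> borel_measurable (hist_before t)"
  unfolding hist_before_def
  by (intro rate_measurable_N est_measurable_N fst_measurable_hist_alg snd_measurable_hist_alg; simp)+

lemma
  fixes t i
  shows play_measurable_hist_env [measurable]: "(\<lambda>w. play t w i) \<in> borel_measurable (hist_env t)"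
    and rate_measurable_hist_env [measurable]: "(\<lambda>w. rate t w i) \<in> borel_measurable (hist_env t)"
    and est_measurable_hist_env [measurable]: "(\<lambda>w. est t w i) \<in> borel_measurable (hist_env t)"
    and loss_measurable_hist_env [measurable]: "(\<lambda>w. snd w t i) \<in> borel_measurable (hist_env t)"
  unfolding hist_env_def
  by (intro play_measurable_N rate_measurable_N est_measurable_N fst_measurable_hist_alg snd_measurable_hist_alg; simp)+

lemma
  fixes t i
  shows play_measurable_M [measurable]: "(\<lambda>w. play t w i) \<in> borel_measurable M"
    and rate_measurable_M [measurable]: "(\<lambda>w. rate t w i) \<in> borel_measurable M"
  using measurable_from_subalg[OF subalgebra_hist_alg] play_measurable_hist_env rate_measurable_hist_env
  unfolding hist_env_def by blast+

lemma fst_measurable_M [measurable]: "(\<lambda>w. fst w t) \<in> measurable M (count_space UNIV)"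
  and snd_measurable_M [measurable]: "(\<lambda>w. snd w t i) \<in> borel_measurable M"
  by measurable

lemma lb: "log_barrier {..<K} (rate t w)"
  using K_pos rate_pos by unfold_locales auto

lemma play_pos: "i < K \<Longrightarrow> 0 < play t w i"
  and play_nonneg: "0 \<le> play t w i"
  and play_le_1: "play t w i \<le> 1"
  and play_sum: "(\<Sum>i<K. play t w i) = 1"
  unfolding play_eq_argmin
  using log_barrier.lb_argmin_pos[OF lb] log_barrier.lb_argmin_nonneg[OF lb]
    log_barrier.lb_argmin_le_1[OF lb] log_barrier.lb_argmin_sum[OF lb] by auto

lemma arm_prob:
  assumes "t < T" "i < K" "E \<in> sets (hist_env t)"
  shows "measure M (E \<inter> {w. fst w t = i}) = (\<integral>w\<in>E. play t w i \<partial>M)"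
  using run assms by (auto simp: ftrl_run_def play_def)

lemma integrable_play [simp]: "integrable M (\<lambda>w. play t w i)"
  using play_nonneg play_le_1 by (intro integrable_const_bound[where B = 1]) auto

text \<open>Induction over nonnegative measurable functions extends the sampling rule from events to
  integrands. Extended nonnegative integrals ask for no integrability of the importance-weighted
  terms.\<close>

lemma nn_integral_arm:
  assumes t: "t < T" and i: "i < K" and h: "h \<in> borel_measurable (hist_env t)"
  shows "(\<integral>\<^sup>+w. h w * indicator {w. fst w t = i} w \<partial>M) = (\<integral>\<^sup>+w. ennreal (play t w i) * h w \<partial>M)"
  using h
proof (induction h rule: borel_measurable_induct)
  case (cong f g)
  then show ?case by (simp add: hist_env_def)
next
  case (set E)
  then have [measurable]: "E \<in> sets M"
    using subalgebra_hist_alg unfolding hist_env_def subalgebra_def by auto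
  have "(\<integral>\<^sup>+w. indicator E w * indicator {w. fst w t = i} w \<partial>M) = emeasure M (E \<inter> {w. fst w t = i})"
    by (simp add: indicator_inter_arith[symmetric])
  also have "\<dots> = ennreal (\<integral>w. indicator E w * play t w i \<partial>M)"
    using arm_prob[OF t i set] by (simp add: emeasure_eq_measure set_lebesgue_integral_def)
  also have "\<dots> = (\<integral>\<^sup>+w. ennreal (indicator E w * play t w i) \<partial>M)"
    using play_nonneg play_le_1
    by (intro nn_integral_eq_integral[symmetric] integrable_const_bound[where B = 1])
       (auto simp: indicator_def)
  also have "\<dots> = (\<integral>\<^sup>+w. ennreal (play t w i) * indicator E w \<partial>M)"
    by (intro nn_integral_cong) (simp add: indicator_def)
  finally show ?case .
next
  case (mult u c)
  then have [measurable]: "u \<in> borel_measurable M"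
    using measurable_from_subalg[OF subalgebra_hist_alg] unfolding hist_env_def by blast
  have "(\<integral>\<^sup>+w. c * (u w * indicator {w. fst w t = i} w) \<partial>M) = (\<integral>\<^sup>+w. c * (ennreal (play t w i) * u w) \<partial>M)"
    using mult by (simp add: nn_integral_cmult)
  then show ?case by (simp add: mult_ac)
next
  case (add u v)
  then have [measurable]: "u \<in> borel_measurable M" "v \<in> borel_measurable M"
    using measurable_from_subalg[OF subalgebra_hist_alg] unfolding hist_env_def by blast+
  show ?case
    using add by (simp add: distrib_left distrib_right nn_integral_add)
next
  case (seq U)
  then have [measurable]: "\<And>i. U i \<in> borel_measurable M"
    using measurable_from_subalg[OF subalgebra_hist_alg] unfolding hist_env_def by blast
  have "(\<integral>\<^sup>+w. (SUP n. U n w) * indicator {w. fst w t = i} w \<partial>M)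
      = (\<integral>\<^sup>+w. (SUP n. U n w * indicator {w. fst w t = i} w) \<partial>M)"
    by (simp add: SUP_mult_right_ennreal)
  also have "\<dots> = (SUP n. \<integral>\<^sup>+w. U n w * indicator {w. fst w t = i} w \<partial>M)"
    using seq by (intro nn_integral_monotone_convergence_SUP)
      (auto simp: incseq_def le_fun_def intro!: mult_right_mono)
  also have "\<dots> = (SUP n. \<integral>\<^sup>+w. ennreal (play t w i) * U n w \<partial>M)"
    using seq by simp
  also have "\<dots> = (\<integral>\<^sup>+w. (SUP n. ennreal (play t w i) * U n w) \<partial>M)"
    using seq by (intro nn_integral_monotone_convergence_SUP[symmetric])
      (auto simp: incseq_def le_fun_def intro!: mult_left_mono)
  also have "\<dots> = (\<integral>\<^sup>+w. ennreal (play t w i) * (SUP n. U n w) \<partial>M)"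
    by (simp add: SUP_mult_left_ennreal)
  finally show ?case using seq by (simp add: image_comp)
qed

lemma measure_arm: "t < T \<Longrightarrow> i < K \<Longrightarrow> measure M {w. fst w t = i} = (\<integral>w. play t w i \<partial>M)"
  using arm_prob[of t i UNIV] sets.top[of "hist_env t"]
  by (simp add: hist_env_def set_lebesgue_integral_def)

lemma arms: "AE w in M. \<forall>t<T. fst w t < K"
proof -
  have "AE w in M. fst w t < K" if t: "t < T" for t
  proof -
    have [measurable]: "{w. fst w t = i} \<in> sets M" for i
      using measurable_sets[OF fst_measurable_M[of t], of "{i}"] by (simp add: vimage_def)
    have "measure M (\<Union>i<K. {w. fst w t = i}) = (\<Sum>i<K. measure M {w. fst w t = i})"
      by (intro finite_measure_finite_Union) (auto simp: disjoint_family_on_def)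
    also have "\<dots> = (\<integral>w. (\<Sum>i<K. play t w i) \<partial>M)"
      using t by (simp add: measure_arm)
    also have "\<dots> = 1" using prob_space by (simp add: play_sum)
    finally have "AE w in M. w \<in> (\<Union>i<K. {w. fst w t = i})"
      by (intro AE_prob_1)
    then show ?thesis by auto
  qed
  then show ?thesis by (simp add: AE_all_countable)
qed

text \<open>Splitting by the value of the random index leaves one arm at a time, where the indicator
  of the draw may be replaced by its probability.\<close>

lemma nn_integral_chosen_arm:
  assumes t: "t < T" and h: "\<And>i. i < K \<Longrightarrow> h i \<in> borel_measurable (hist_env t)"
  shows "(\<integral>\<^sup>+w. h (fst w t) w \<partial>M) = (\<integral>\<^sup>+w. (\<Sum>i<K. ennreal (play t w i) * h i w) \<partial>M)"
proof -
  have [measurable]: "h i \<in> borel_measurable M" if "i < K" for i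
    using that h measurable_from_subalg[OF subalgebra_hist_alg] unfolding hist_env_def by blast
  have "(\<integral>\<^sup>+w. h (fst w t) w \<partial>M) = (\<integral>\<^sup>+w. (\<Sum>i<K. h i w * indicator {w. fst w t = i} w) \<partial>M)"
  proof (rule nn_integral_cong_AE)
    show "AE w in M. h (fst w t) w = (\<Sum>i<K. h i w * indicator {w. fst w t = i} w)"
      using arms
    proof eventually_elim
      case (elim w)
      have "(\<Sum>i<K. h i w * indicator {w. fst w t = i} w) = (\<Sum>i<K. if i = fst w t then h i w else 0)"
        by (intro sum.cong) (auto simp: indicator_def)
      also have "\<dots> = h (fst w t) w"
        using elim t by (simp add: sum.delta)
      finally show ?case by simp
    qed
  qed
  also have "\<dots> = (\<Sum>i<K. \<integral>\<^sup>+w. h i w * indicator {w. fst w t = i} w \<partial>M)"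
    by (intro nn_integral_sum) measurable
  also have "\<dots> = (\<Sum>i<K. \<integral>\<^sup>+w. ennreal (play t w i) * h i w \<partial>M)"
    using nn_integral_arm[OF t] h by simp
  also have "\<dots> = (\<integral>\<^sup>+w. (\<Sum>i<K. ennreal (play t w i) * h i w) \<partial>M)"
    by (intro nn_integral_sum[symmetric]) measurable
  finally show ?thesis .
qed

end

section \<open>From trajectories to expectations\<close>

context ftrl_log_barrier_run
begin

definition "virt U t w = lb_argmin U (rate t w) (est t w)"
definition "arm_cost U t w i = log_barrier_pair.cost {..<K} U (rate t w) (est t w) i"
definition "mass j w = (\<Sum>t<T. play t w j)"
definition "pulls j = (\<Sum>t<T. measure M {w. fst w t = j})"

text \<open>In order: stability outside and on \<open>U\<close>; the terminal loss estimates, 1/2 in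
  expectation per arm outside \<open>U\<close>; the terminal rates outside \<open>U\<close>; those
  on \<open>U\<close>, with the pulls replaced by \<open>T\<close>.\<close>

definition "regret_bound U = 10 / \<theta> * (\<Sum>j\<in>{..<K}-U. sqrt (pulls j))
  + 2 / \<theta> * sqrt (card U * (\<Sum>j\<in>{..<K}-U. pulls j)) + card ({..<K}-U) / 2
  + (\<Sum>j\<in>{..<K}-U. C + \<theta> * (2 + sqrt (pulls j))) * ln (2 * T)
  + card U * (C + \<theta> * sqrt (2 + T)) * (card ({..<K}-U) / T)"

lemma T_pos: "0 < T"
  using K_pos K_le_T by simp

lemma mass_measurable [measurable]: "mass j \<in> borel_measurable M"
  unfolding mass_def by measurable

lemma mass_bounds: "0 \<le> mass j w" "mass j w \<le> T"
  unfolding mass_def using play_nonneg play_le_1 sum_mono[of "{..<T}" "\<lambda>t. play t w j" "\<lambda>_. 1"]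
  by (auto intro!: sum_nonneg play_nonneg)

lemma expectation_mass: "j < K \<Longrightarrow> expectation (mass j) = pulls j"
  unfolding mass_def[abs_def] pulls_def by (simp add: measure_arm)

lemma integrable_chosen_loss: "integrable M (\<lambda>w. snd w t (fst w t))" if "t < T"
proof (rule integrable_const_bound[where B = 1])
  show "AE w in M. norm (snd w t (fst w t)) \<le> 1"
    using losses arms by eventually_elim (use that in auto)
  show "(\<lambda>w. snd w t (fst w t)) \<in> borel_measurable M"
    by (rule measurable_compose_countable[where f = "\<lambda>i w. snd w t i"]) measurable
qed

context
  fixes U :: "nat set"
  assumes U_sub: "U \<subseteq> {..<K}" and U_ne: "U \<noteq> {}"
begin

interpretation traj: lb_trajectory "{..<K}" U C \<theta> T "\<lambda>t. rate t w" "\<lambda>t. est t w" for w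
  using U_sub U_ne C_ge \<theta>_pos K_le_T by unfold_locales (auto simp: rate_def simp flip: play_eq_argmin)

lemma virt_eq: "traj.q w t = virt U t w"
  by (simp add: traj.q_def virt_def)

lemma play_eq: "traj.p w t = play t w"
  by (simp add: traj.p_def play_eq_argmin)

lemma virt_nonneg: "0 \<le> virt U t w i"
  and virt_le_1: "virt U t w i \<le> 1"
  and virt_sum: "(\<Sum>i\<in>U. virt U t w i) = 1"
  and virt_outside: "i \<notin> U \<Longrightarrow> virt U t w i = 0"
  unfolding virt_def
  using traj.pair.U.lb_argmin_nonneg traj.pair.U.lb_argmin_le_1 traj.pair.U.lb_argmin_sum
  by (auto simp: lb_argmin_def[of U])

lemma virt_measurable:
  assumes "\<And>i. (\<lambda>w. rate t w i) \<in> borel_measurable N" "\<And>i. (\<lambda>w. est t w i) \<in> borel_measurable N"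
  shows "(\<lambda>w. virt U t w i) \<in> borel_measurable N"
  unfolding virt_def using U_ne U_sub assms rate_pos
  by (intro borel_measurable_lb_argmin) (auto intro: finite_subset)

text \<open>Predictability: these weights may later be moved through the conditional expectation
  given the past.\<close>

lemma virt_measurable_hist_before: "(\<lambda>w. virt U t w i) \<in> borel_measurable (hist_before t)"
  by (intro virt_measurable rate_measurable_hist_before est_measurable_hist_before)

lemma virt_measurable_hist_env [measurable]: "(\<lambda>w. virt U t w i) \<in> borel_measurable (hist_env t)"
  by (intro virt_measurable rate_measurable_hist_env est_measurable_hist_env)

lemma virt_measurable_M [measurable]: "(\<lambda>w. virt U t w i) \<in> borel_measurable M"
  using measurable_from_subalg[OF subalgebra_hist_alg] virt_measurable_hist_before
  unfolding hist_before_def by blast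

lemma arm_cost_eq: "arm_cost U t w i = (if i \<in> U then
    (play t w i)\<^sup>2 / rate t w i / (\<Sum>j\<in>U. (play t w j)\<^sup>2 / rate t w j)
      * ((if play t w i \<le> (\<Sum>j\<in>{..<K}-U. play t w j) then play t w i / rate t w i else 0)
        + 4 * (\<Sum>j\<in>{..<K}-U. play t w j / rate t w j)) / play t w i
    else 1 / rate t w i)"
  unfolding arm_cost_def traj.pair.cost_def traj.pair.U_cost_def traj.pair.weight_def
    traj.pair.off_mass_def traj.pair.off_rate_def play_eq_argmin[symmetric] by (rule refl)

lemma arm_cost_measurable_hist_env [measurable]:
  "(\<lambda>w. arm_cost U t w i) \<in> borel_measurable (hist_env t)"
  unfolding arm_cost_eq by measurable

lemma arm_cost_nonneg: "i < K \<Longrightarrow> 0 \<le> arm_cost U t w i"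
  using traj.pair.cost_nonneg[of i] by (simp add: arm_cost_def)

text \<open>Everything in the trajectory inequality that depends on the arm drawn in round
  \<open>t\<close>, as a function of that arm.\<close>

definition "charge t i w = virt U t w i * snd w t i / play t w i + arm_cost U t w i
  + (if i \<in> U then 0 else snd w t i / (2 * T * play t w i))"

definition "terminal w = (\<Sum>j\<in>{..<K}-U. rate T w j) * ln (2 * T)
  + (\<Sum>i\<in>U. rate T w i) * (card ({..<K}-U) / T)"

lemma path_bound:
  "AE w in M. (\<Sum>t<T. snd w t (fst w t)) \<le> (\<Sum>t<T. charge t (fst w t) w) + terminal w"
  using losses arms
proof eventually_elim
  case (elim w)
  have "(\<Sum>t<T. snd w t (fst w t)) \<le> (\<Sum>t<T. virt U t w (fst w t) * snd w t (fst w t) / play t w (fst w t)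
      + traj.pair.cost t w (est t w) (fst w t)
      + (if fst w t \<in> U then 0 else snd w t (fst w t) / (2 * T * play t w (fst w t))))
    + (\<Sum>j\<in>{..<K}-U. rate T w j) * ln (2 * T) + (\<Sum>i\<in>U. rate T w i) * (card ({..<K} - U) / T)"
    using traj.path_regret_le[of "fst w" "\<lambda>t. snd w t (fst w t)" w] elim
    unfolding play_eq virt_eq by (simp add: est_def cong: if_cong)
  then show ?case by (simp add: charge_def terminal_def arm_cost_def)
qed

lemma sum_cost_le: "(\<Sum>t<T. \<Sum>i<K. play t w i * arm_cost U t w i)
    \<le> 10 / \<theta> * (\<Sum>j\<in>{..<K}-U. sqrt (mass j w)) + 2 / \<theta> * sqrt (card U * (\<Sum>j\<in>{..<K}-U. mass j w))"
  using traj.total_cost_le[of w] unfolding play_eq by (simp add: arm_cost_def mass_def)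

lemma rate_T_le: "rate T w i \<le> C + \<theta> * sqrt (2 + mass i w)"
  using traj.\<Gamma>_le[of w i] unfolding play_eq by (simp add: mass_def)

definition "path_total w = 10 / \<theta> * (\<Sum>j\<in>{..<K}-U. sqrt (mass j w))
  + 2 / \<theta> * sqrt (card U * (\<Sum>j\<in>{..<K}-U. mass j w)) + card ({..<K}-U) / 2
  + (\<Sum>j\<in>{..<K}-U. C + \<theta> * (2 + sqrt (mass j w))) * ln (2 * T)
  + card U * (C + \<theta> * sqrt (2 + T)) * (card ({..<K}-U) / T)"

lemma terminal_nonneg: "0 \<le> terminal w"
  unfolding terminal_def using rate_pos T_pos
  by (intro add_nonneg_nonneg mult_nonneg_nonneg sum_nonneg) (auto intro!: less_imp_le[OF rate_pos])

text \<open>Outside \<open>U\<close> the pulls are kept, because the self-bounding condition will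
  absorb them. On \<open>U\<close> the crude bound \<open>T\<close> is affordable thanks to the
  factor \<open>card ({..<K}-U) / T\<close>.\<close>

lemma terminal_le: "terminal w \<le> (\<Sum>j\<in>{..<K}-U. C + \<theta> * (2 + sqrt (mass j w))) * ln (2 * T)
  + card U * (C + \<theta> * sqrt (2 + T)) * (card ({..<K}-U) / T)"
  unfolding terminal_def
proof (intro add_mono mult_right_mono)
  have "rate T w j \<le> C + \<theta> * (2 + sqrt (mass j w))" for j
  proof -
    have "sqrt (2 + mass j w) \<le> sqrt 2 + sqrt (mass j w)"
      using mass_bounds by (intro sqrt_add_le_add_sqrt) auto
    also have "sqrt 2 \<le> 2" using real_sqrt_le_iff[of 2 4] by simp
    finally have "\<theta> * sqrt (2 + mass j w) \<le> \<theta> * (2 + sqrt (mass j w))"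
      using \<theta>_pos by (intro mult_left_mono) auto
    then show ?thesis using rate_T_le[of w j] by linarith
  qed
  then show "(\<Sum>j\<in>{..<K}-U. rate T w j) \<le> (\<Sum>j\<in>{..<K}-U. C + \<theta> * (2 + sqrt (mass j w)))"
    by (intro sum_mono)
  have "rate T w j \<le> C + \<theta> * sqrt (2 + T)" for j
  proof -
    have "\<theta> * sqrt (2 + mass j w) \<le> \<theta> * sqrt (2 + T)"
      using mass_bounds[of j w] \<theta>_pos by (intro mult_left_mono) auto
    then show ?thesis using rate_T_le[of w j] by simp
  qed
  then have "(\<Sum>i\<in>U. rate T w i) \<le> (\<Sum>i\<in>U. C + \<theta> * sqrt (2 + T))" by (intro sum_mono)
  then show "(\<Sum>i\<in>U. rate T w i) \<le> card U * (C + \<theta> * sqrt (2 + T))" by simp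
qed (use T_pos in auto)

text \<open>Averaging cancels the importance weights: the first summand of the charge becomes the
  loss of the virtual iterate, the last at most \<open>1 / (2 * T)\<close> per round and arm outside
  \<open>U\<close>.\<close>

lemma sum_play_charge_le:
  assumes w: "\<forall>t<T. \<forall>i<K. 0 \<le> snd w t i \<and> snd w t i \<le> 1"
  shows "(\<Sum>t<T. \<Sum>i<K. play t w i * charge t i w) + terminal w
    \<le> (\<Sum>t<T. \<Sum>i\<in>U. virt U t w i * snd w t i) + path_total w"
proof -
  have "play t w i * charge t i w = virt U t w i * snd w t i + play t w i * arm_cost U t w i
      + (if i \<in> U then 0 else snd w t i / (2 * T))" if "i < K" for t i
    using play_pos[OF that, of t w] by (simp add: charge_def distrib_left)
  then have "(\<Sum>t<T. \<Sum>i<K. play t w i * charge t i w)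
      = (\<Sum>t<T. \<Sum>i<K. virt U t w i * snd w t i) + (\<Sum>t<T. \<Sum>i<K. play t w i * arm_cost U t w i)
        + (\<Sum>t<T. \<Sum>i<K. if i \<in> U then 0 else snd w t i / (2 * T))"
    by (simp add: sum.distrib)
  also have "(\<Sum>t<T. \<Sum>i<K. virt U t w i * snd w t i) = (\<Sum>t<T. \<Sum>i\<in>U. virt U t w i * snd w t i)"
    using U_sub virt_outside by (intro sum.cong refl sum.mono_neutral_right) auto
  also have "(\<Sum>t<T. \<Sum>i<K. if i \<in> U then 0 else snd w t i / (2 * T)) \<le> (\<Sum>t<T. \<Sum>i\<in>{..<K}-U. 1 / (2 * T))"
  proof (rule sum_mono)
    fix t assume t: "t \<in> {..<T}"
    have "(\<Sum>i<K. if i \<in> U then 0 else snd w t i / (2 * T)) = (\<Sum>i\<in>{..<K}-U. snd w t i / (2 * T))"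
      by (intro sum.mono_neutral_cong_right) auto
    also have "\<dots> \<le> (\<Sum>i\<in>{..<K}-U. 1 / (2 * T))"
      using w t by (intro sum_mono divide_right_mono) auto
    finally show "(\<Sum>i<K. if i \<in> U then 0 else snd w t i / (2 * T)) \<le> (\<Sum>i\<in>{..<K}-U. 1 / (2 * T))" .
  qed
  also have "\<dots> = card ({..<K}-U) / 2" using T_pos by simp
  finally show ?thesis
    using sum_cost_le[of w] terminal_le[of w] by (simp add: path_total_def)
qed

lemma integrable_virt_loss: "t < T \<Longrightarrow> i \<in> U \<Longrightarrow> integrable M (\<lambda>w. virt U t w i * snd w t i)"
proof (rule integrable_const_bound[where B = 1])
  assume "t < T" "i \<in> U"
  show "AE w in M. norm (virt U t w i * snd w t i) \<le> 1"
    using losses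
  proof eventually_elim
    case (elim w)
    then have "virt U t w i * snd w t i \<le> 1" "0 \<le> virt U t w i * snd w t i"
      using \<open>t < T\<close> \<open>i \<in> U\<close> U_sub
      by (auto intro!: mult_le_one mult_nonneg_nonneg virt_nonneg virt_le_1)
    then show ?case by simp
  qed
qed measurable

lemma integrable_sqrt_mass: "integrable M (\<lambda>w. sqrt (mass j w))"
  using mass_bounds by (intro integrable_const_bound[where B = "sqrt T"]) auto

lemma sum_mass_bounds:
  "0 \<le> (\<Sum>j\<in>{..<K}-U. mass j w)" "(\<Sum>j\<in>{..<K}-U. mass j w) \<le> card ({..<K}-U) * T"
  using sum_mono[of "{..<K}-U" "\<lambda>j. mass j w" "\<lambda>_. T"] by (auto intro!: sum_nonneg mass_bounds)

lemma weighted_mass_bounds: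
  "0 \<le> card U * (\<Sum>j\<in>{..<K}-U. mass j w)"
  "card U * (\<Sum>j\<in>{..<K}-U. mass j w) \<le> card U * (card ({..<K}-U) * T)"
proof -
  show "0 \<le> card U * (\<Sum>j\<in>{..<K}-U. mass j w)" using sum_mass_bounds by simp
  have "card U * (\<Sum>j\<in>{..<K}-U. mass j w) \<le> card U * real (card ({..<K}-U) * T)"
    by (intro mult_left_mono sum_mass_bounds) simp
  then show "card U * (\<Sum>j\<in>{..<K}-U. mass j w) \<le> card U * (card ({..<K}-U) * T)" by simp
qed

lemma integrable_sqrt_sum_mass: "integrable M (\<lambda>w. sqrt (card U * (\<Sum>j\<in>{..<K}-U. mass j w)))"
proof (rule integrable_const_bound[where B = "sqrt (card U * (card ({..<K}-U) * T))"])
  show "AE w in M. norm (sqrt (card U * (\<Sum>j\<in>{..<K}-U. mass j w))) \<le> sqrt (card U * (card ({..<K}-U) * T))"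
    using weighted_mass_bounds by (intro AE_I2) simp
qed measurable

lemma integrable_path_total: "integrable M path_total"
  unfolding path_total_def[abs_def]
  by (intro Bochner_Integration.integrable_add integrable_mult_right integrable_mult_left
      Bochner_Integration.integrable_sum integrable_sqrt_mass integrable_sqrt_sum_mass integrable_const)

lemma expectation_path_total_le: "expectation path_total \<le> regret_bound U"
proof -
  have sq: "expectation (\<lambda>w. sqrt (mass j w)) \<le> sqrt (pulls j)" if "j \<in> {..<K}-U" for j
    using expectation_sqrt_le[of "mass j" "real T"] mass_bounds expectation_mass that by auto
  have sq_sum: "expectation (\<lambda>w. sqrt (card U * (\<Sum>j\<in>{..<K}-U. mass j w)))
      \<le> sqrt (card U * (\<Sum>j\<in>{..<K}-U. pulls j))"
  proof -
    have "integrable M (mass j)" for j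
      using mass_bounds by (intro integrable_const_bound[where B = T]) auto
    then have "expectation (\<lambda>w. \<Sum>j\<in>{..<K}-U. mass j w) = (\<Sum>j\<in>{..<K}-U. pulls j)"
      by (simp add: expectation_mass)
    then show ?thesis
      using expectation_sqrt_le[of "\<lambda>w. card U * (\<Sum>j\<in>{..<K}-U. mass j w)" "card U * (card ({..<K}-U) * T)"]
        weighted_mass_bounds by simp
  qed
  have "expectation path_total = 10 / \<theta> * (\<Sum>j\<in>{..<K}-U. expectation (\<lambda>w. sqrt (mass j w)))
    + 2 / \<theta> * expectation (\<lambda>w. sqrt (card U * (\<Sum>j\<in>{..<K}-U. mass j w))) + card ({..<K}-U) / 2
    + (\<Sum>j\<in>{..<K}-U. C + \<theta> * (2 + expectation (\<lambda>w. sqrt (mass j w)))) * ln (2 * T)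
    + card U * (C + \<theta> * sqrt (2 + T)) * (card ({..<K}-U) / T)"
    unfolding path_total_def[abs_def]
    using integrable_sqrt_mass integrable_sqrt_sum_mass prob_space
    by (simp add: Bochner_Integration.integrable_sum Bochner_Integration.integral_sum)
  also have "\<dots> \<le> regret_bound U"
    unfolding regret_bound_def using sq sq_sum \<theta>_pos T_pos
    by (intro add_mono mult_left_mono mult_right_mono sum_mono order_refl) auto
  finally show ?thesis .
qed

text \<open>The averaging takes place in extended nonnegative integrals; only the two ends
  \<open>?X\<close> and \<open>?Z\<close>, whose integrability is known, are read as real
  expectations.\<close>

lemma learner_loss_le:
  "expectation (\<lambda>w. \<Sum>t<T. snd w t (fst w t))
    \<le> (\<Sum>t<T. \<Sum>i\<in>U. expectation (\<lambda>w. virt U t w i * snd w t i)) + regret_bound U"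
proof -
  let ?X = "\<lambda>w. \<Sum>t<T. snd w t (fst w t)"
  let ?Z = "\<lambda>w. (\<Sum>t<T. \<Sum>i\<in>U. virt U t w i * snd w t i) + path_total w"
  have charge_env: "(\<lambda>w. charge t i w) \<in> borel_measurable (hist_env t)" for t i
    unfolding charge_def by measurable
  have charge_M: "(\<lambda>w. charge t i w) \<in> borel_measurable M" for t i
    using measurable_from_subalg[OF subalgebra_hist_alg] charge_env unfolding hist_env_def by blast
  note [measurable] = charge_M
  have charge_chosen [measurable]: "(\<lambda>w. charge t (fst w t) w) \<in> borel_measurable M" for t
    by (rule measurable_compose_countable[where f = "\<lambda>i w. charge t i w"]) measurable
  have terminal_M [measurable]: "terminal \<in> borel_measurable M"
    unfolding terminal_def[abs_def] by measurable
  have charge_nonneg: "AE w in M. \<forall>t<T. \<forall>i<K. 0 \<le> charge t i w"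
    using losses
  proof eventually_elim
    case (elim w)
    then show ?case
      unfolding charge_def using virt_nonneg play_nonneg arm_cost_nonneg
      by (auto intro!: add_nonneg_nonneg divide_nonneg_nonneg mult_nonneg_nonneg)
  qed
  have intX: "integrable M ?X" by (intro Bochner_Integration.integrable_sum integrable_chosen_loss) simp
  have intZ: "integrable M ?Z"
    by (intro Bochner_Integration.integrable_add Bochner_Integration.integrable_sum
        integrable_virt_loss integrable_path_total) auto
  have X_nonneg: "AE w in M. 0 \<le> ?X w"
    using losses arms by eventually_elim (auto intro!: sum_nonneg)
  have Z_nonneg: "AE w in M. 0 \<le> ?Z w"
    using losses charge_nonneg
  proof eventually_elim
    case (elim w)
    have "0 \<le> (\<Sum>t<T. \<Sum>i<K. play t w i * charge t i w) + terminal w"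
      using elim play_nonneg terminal_nonneg by (intro add_nonneg_nonneg sum_nonneg mult_nonneg_nonneg) auto
    then show ?case using sum_play_charge_le[OF elim(1)] by linarith
  qed
  have "ennreal (expectation ?X) = (\<integral>\<^sup>+w. ennreal (?X w) \<partial>M)"
    using intX X_nonneg by (rule nn_integral_eq_integral[symmetric])
  also have "\<dots> \<le> (\<integral>\<^sup>+w. (\<Sum>t<T. ennreal (charge t (fst w t) w)) + ennreal (terminal w) \<partial>M)"
  proof (rule nn_integral_mono_AE)
    show "AE w in M. ennreal (?X w) \<le> (\<Sum>t<T. ennreal (charge t (fst w t) w)) + ennreal (terminal w)"
      using path_bound charge_nonneg arms
    proof eventually_elim
      case (elim w)
      then have "(\<Sum>t<T. ennreal (charge t (fst w t) w)) = ennreal (\<Sum>t<T. charge t (fst w t) w)"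
        by (intro sum_ennreal) auto
      then have "(\<Sum>t<T. ennreal (charge t (fst w t) w)) + ennreal (terminal w)
          = ennreal ((\<Sum>t<T. charge t (fst w t) w) + terminal w)"
        using terminal_nonneg[of w] elim by (subst ennreal_plus) (auto intro!: sum_nonneg)
      then show ?case using elim by (simp add: ennreal_leI)
    qed
  qed
  also have "\<dots> = (\<Sum>t<T. \<integral>\<^sup>+w. ennreal (charge t (fst w t) w) \<partial>M) + (\<integral>\<^sup>+w. ennreal (terminal w) \<partial>M)"
    by (simp add: nn_integral_add nn_integral_sum)
  also have "\<dots> = (\<Sum>t<T. \<integral>\<^sup>+w. (\<Sum>i<K. ennreal (play t w i) * ennreal (charge t i w)) \<partial>M)
      + (\<integral>\<^sup>+w. ennreal (terminal w) \<partial>M)"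
    using charge_env nn_integral_chosen_arm[of _ "\<lambda>i w. ennreal (charge _ i w)"]
    by (intro arg_cong2[where f = "(+)"] sum.cong refl nn_integral_chosen_arm) auto
  also have "\<dots> = (\<integral>\<^sup>+w. (\<Sum>t<T. \<Sum>i<K. ennreal (play t w i) * ennreal (charge t i w)) + ennreal (terminal w) \<partial>M)"
    by (simp add: nn_integral_add nn_integral_sum)
  also have "\<dots> \<le> (\<integral>\<^sup>+w. ennreal (?Z w) \<partial>M)"
  proof (rule nn_integral_mono_AE)
    show "AE w in M. (\<Sum>t<T. \<Sum>i<K. ennreal (play t w i) * ennreal (charge t i w)) + ennreal (terminal w)
        \<le> ennreal (?Z w)"
      using charge_nonneg losses
    proof eventually_elim
      case (elim w)
      have "(\<Sum>t<T. \<Sum>i<K. ennreal (play t w i) * ennreal (charge t i w)) + ennreal (terminal w)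
          = (\<Sum>t<T. \<Sum>i<K. ennreal (play t w i * charge t i w)) + ennreal (terminal w)"
        using play_nonneg by (simp add: ennreal_mult')
      also have "(\<Sum>t<T. \<Sum>i<K. ennreal (play t w i * charge t i w))
          = (\<Sum>t<T. ennreal (\<Sum>i<K. play t w i * charge t i w))"
        using elim by (intro sum.cong refl sum_ennreal) (auto intro!: mult_nonneg_nonneg play_nonneg)
      also have "\<dots> = ennreal (\<Sum>t<T. \<Sum>i<K. play t w i * charge t i w)"
        using elim by (intro sum_ennreal) (auto intro!: sum_nonneg mult_nonneg_nonneg play_nonneg)
      also have "\<dots> + ennreal (terminal w) = ennreal ((\<Sum>t<T. \<Sum>i<K. play t w i * charge t i w) + terminal w)"
        using elim terminal_nonneg[of w]
        by (subst ennreal_plus) (auto intro!: sum_nonneg mult_nonneg_nonneg play_nonneg)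
      also have "\<dots> \<le> ennreal (?Z w)"
        using sum_play_charge_le[of w] elim by (intro ennreal_leI) auto
      finally show ?case .
    qed
  qed
  also have "\<dots> = ennreal (expectation ?Z)"
    using intZ Z_nonneg by (rule nn_integral_eq_integral)
  finally have "expectation ?X \<le> expectation ?Z"
    using Z_nonneg by (subst (asm) ennreal_le_iff) (auto intro!: integral_nonneg_AE)
  also have "expectation ?Z = expectation (\<lambda>w. \<Sum>t<T. \<Sum>i\<in>U. virt U t w i * snd w t i) + expectation path_total"
    by (intro Bochner_Integration.integral_add Bochner_Integration.integrable_sum
        integrable_virt_loss integrable_path_total) auto
  also have "expectation (\<lambda>w. \<Sum>t<T. \<Sum>i\<in>U. virt U t w i * snd w t i)
      = (\<Sum>t<T. expectation (\<lambda>w. \<Sum>i\<in>U. virt U t w i * snd w t i))"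
    by (intro Bochner_Integration.integral_sum Bochner_Integration.integrable_sum integrable_virt_loss) auto
  also have "\<dots> = (\<Sum>t<T. \<Sum>i\<in>U. expectation (\<lambda>w. virt U t w i * snd w t i))"
    by (intro sum.cong refl Bochner_Integration.integral_sum integrable_virt_loss) auto
  finally show ?thesis using expectation_path_total_le by linarith
qed

end

end

subsection \<open>Regret bounds\<close>

text \<open>Completing the square in \<open>sqrt n\<close>; \<open>x\<close> stays free for
  balancing.\<close>

lemma am_gm_sqrt:
  fixes a s n d x :: real
  assumes "0 \<le> n" "0 < d" "0 < x"
  shows "2 * a * s * sqrt n \<le> x * d * n / 2 + 2 * a\<^sup>2 * s\<^sup>2 / (x * d)"
proof -
  have xd: "0 < x * d" using assms by simp
  have "0 \<le> (x * d * sqrt n - 2 * a * s)\<^sup>2" by simp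
  also have "\<dots> = (x * d)\<^sup>2 * n - 4 * a * s * (x * d) * sqrt n + 4 * a\<^sup>2 * s\<^sup>2"
    using assms by (simp add: power2_diff power_mult_distrib mult_ac)
  finally have "(2 * a * s * sqrt n) * (2 * (x * d)) \<le> ((x * d)\<^sup>2 * n + 4 * a\<^sup>2 * s\<^sup>2)"
    by (simp add: algebra_simps)
  then have "2 * a * s * sqrt n \<le> ((x * d)\<^sup>2 * n + 4 * a\<^sup>2 * s\<^sup>2) / (2 * (x * d))"
    using xd by (subst pos_le_divide_eq) auto
  also have "\<dots> = x * d * n / 2 + 2 * a\<^sup>2 * s\<^sup>2 / (x * d)"
    using xd by (simp add: add_divide_distrib power2_eq_square mult_ac)
  finally show ?thesis .
qed

text \<open>The regret \<open>R\<close> is written as \<open>(1 + x) R - x R\<close>: the self-bounding condition turns the second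
  term into a negative multiple of the pulls, which absorbs the square roots; then \<open>x\<close> is optimised.\<close>

lemma self_bounding_bound:
  fixes n \<Delta> :: "'a \<Rightarrow> real"
  assumes V: "finite V" "\<And>j. j \<in> V \<Longrightarrow> 0 \<le> n j" "\<And>j. j \<in> V \<Longrightarrow> \<delta> \<le> \<Delta> j" and \<delta>: "0 < \<delta>"
    and nonneg: "0 \<le> a" "0 \<le> s" "0 \<le> u" "0 \<le> c" "0 \<le> E"
    and R_le: "R \<le> E + a * s * ((\<Sum>j\<in>V. sqrt (n j)) + sqrt (u * (\<Sum>j\<in>V. n j)))"
    and R_ge: "(\<Sum>j\<in>V. \<Delta> j * n j) - c \<le> R"
    and G: "u / \<delta> + (\<Sum>j\<in>V. 1 / \<Delta> j) \<le> G"
  shows "R \<le> 2 * E + (2 * a\<^sup>2 + 1) * (G * s\<^sup>2 + sqrt (c * G * s\<^sup>2))"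
proof -
  define N where "N = (\<Sum>j\<in>V. n j)"
  define B where "B = a * s * ((\<Sum>j\<in>V. sqrt (n j)) + sqrt (u * N))"
  define H where "H = G * s\<^sup>2"
  have \<Delta>_pos: "0 < \<Delta> j" if "j \<in> V" for j using V(3)[OF that] \<delta> by linarith
  have N0: "0 \<le> N" unfolding N_def using V by (intro sum_nonneg) auto
  have B0: "0 \<le> B"
    unfolding B_def using nonneg N0 V by (intro mult_nonneg_nonneg add_nonneg_nonneg sum_nonneg) auto
  have G0: "0 \<le> G"
  proof -
    have "0 \<le> (\<Sum>j\<in>V. 1 / \<Delta> j)" using \<Delta>_pos by (intro sum_nonneg) (auto simp: less_imp_le)
    moreover have "0 \<le> u / \<delta>" using nonneg \<delta> by simp
    ultimately show ?thesis using G by linarith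
  qed
  have H0: "0 \<le> H" using G0 by (simp add: H_def)
  have main: "R \<le> 2 * E + 2 * a\<^sup>2 * H / x + x * c" if x: "0 < x" "x \<le> 1" for x
  proof -
    have "2 * B = (\<Sum>j\<in>V. 2 * a * s * sqrt (n j)) + 2 * a * (s * sqrt u) * sqrt N"
      by (simp add: B_def real_sqrt_mult distrib_left sum_distrib_left mult_ac)
    also have "\<dots> \<le> (\<Sum>j\<in>V. x * \<Delta> j * n j / 2 + 2 * a\<^sup>2 * s\<^sup>2 / (x * \<Delta> j))
        + (x * \<delta> * N / 2 + 2 * a\<^sup>2 * (s * sqrt u)\<^sup>2 / (x * \<delta>))"
      using V \<Delta>_pos N0 \<delta> x by (intro add_mono sum_mono am_gm_sqrt) auto
    also have "\<dots> = x / 2 * (\<Sum>j\<in>V. \<Delta> j * n j) + x / 2 * (\<delta> * N)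
        + 2 * a\<^sup>2 * s\<^sup>2 / x * (u / \<delta> + (\<Sum>j\<in>V. 1 / \<Delta> j))"
      using nonneg by (simp add: sum.distrib sum_distrib_left sum_divide_distrib distrib_left
          add_divide_distrib power_mult_distrib mult_ac)
    \<comment> \<open>All gaps in \<open>V\<close> are at least \<open>\<delta>\<close>, so the term
      with the total pulls uses the second half of the self-bounding sum.\<close>
    also have "x / 2 * (\<delta> * N) \<le> x / 2 * (\<Sum>j\<in>V. \<Delta> j * n j)"
      unfolding N_def sum_distrib_left[of \<delta>] using V x by (intro mult_left_mono sum_mono mult_right_mono) auto
    also have "2 * a\<^sup>2 * s\<^sup>2 / x * (u / \<delta> + (\<Sum>j\<in>V. 1 / \<Delta> j)) \<le> 2 * a\<^sup>2 * s\<^sup>2 / x * G"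
      using G x by (intro mult_left_mono) auto
    finally have 2: "2 * B \<le> x * (\<Sum>j\<in>V. \<Delta> j * n j) + 2 * a\<^sup>2 * H / x"
      by (simp add: H_def mult_ac)
    have "(1 + x) * R \<le> (1 + x) * (E + B)"
      using R_le x by (intro mult_left_mono) (auto simp: B_def N_def)
    also have "\<dots> \<le> 2 * (E + B)"
      using x nonneg B0 by (intro mult_right_mono) auto
    finally have "R \<le> 2 * E + 2 * B - x * R" by (simp add: algebra_simps)
    moreover have "x * ((\<Sum>j\<in>V. \<Delta> j * n j) - c) \<le> x * R" using R_ge x by (intro mult_left_mono) auto
    ultimately show ?thesis using 2 by (simp add: right_diff_distrib)
  qed
  show ?thesis
  proof (cases "c \<le> H")
    case True
    have "R \<le> 2 * E + 2 * a\<^sup>2 * H + c" using main[of 1] by simp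
    also have "\<dots> \<le> 2 * E + (2 * a\<^sup>2 + 1) * H" using True by (simp add: algebra_simps)
    also have "\<dots> \<le> 2 * E + (2 * a\<^sup>2 + 1) * (H + sqrt (c * G * s\<^sup>2))"
      using nonneg G0 by (intro add_left_mono mult_left_mono) auto
    finally show ?thesis by (simp add: H_def)
  next
    case False
    show ?thesis
    proof (cases "H = 0")
      case True
      have "R \<le> 2 * E + e" if e: "0 < e" for e
      proof -
        have c: "0 < c" using False True by simp
        \<comment> \<open>Nothing is left to balance when \<open>H = 0\<close>: the bound is
          \<open>2 * E + x * c\<close>, and \<open>x\<close> may be as small as desired.\<close>
        define x where "x = min 1 (e / c)"
        have "R \<le> 2 * E + x * c"
          using main[of x] True e c by (simp add: x_def)
        moreover have "x * c \<le> e / c * c" using c by (intro mult_right_mono) (auto simp: x_def)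
        ultimately show ?thesis using c by simp
      qed
      then have "R \<le> 2 * E" by (rule field_le_epsilon)
      moreover have "0 \<le> (2 * a\<^sup>2 + 1) * (G * s\<^sup>2 + sqrt (c * G * s\<^sup>2))"
        using nonneg G0 by (intro mult_nonneg_nonneg) auto
      ultimately show ?thesis by linarith
    next
      case H: False
      then have Hp: "0 < H" "0 < c" using H0 False by auto
      \<comment> \<open>Makes \<open>H / x\<close> and \<open>x * c\<close> equal; it is at most 1
        because \<open>H < c\<close> here.\<close>
      define x where "x = sqrt H / sqrt c"
      have x: "0 < x" "x \<le> 1" using Hp False by (auto simp: x_def)
      have "x * c = sqrt (c * H)"
        using Hp by (simp add: x_def real_sqrt_mult field_simps)
      moreover have "H / x = sqrt (c * H)"
        using Hp by (simp add: x_def real_sqrt_mult real_div_sqrt divide_simps)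
      moreover have "R \<le> 2 * E + 2 * a\<^sup>2 * (H / x) + x * c"
        using main[OF x] by simp
      ultimately have "R \<le> 2 * E + (2 * a\<^sup>2 + 1) * sqrt (c * H)"
        by (simp only: distrib_right mult_1_left add.assoc)
      also have "\<dots> \<le> 2 * E + (2 * a\<^sup>2 + 1) * (H + sqrt (c * H))"
        using H0 by (intro add_left_mono mult_left_mono) auto
      finally show ?thesis by (simp add: H_def mult.assoc)
    qed
  qed
qed

section \<open>Regret of the virtual iterate and the deviation term\<close>

context ftrl_log_barrier_run
begin

lemma integrable_loss: "t < T \<Longrightarrow> i < K \<Longrightarrow> integrable M (\<lambda>w. snd w t i)"
proof (rule integrable_const_bound[where B = 1])
  assume "t < T" "i < K"
  show "AE w in M. norm (snd w t i) \<le> 1"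
    using losses by eventually_elim (use \<open>t < T\<close> \<open>i < K\<close> in auto)
qed measurable

lemma pseudo_regret_eq:
  assumes best: "is_best_arm K T M istar"
  shows "pseudo_regret K T M = expectation (\<lambda>w. \<Sum>t<T. snd w t (fst w t)) - (\<Sum>t<T. expectation (\<lambda>w. snd w t istar))"
proof -
  have "Min ((\<lambda>i. \<integral>w. cum_loss_arm T i w \<partial>M) ` {..<K}) = (\<integral>w. cum_loss_arm T istar w \<partial>M)"
    using best by (intro Min_eqI) (auto simp: is_best_arm_def)
  also have "\<dots> = (\<Sum>t<T. expectation (\<lambda>w. snd w t istar))"
    using best unfolding cum_loss_arm_def
    by (intro Bochner_Integration.integral_sum integrable_loss) (auto simp: is_best_arm_def)
  finally show ?thesis by (simp add: pseudo_regret_def)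
qed

text \<open>The virtual weights sum to one, so the loss of \<open>istar\<close> can be subtracted
  inside the weighted sum.\<close>

lemma regret_le_comparator:
  assumes best: "is_best_arm K T M istar" and U: "U \<subseteq> {..<K}" "U \<noteq> {}"
  shows "pseudo_regret K T M \<le>
    (\<Sum>t<T. \<Sum>i\<in>U. expectation (\<lambda>w. virt U t w i * (snd w t i - snd w t istar))) + regret_bound U"
proof -
  have istar: "istar < K" using best by (simp add: is_best_arm_def)
  have "(\<Sum>i\<in>U. expectation (\<lambda>w. virt U t w i * (snd w t i - snd w t istar)))
      = (\<Sum>i\<in>U. expectation (\<lambda>w. virt U t w i * snd w t i)) - expectation (\<lambda>w. snd w t istar)"
    if t: "t < T" for t
  proof -
    have int: "integrable M (\<lambda>w. virt U t w i * snd w t istar)" for i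
    proof (rule Bochner_Integration.integrable_bound[OF integrable_loss[OF t istar]])
      show "AE w in M. norm (virt U t w i * snd w t istar) \<le> norm (snd w t istar)"
        using virt_nonneg[OF U] virt_le_1[OF U] by (intro AE_I2) (simp add: abs_mult mult_left_le_one_le)
      show "(\<lambda>w. virt U t w i * snd w t istar) \<in> borel_measurable M"
        using virt_measurable_M[OF U] by measurable
    qed
    have "(\<Sum>i\<in>U. expectation (\<lambda>w. virt U t w i * (snd w t i - snd w t istar)))
        = (\<Sum>i\<in>U. expectation (\<lambda>w. virt U t w i * snd w t i) - expectation (\<lambda>w. virt U t w i * snd w t istar))"
      using integrable_virt_loss[OF U t] int
      by (intro sum.cong refl) (simp add: right_diff_distrib)
    also have "\<dots> = (\<Sum>i\<in>U. expectation (\<lambda>w. virt U t w i * snd w t i))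
        - expectation (\<lambda>w. \<Sum>i\<in>U. virt U t w i * snd w t istar)"
      using int by (simp add: sum_subtractf)
    also have "(\<lambda>w. \<Sum>i\<in>U. virt U t w i * snd w t istar) = (\<lambda>w. snd w t istar)"
      by (simp add: virt_sum[OF U] flip: sum_distrib_right)
    finally show ?thesis .
  qed
  then show ?thesis
    using learner_loss_le[OF U] pseudo_regret_eq[OF best] by (simp add: sum_subtractf)
qed

lemma regret_le_best_arm:
  assumes best: "is_best_arm K T M istar"
  shows "pseudo_regret K T M \<le> regret_bound {istar}"
  using regret_le_comparator[OF best, of "{istar}"] best by (simp add: is_best_arm_def)

text \<open>A predictable weight passes through the conditional expectation, and a convex
  combination is at most the maximum. The weights are general because a point mass on one arm is
  needed besides the virtual iterate.\<close>

lemma sum_weighted_deviation_le: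
  assumes U: "opt_arms K \<Delta> \<noteq> {}" and istar: "istar < K"
    and f: "\<And>t i. (\<lambda>w. f t w i) \<in> borel_measurable (hist_before t)"
      "\<And>t w i. 0 \<le> f t w i" "\<And>t w i. f t w i \<le> 1" "\<And>t w. (\<Sum>i\<in>opt_arms K \<Delta>. f t w i) = 1"
  shows "(\<Sum>t<T. \<Sum>i\<in>opt_arms K \<Delta>. expectation (\<lambda>w. f t w i * (snd w t i - snd w t istar)))
    \<le> expectation (opt_deviation K T M \<Delta> istar)"
proof -
  let ?U = "opt_arms K \<Delta>"
  let ?Y = "\<lambda>t i. real_cond_exp M (hist_before t) (\<lambda>v. snd v t i - snd v t istar)"
  let ?X = "\<lambda>t w. Max ((\<lambda>i. ?Y t i w) ` ?U)"
  have finU: "finite ?U" and UK: "?U \<subseteq> {..<K}" by (auto simp: opt_arms_def)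
  have sub: "sigma_finite_subalgebra M (hist_before t)" for t
    unfolding hist_before_def
    by (intro finite_measure_subalgebra_is_sigma_finite)
       (simp add: finite_measure_subalgebra_def finite_measure_subalgebra_axioms_def
          finite_measure_axioms subalgebra_hist_alg)
  have f_M [measurable]: "(\<lambda>w. f t w i) \<in> borel_measurable M" for t i
    using measurable_from_subalg[OF subalgebra_hist_alg] f(1) unfolding hist_before_def by blast
  have intd: "integrable M (\<lambda>w. snd w t i - snd w t istar)" if "t < T" "i \<in> ?U" for t i
    using that UK istar integrable_loss by auto
  have intY: "integrable M (?Y t i)" if "t < T" "i \<in> ?U" for t i
    using sigma_finite_subalgebra.real_cond_exp_int(1)[OF sub intd[OF that]] .
  have intX: "integrable M (?X t)" if t: "t < T" for t
  proof (rule Bochner_Integration.integrable_bound)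
    show "integrable M (\<lambda>w. \<Sum>i\<in>?U. \<bar>?Y t i w\<bar>)" using intY[OF t] by simp
    show "?X t \<in> borel_measurable M" using finU by measurable
    have "\<bar>?X t w\<bar> \<le> (\<Sum>i\<in>?U. \<bar>?Y t i w\<bar>)" for w
    proof -
      have "?X t w \<in> (\<lambda>i. ?Y t i w) ` ?U" using finU U by (intro Max_in) auto
      then obtain i where "i \<in> ?U" "?X t w = ?Y t i w" by blast
      then show ?thesis using finU member_le_sum[of i ?U "\<lambda>i. \<bar>?Y t i w\<bar>"] by simp
    qed
    then show "AE w in M. norm (?X t w) \<le> norm (\<Sum>i\<in>?U. \<bar>?Y t i w\<bar>)"
      by (intro AE_I2) (simp add: sum_nonneg abs_of_nonneg)
  qed
  have "(\<Sum>i\<in>?U. expectation (\<lambda>w. f t w i * (snd w t i - snd w t istar))) \<le> expectation (?X t)"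
    if t: "t < T" for t
  proof -
    have int_f: "integrable M (\<lambda>w. f t w i * (snd w t i - snd w t istar))" if "i \<in> ?U" for i
    proof (rule Bochner_Integration.integrable_bound[OF intd[OF t that]])
      show "AE w in M. norm (f t w i * (snd w t i - snd w t istar)) \<le> norm (snd w t i - snd w t istar)"
        using f by (intro AE_I2) (simp add: abs_mult mult_left_le_one_le)
    qed measurable
    have cond: "integrable M (\<lambda>w. f t w i * ?Y t i w)"
      "expectation (\<lambda>w. f t w i * ?Y t i w) = expectation (\<lambda>w. f t w i * (snd w t i - snd w t istar))"
      if "i \<in> ?U" for i
      using sigma_finite_subalgebra.real_cond_exp_intg[OF sub int_f[OF that] f(1)] by auto
    have "(\<Sum>i\<in>?U. expectation (\<lambda>w. f t w i * (snd w t i - snd w t istar)))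
        = expectation (\<lambda>w. \<Sum>i\<in>?U. f t w i * ?Y t i w)"
      using cond by simp
    also have "\<dots> \<le> expectation (?X t)"
    proof (rule integral_mono)
      fix w
      have "(\<Sum>i\<in>?U. f t w i * ?Y t i w) \<le> (\<Sum>i\<in>?U. f t w i * ?X t w)"
        using finU f(2) by (intro sum_mono mult_left_mono Max_ge) auto
      also have "\<dots> = ?X t w" using f(4)[of t w] by (simp flip: sum_distrib_right)
      finally show "(\<Sum>i\<in>?U. f t w i * ?Y t i w) \<le> ?X t w" .
    qed (use cond intX[OF t] in auto)
    finally show ?thesis .
  qed
  then have "(\<Sum>t<T. \<Sum>i\<in>?U. expectation (\<lambda>w. f t w i * (snd w t i - snd w t istar))) \<le> (\<Sum>t<T. expectation (?X t))"
    by (intro sum_mono) auto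
  also have "\<dots> = expectation (opt_deviation K T M \<Delta> istar)"
    unfolding opt_deviation_def[abs_def] using U intX by simp
  finally show ?thesis .
qed

lemma regret_le_opt_arms:
  assumes best: "is_best_arm K T M istar" and U: "opt_arms K \<Delta> \<noteq> {}"
  shows "pseudo_regret K T M \<le> expectation (opt_deviation K T M \<Delta> istar) + regret_bound (opt_arms K \<Delta>)"
proof -
  have UK: "opt_arms K \<Delta> \<subseteq> {..<K}" by (auto simp: opt_arms_def)
  show ?thesis
    using regret_le_comparator[OF best UK U]
      sum_weighted_deviation_le[OF U, of istar "virt (opt_arms K \<Delta>)"] best
      virt_measurable_hist_before[OF UK U] virt_nonneg[OF UK U] virt_le_1[OF UK U] virt_sum[OF UK U]
    by (simp add: is_best_arm_def)
qed

text \<open>A fixed arm of \<open>opt_arms\<close> does no better than \<open>istar\<close> in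
  expectation, and a point mass on it is predictable. This yields 0 \<le> \<open>D\<close>, needed
  for a nonnegative error term in the self-bounding step.\<close>

lemma opt_deviation_nonneg:
  assumes best: "is_best_arm K T M istar"
  shows "0 \<le> expectation (opt_deviation K T M \<Delta> istar)"
proof (cases "opt_arms K \<Delta> = {}")
  case True
  then show ?thesis by (simp add: opt_deviation_def[abs_def])
next
  case False
  then obtain k where k: "k \<in> opt_arms K \<Delta>" by blast
  then have kK: "k < K" and fin: "finite (opt_arms K \<Delta>)" by (auto simp: opt_arms_def)
  have istar: "istar < K" using best by (simp add: is_best_arm_def)
  have cum: "expectation (cum_loss_arm T i) = (\<Sum>t<T. expectation (\<lambda>w. snd w t i))" if "i < K" for i
    unfolding cum_loss_arm_def[abs_def] using that
    by (intro Bochner_Integration.integral_sum integrable_loss) auto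
  have "0 \<le> expectation (cum_loss_arm T k) - expectation (cum_loss_arm T istar)"
    using best kK by (simp add: is_best_arm_def)
  also have "\<dots> = (\<Sum>t<T. expectation (\<lambda>w. snd w t k - snd w t istar))"
    using integrable_loss kK istar by (simp add: cum sum_subtractf)
  also have "\<dots> = (\<Sum>t<T. \<Sum>i\<in>opt_arms K \<Delta>. expectation (\<lambda>w. of_bool (i = k) * (snd w t i - snd w t istar)))"
  proof (intro sum.cong refl)
    fix t
    have "(\<Sum>i\<in>opt_arms K \<Delta>. expectation (\<lambda>w. of_bool (i = k) * (snd w t i - snd w t istar)))
        = (\<Sum>i\<in>{k}. expectation (\<lambda>w. of_bool (i = k) * (snd w t i - snd w t istar)))"
      using k fin by (intro sum.mono_neutral_right) auto
    then show "expectation (\<lambda>w. snd w t k - snd w t istar)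
      = (\<Sum>i\<in>opt_arms K \<Delta>. expectation (\<lambda>w. of_bool (i = k) * (snd w t i - snd w t istar)))" by simp
  qed
  also have "\<dots> \<le> expectation (opt_deviation K T M \<Delta> istar)"
    using k fin by (intro sum_weighted_deviation_le False istar) (auto simp: of_bool_def sum.delta)
  finally show ?thesis .
qed

lemma pulls_nonneg: "0 \<le> pulls j"
  by (simp add: pulls_def sum_nonneg)

lemma sum_pulls: "(\<Sum>j<K. pulls j) = T"
proof -
  have "(\<Sum>j<K. pulls j) = (\<Sum>j<K. expectation (mass j))" by (simp add: expectation_mass)
  also have "\<dots> = expectation (\<lambda>w. \<Sum>j<K. mass j w)"
  proof -
    have "integrable M (mass j)" for j
      using mass_bounds by (intro integrable_const_bound[where B = T]) auto
    then show ?thesis by simp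
  qed
  also have "(\<lambda>w. \<Sum>j<K. mass j w) = (\<lambda>_. T)"
    unfolding mass_def by (subst sum.swap) (simp add: play_sum)
  finally show ?thesis using prob_space by simp
qed

lemma self_bounding_pulls:
  assumes "self_bounding K T M \<Delta> c"
  shows "(\<Sum>j<K. \<Delta> j * pulls j) - c \<le> pseudo_regret K T M"
proof -
  have "(\<Sum>t<T. \<Sum>i<K. measure M {w\<in>space M. fst w t = i} * \<Delta> i) = (\<Sum>j<K. \<Delta> j * pulls j)"
    by (subst sum.swap) (simp add: pulls_def sum_distrib_left mult.commute)
  then show ?thesis using assms by (simp add: self_bounding_def)
qed

lemma regret_le_T:
  assumes best: "is_best_arm K T M istar"
  shows "pseudo_regret K T M \<le> T"
proof -
  have istar: "istar < K" using best by (simp add: is_best_arm_def)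
  have "expectation (\<lambda>w. \<Sum>t<T. snd w t (fst w t)) = (\<Sum>t<T. expectation (\<lambda>w. snd w t (fst w t)))"
    using integrable_chosen_loss by (intro Bochner_Integration.integral_sum) auto
  also have "\<dots> \<le> (\<Sum>t<T. 1)"
  proof (rule sum_mono)
    fix t assume t: "t \<in> {..<T}"
    have "AE w in M. snd w t (fst w t) \<le> 1"
      using losses arms by eventually_elim (use t in auto)
    then have "expectation (\<lambda>w. snd w t (fst w t)) \<le> expectation (\<lambda>_. 1)"
      using t integrable_chosen_loss by (intro integral_mono_AE) auto
    then show "expectation (\<lambda>w. snd w t (fst w t)) \<le> 1" using prob_space by simp
  qed
  finally have "expectation (\<lambda>w. \<Sum>t<T. snd w t (fst w t)) \<le> T" by simp
  moreover have "0 \<le> (\<Sum>t<T. expectation (\<lambda>w. snd w t istar))"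
  proof (intro sum_nonneg integral_nonneg_AE)
    fix t assume t: "t \<in> {..<T}"
    show "AE w in M. 0 \<le> snd w t istar" using losses by eventually_elim (use t istar in auto)
  qed
  ultimately show ?thesis using pseudo_regret_eq[OF best] by linarith
qed

lemma ex_best_arm: "\<exists>istar. is_best_arm K T M istar"
proof -
  let ?f = "\<lambda>i. \<integral>w. cum_loss_arm T i w \<partial>M"
  have "Min (?f ` {..<K}) \<in> ?f ` {..<K}" using K_pos by (intro Min_in) auto
  then obtain i where "i < K" "Min (?f ` {..<K}) = ?f i" by auto
  then show ?thesis
    unfolding is_best_arm_def by (metis Min_le finite_imageI finite_lessThan image_eqI lessThan_iff)
qed

end

section \<open>The tuned parameters and their constants\<close>

lemma ln_ge_half: "2 \<le> x \<Longrightarrow> 1 / 2 \<le> ln x" for x :: real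
proof -
  assume x: "2 \<le> x"
  have "ln (1 / 2) \<le> (1 / 2 :: real) - 1" by (rule ln_le_minus_one) simp
  then have "1 / 2 \<le> ln (2 :: real)" by (simp add: ln_div)
  also have "\<dots> \<le> ln x" using x by simp
  finally show ?thesis .
qed

locale ftrl_tuned_run = ftrl_log_barrier_run K T "sqrt (1 / ln (real T))" 162 M
  for K T :: nat and M :: "traj measure" +
  assumes K_ge: "2 \<le> K"
begin

abbreviation "s \<equiv> sqrt (ln (real T))"

lemma T_ge: "2 \<le> real T"
  using K_ge K_le_T by simp

lemma ln_T: "1 / 2 \<le> ln (real T)"
  using T_ge by (rule ln_ge_half)

lemma s_facts: "0 < s" "s * s = ln (real T)" "s \<le> 2 * ln (real T)" "1 / s \<le> 2 * s" "ln (real T) / s = s"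
    "sqrt (1 / ln (real T)) = 1 / s"
proof -
  show s0: "0 < s" and ss: "s * s = ln (real T)" using ln_T by auto
  have "1 / 2 \<le> s" using ln_T by (intro real_le_rsqrt) (auto simp: power2_eq_square)
  then have "s * 1 \<le> s * (2 * s)" using s0 by (intro mult_left_mono) auto
  moreover have "s * (2 * s) = 2 * (s * s)" by simp
  ultimately show "s \<le> 2 * ln (real T)" using ss by linarith
  have "2 * s * s = 2 * ln (real T)" using ss by (simp only: mult.assoc)
  then have "1 \<le> 2 * s * s" using ln_T by linarith
  then show "1 / s \<le> 2 * s" using s0 by (simp add: pos_divide_le_eq)
  show "ln (real T) / s = s" using s0 ss by (simp add: field_simps)
  show "sqrt (1 / ln (real T)) = 1 / s" by (simp add: real_sqrt_divide)
qed

text \<open>12 = 10 + 2: the terminal rates contribute \<open>S / s\<close> times ln (2T) \<le> 2 ln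
  T. 333 = 324 + 8 + 1, from 2 * 162, from 4 m s \<le> 8 m ln T and from m / 2 \<le> m ln T.\<close>

lemma regret_bound_le:
  assumes U: "U \<subseteq> {..<K}"
  defines "V \<equiv> {..<K} - U"
  shows "regret_bound U \<le> 12 * s * (\<Sum>j\<in>V. sqrt (pulls j)) + 2 * s * sqrt (card U * (\<Sum>j\<in>V. pulls j))
    + 333 * (K * ln T) + card U * (162 + sqrt (2 + T) / s) * (card V / T)"
proof -
  define S where "S = (\<Sum>j\<in>V. sqrt (pulls j))"
  define m where "m = real (card V)"
  have S0: "0 \<le> S" unfolding S_def by (intro sum_nonneg) (simp add: pulls_nonneg)
  have "card V \<le> card {..<K}" unfolding V_def by (intro card_mono) auto
  then have m: "0 \<le> m" "m \<le> K" by (auto simp: m_def)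
  have ln2T: "ln (2 * real T) \<le> 2 * ln (real T)"
    using T_ge by (simp add: ln_mult)
  have "(\<Sum>j\<in>V. 162 + 1 / s * (2 + sqrt (pulls j))) = m * (162 + 2 / s) + S / s"
    by (simp add: S_def m_def sum.distrib sum_divide_distrib[symmetric] add_divide_distrib algebra_simps)
  then have "(\<Sum>j\<in>V. 162 + 1 / s * (2 + sqrt (pulls j))) * ln (2 * real T)
      \<le> (m * (162 + 2 / s) + S / s) * (2 * ln (real T))"
    using ln2T m S0 s_facts(1) by (simp only:) (intro mult_left_mono add_nonneg_nonneg mult_nonneg_nonneg divide_nonneg_nonneg; simp)
  also have "\<dots> = 324 * (m * ln T) + 4 * m * (ln T / s) + 2 * S * (ln T / s)"
    by (simp add: algebra_simps)
  also have "\<dots> = 324 * (m * ln T) + 4 * (m * s) + 2 * s * S"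
    by (simp only: s_facts(5)) simp
  also have "m * s \<le> m * (2 * ln T)" using m s_facts(3) by (intro mult_left_mono) auto
  finally have 1: "(\<Sum>j\<in>V. 162 + 1 / s * (2 + sqrt (pulls j))) * ln (2 * real T) \<le> 332 * (m * ln T) + 2 * s * S"
    by simp
  have 2: "m / 2 \<le> m * ln T" using m ln_T mult_left_mono[of "1/2" "ln T" m] by simp
  have 3: "m * ln T \<le> K * ln T" using m ln_T by (intro mult_right_mono) auto
  have "regret_bound U = 10 * s * S + 2 * s * sqrt (card U * (\<Sum>j\<in>V. pulls j)) + m / 2
      + (\<Sum>j\<in>V. 162 + 1 / s * (2 + sqrt (pulls j))) * ln (2 * real T)
      + card U * (162 + sqrt (2 + T) / s) * (card V / T)"
    by (subst regret_bound_def) (simp add: V_def[symmetric] S_def m_def s_facts(6))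
  then show ?thesis using 1 2 3 by (simp add: S_def)
qed

text \<open>With \<open>U\<close> a single best arm, Cauchy-Schwarz over the pulls gives the root.
  The lower-order K ln T is below it when K ln T \<le> T; otherwise the trivial bound
  \<open>T\<close> is.\<close>

lemma adversarial_regret: "pseudo_regret K T M \<le> 673 * sqrt (real K * T * ln T)"
proof -
  obtain istar where best: "is_best_arm K T M istar" using ex_best_arm by blast
  then have istar: "istar < K" by (simp add: is_best_arm_def)
  define R where "R = sqrt (real K * T * ln T)"
  have R0: "0 \<le> R" unfolding R_def using ln_T by simp
  show ?thesis
  proof (cases "K * ln T \<le> T")
    case False
    have "real T * T \<le> T * (K * ln T)" using False by (intro mult_left_mono) auto
    then have "real T \<le> R" unfolding R_def by (intro real_le_rsqrt) (simp add: power2_eq_square mult_ac)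
    then show ?thesis using regret_le_T[OF best] R0 by (simp add: R_def)
  next
    case True
    define V where "V = {..<K} - {istar}"
    have n_le: "(\<Sum>j\<in>V. pulls j) \<le> T"
      using sum_pulls sum_mono2[of "{..<K}" V pulls] pulls_nonneg by (auto simp: V_def)
    have V_card: "real (card V) \<le> K" using card_mono[of "{..<K}" V] by (auto simp: V_def)
    have R_eq: "R = s * sqrt (real K * T)" by (simp add: R_def real_sqrt_mult mult_ac)
    have "(\<Sum>j\<in>V. sqrt (pulls j)) \<le> sqrt (real K * T)"
    proof (rule real_le_rsqrt)
      have "(\<Sum>j\<in>V. sqrt (pulls j))\<^sup>2 \<le> card V * (\<Sum>j\<in>V. pulls j)"
        using Cauchy_Schwarz_ineq_sum[of "\<lambda>_. 1" "\<lambda>j. sqrt (pulls j)" V] pulls_nonneg by simp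
      also have "\<dots> \<le> real K * T" using n_le V_card pulls_nonneg by (intro mult_mono sum_nonneg) auto
      finally show "(\<Sum>j\<in>V. sqrt (pulls j))\<^sup>2 \<le> real K * T" .
    qed
    then have 1: "12 * s * (\<Sum>j\<in>V. sqrt (pulls j)) \<le> 12 * R"
      unfolding R_eq using s_facts(1) by (simp add: mult_left_mono)
    have "1 * real T \<le> real K * T" using K_pos by (intro mult_right_mono) auto
    then have "sqrt (\<Sum>j\<in>V. pulls j) \<le> sqrt (real K * T)" using n_le by (intro real_sqrt_le_mono) linarith
    then have 2: "2 * s * sqrt (card {istar} * (\<Sum>j\<in>V. pulls j)) \<le> 2 * R"
      unfolding R_eq using s_facts(1) by (simp add: mult_left_mono)
    have 3: "K * ln T \<le> R"
    proof -
      have "(K * ln T) * (K * ln T) \<le> (K * ln T) * T" using True ln_T by (intro mult_left_mono) auto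
      then show ?thesis unfolding R_def by (intro real_le_rsqrt) (simp add: power2_eq_square mult_ac)
    qed
    have 4: "1 \<le> K * ln T"
    proof -
      have "2 * (1 / 2) \<le> K * ln T" using K_ge ln_T by (intro mult_mono) auto
      then show ?thesis by simp
    qed
    have 5: "sqrt (2 + T) / s \<le> 2 * R"
    proof -
      have "2 * real T \<le> real K * T" using K_ge by (intro mult_right_mono) auto
      then have "2 + real T \<le> real K * T" using T_ge by linarith
      then have "sqrt (2 + T) * (1 / s) \<le> sqrt (real K * T) * (2 * s)"
        using s_facts by (intro mult_mono) auto
      then show ?thesis by (simp add: R_eq mult_ac)
    qed
    have "(162 + sqrt (2 + T) / s) * (card V / T) \<le> (162 + sqrt (2 + T) / s) * 1"
      using s_facts(1) V_card K_le_T T_pos by (intro mult_left_mono) auto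
    then have 6: "card {istar} * (162 + sqrt (2 + T) / s) * (card V / T) \<le> 164 * R"
      using 3 4 5 by simp
    have "pseudo_regret K T M \<le> 12 * R + 2 * R + 333 * R + 164 * R"
      using regret_le_best_arm[OF best] regret_bound_le[of "{istar}"] istar 1 2 3 6
      by (simp add: V_def)
    then show ?thesis using R0 unfolding R_def by linarith
  qed
qed

lemma stochastic_regret:
  assumes sb: "self_bounding K T M \<Delta> c" and ne: "subopt_arms K \<Delta> \<noteq> {}"
    and best: "is_best_arm K T M istar" and D: "expectation (opt_deviation K T M \<Delta> istar) \<le> D"
  shows "pseudo_regret K T M \<le> 1314 * (gap_complexity K \<Delta> * ln T + sqrt (c * gap_complexity K \<Delta> * ln T)
    + K\<^sup>2 / sqrt (ln T) + K * ln T + D)"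
proof -
  define \<delta> where "\<delta> = Min (\<Delta> ` subopt_arms K \<Delta>)"
  \<comment> \<open>\<open>U\<close> must be nonempty: if every gap is positive, a best arm stands
    in for the missing optimal arms.\<close>
  define U where "U = (if opt_arms K \<Delta> = {} then {istar} else opt_arms K \<Delta>)"
  define V where "V = {..<K} - U"
  define G where "G = gap_complexity K \<Delta>"
  have istar: "istar < K" using best by (simp add: is_best_arm_def)
  have D0: "0 \<le> D" using opt_deviation_nonneg[OF best, of \<Delta>] D by linarith
  have \<Delta>0: "0 \<le> \<Delta> i" if "i < K" for i using sb that by (auto simp: self_bounding_def)
  have c0: "0 \<le> c" using sb by (simp add: self_bounding_def)
  have fin: "finite (subopt_arms K \<Delta>)" by (simp add: subopt_arms_def)
  have sub_pos: "0 < \<Delta> j" if "j \<in> subopt_arms K \<Delta>" for j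
    using that \<Delta>0[of j] by (auto simp: subopt_arms_def order_less_le)
  have \<delta>_in: "\<delta> \<in> \<Delta> ` subopt_arms K \<Delta>" unfolding \<delta>_def using fin ne by (intro Min_in) auto
  then have \<delta>0: "0 < \<delta>" using sub_pos by auto
  have \<delta>_le: "\<delta> \<le> \<Delta> j" if "j \<in> subopt_arms K \<Delta>" for j
    unfolding \<delta>_def using that fin by (intro Min_le) auto
  have UK: "U \<subseteq> {..<K}" using istar by (auto simp: U_def opt_arms_def)
  have VS: "V \<subseteq> subopt_arms K \<Delta>" by (auto simp: V_def U_def opt_arms_def subopt_arms_def split: if_splits)
  have inv_nonneg: "0 \<le> 1 / \<Delta> j" if "j \<in> subopt_arms K \<Delta>" for j using sub_pos[OF that] by simp
  have G_eq: "G = card (opt_arms K \<Delta>) / \<delta> + (\<Sum>j\<in>subopt_arms K \<Delta>. 1 / \<Delta> j)"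
    by (simp add: G_def gap_complexity_def \<delta>_def)
  \<comment> \<open>The factor 2 pays for that replacement: then \<open>card U / \<delta>\<close> is
    \<open>1 / \<delta>\<close>, itself one of the summands of the gap complexity.\<close>
  have G_le: "card U / \<delta> + (\<Sum>j\<in>V. 1 / \<Delta> j) \<le> 2 * G"
  proof -
    have sV: "(\<Sum>j\<in>V. 1 / \<Delta> j) \<le> (\<Sum>j\<in>subopt_arms K \<Delta>. 1 / \<Delta> j)"
      using fin VS inv_nonneg by (intro sum_mono2) auto
    obtain j where j: "j \<in> subopt_arms K \<Delta>" "\<delta> = \<Delta> j" using \<delta>_in by blast
    have "1 / \<delta> \<le> (\<Sum>j\<in>subopt_arms K \<Delta>. 1 / \<Delta> j)"
      unfolding j(2) using fin inv_nonneg j(1) by (intro member_le_sum) auto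
    moreover have "0 \<le> card (opt_arms K \<Delta>) / \<delta>" using \<delta>0 by simp
    moreover have "0 \<le> (\<Sum>j\<in>subopt_arms K \<Delta>. 1 / \<Delta> j)" using inv_nonneg by (intro sum_nonneg)
    ultimately show ?thesis using sV unfolding G_eq U_def by (auto split: if_splits)
  qed
  have G0: "0 \<le> G" unfolding G_eq using \<delta>0 inv_nonneg by (intro add_nonneg_nonneg sum_nonneg) auto
  \<comment> \<open>657 = 333 + 324, the second part coming from the rates on \<open>U\<close> in
    \<open>last\<close>.\<close>
  define E where "E = D + 657 * (K * ln T) + K\<^sup>2 / s"
  \<comment> \<open>The constant 162 costs K ln T. The root costs \<open>card U * card V\<close>
    \<le> K^2 over \<open>s\<close>, since sqrt (2 + T) \<le> T.\<close>
  have last: "card U * (162 + sqrt (2 + T) / s) * (card V / T) \<le> 324 * (K * ln T) + K\<^sup>2 / s"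
  proof -
    have cU: "real (card U) \<le> K" using card_mono[OF _ UK] by simp
    have cV: "real (card V) \<le> K" using card_mono[of "{..<K}" V] by (auto simp: V_def)
    have VT: "card V / T \<le> 1" using cV K_le_T T_pos by simp
    have "card U * (162 + sqrt (2 + T) / s) * (card V / T)
        = 162 * (card U * (card V / T)) + (real (card U) * real (card V)) * (sqrt (2 + T) / T) / s"
      by (simp add: algebra_simps)
    also have "card U * (card V / T) \<le> real K * 1" using cU VT by (intro mult_mono) auto
    also have "(real (card U) * real (card V)) * (sqrt (2 + T) / T) / s \<le> (real K * real K) * 1 / s"
    proof -
      have "2 * real T \<le> real T * real T"
        using T_ge by (intro mult_right_mono) auto
      then have "2 + real T \<le> real T * real T"
        using T_ge by linarith
      then have "sqrt (2 + real T) \<le> T" by (intro real_le_lsqrt) (auto simp: power2_eq_square)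
      then have "sqrt (2 + real T) / T \<le> 1" using T_pos by simp
      then show ?thesis
        using cU cV s_facts(1) by (intro divide_right_mono mult_mono) auto
    qed
    also have "162 * (real K * 1) \<le> 324 * (K * ln T)"
      using mult_left_mono[OF ln_T, of "real K"] by simp
    finally show ?thesis by (simp add: power2_eq_square)
  qed
  have "pseudo_regret K T M \<le> D + regret_bound U"
  proof (cases "opt_arms K \<Delta> = {}")
    case True
    then show ?thesis using regret_le_best_arm[OF best] D0 by (simp add: U_def)
  next
    case False
    then show ?thesis using regret_le_opt_arms[OF best False] D by (simp add: U_def)
  qed
  also have "regret_bound U \<le> 12 * s * ((\<Sum>j\<in>V. sqrt (pulls j)) + sqrt (card U * (\<Sum>j\<in>V. pulls j)))
      + 657 * (K * ln T) + K\<^sup>2 / s"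
  proof -
    have "0 \<le> 10 * s * sqrt (card U * (\<Sum>j\<in>V. pulls j))"
      using s_facts(1) sum_nonneg[of V pulls] pulls_nonneg by (intro mult_nonneg_nonneg) auto
    then show ?thesis
      using regret_bound_le[OF UK] last unfolding V_def[symmetric] by (simp add: distrib_left)
  qed
  finally have R_le: "pseudo_regret K T M \<le> E
      + 12 * s * ((\<Sum>j\<in>V. sqrt (pulls j)) + sqrt (card U * (\<Sum>j\<in>V. pulls j)))"
    by (simp add: E_def)
  have "(\<Sum>j\<in>V. \<Delta> j * pulls j) \<le> (\<Sum>j<K. \<Delta> j * pulls j)"
    using \<Delta>0 pulls_nonneg by (intro sum_mono2) (auto simp: V_def)
  then have R_ge: "(\<Sum>j\<in>V. \<Delta> j * pulls j) - c \<le> pseudo_regret K T M"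
    using self_bounding_pulls[OF sb] by linarith
  have E0: "0 \<le> E" unfolding E_def using D0 ln_T s_facts(1) by simp
  \<comment> \<open>Used with \<open>a = 12\<close> and \<open>2 * G\<close>; the coefficient 289
    doubles to 578.\<close>
  have "pseudo_regret K T M \<le> 2 * E + (2 * 12\<^sup>2 + 1) * (2 * G * s\<^sup>2 + sqrt (c * (2 * G) * s\<^sup>2))"
    using VS \<delta>_le \<delta>0 s_facts(1) c0 E0 R_le R_ge G_le pulls_nonneg
    by (intro self_bounding_bound[where V = V and n = pulls and \<Delta> = \<Delta> and \<delta> = \<delta> and u = "card U"])
       (auto simp: V_def less_imp_le)
  also have "s\<^sup>2 = ln T" using ln_T by simp
  also have "sqrt (c * (2 * G) * ln T) \<le> 2 * sqrt (c * G * ln T)"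
  proof -
    have "0 \<le> c * G * ln T" using c0 G0 ln_T by simp
    then have "sqrt (c * (2 * G) * ln T) \<le> sqrt (4 * (c * G * ln T))"
      by (intro real_sqrt_le_mono) (simp add: mult_ac)
    then show ?thesis by (simp add: real_sqrt_mult)
  qed
  finally have R_E: "pseudo_regret K T M \<le> 2 * E + 578 * (G * ln T) + 578 * sqrt (c * G * ln T)" by simp
  \<comment> \<open>1314 = 2 * 657 is the largest coefficient.\<close>
  have combine: "r \<le> 1314 * (g + h + x + k + d)"
    if "r \<le> 2 * (d + 657 * k + x) + 578 * g + 578 * h" "0 \<le> g" "0 \<le> h" "0 \<le> x" "0 \<le> k" "0 \<le> d"
    for r g h x k d :: real
    using that by (simp add: distrib_left)
  show ?thesis
    unfolding G_def[symmetric]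
    by (rule combine[OF R_E[unfolded E_def]]) (use D0 G0 c0 ln_T s_facts(1) in auto)
qed

end

theorem theorem1:
  "\<exists>c>0. \<forall>K T M. 2 \<le> K \<longrightarrow> K \<le> T \<longrightarrow>
     ftrl_run K T (sqrt (1 / ln (real T))) 0 162 M \<longrightarrow>
       pseudo_regret K T M \<le> c * sqrt (real K * real T * ln (real T)) \<and>
       (\<forall>\<Delta> C istar D. self_bounding K T M \<Delta> C \<longrightarrow> subopt_arms K \<Delta> \<noteq> {} \<longrightarrow>
          is_best_arm K T M istar \<longrightarrow>
          (\<integral>w. opt_deviation K T M \<Delta> istar w \<partial>M) \<le> D \<longrightarrow>
          pseudo_regret K T M \<le> c * (gap_complexity K \<Delta> * ln (real T)
             + sqrt (C * gap_complexity K \<Delta> * ln (real T))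
             + real K ^ 2 / sqrt (ln (real T)) + real K * ln (real T) + D))"
proof (intro exI[of _ 1314] conjI allI impI)
  fix K T :: nat and M
  assume K: "2 \<le> K" "K \<le> T" and run: "ftrl_run K T (sqrt (1 / ln (real T))) 0 162 M"
  have "0 < ln (real T)" using K by simp
  then interpret ftrl_tuned_run K T M
    using K run by unfold_locales auto
  have "673 * sqrt (real K * real T * ln (real T)) \<le> 1314 * sqrt (real K * real T * ln (real T))"
    using ln_T by (intro mult_right_mono) auto
  then show "pseudo_regret K T M \<le> 1314 * sqrt (real K * real T * ln (real T))"
    using adversarial_regret by linarith
  fix \<Delta> C istar D
  assume "self_bounding K T M \<Delta> C" "subopt_arms K \<Delta> \<noteq> {}" "is_best_arm K T M istar"
    "(\<integral>w. opt_deviation K T M \<Delta> istar w \<partial>M) \<le> D"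
  then show "pseudo_regret K T M \<le> 1314 * (gap_complexity K \<Delta> * ln (real T)
             + sqrt (C * gap_complexity K \<Delta> * ln (real T))
             + real K ^ 2 / sqrt (ln (real T)) + real K * ln (real T) + D)"
    using stochastic_regret by simp
qed simp

end
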